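(* Let $\Gamma$ be a triangulation of a connected closed $2$-dimensional surface $M$ with a $z$-orientation $\tau$ such that every face of $\Gamma$ is of type I. Let $\Gamma_{II}$ be the subgraph of $\Gamma$ formed by all vertices of type II and all edges of type II, each edge of type II directed as induced by $\tau$, regarded as embedded in $M$. Then the following three conditions are equivalent: (1) every zigzag of $\Gamma$ is homogeneous; (2) $\Gamma_{II}$ is a closed $2$-cell embedding (in $M$) of a simple Eulerian digraph such that (the boundary of) every face is a directed cycle; (3) each connected component of $M\setminus\Gamma_{II}$ is homeomorphic to an open $2$-dimensional disk.
   Context: Let $M$ be a connected closed $2$-dimensional surface (not necessarily orientable). A triangulation $\Gamma$ of $M$ is a $2$-cell embedding of a connected simple finite graph in $M$ all of whose faces are triangles; every edge lies in exactly two distinct faces and two distinct faces meet in an edge, a vertex, or not at all. A zigzag in $\Gamma$ is a sequence of edges $(e_i)_{i\in\mathbb N}$ such that for every $i$: $e_i$ and $e_{i+1}$ are distinct edges of some face; the faces containing $e_i,e_{i+1}$ and $e_{i+1},e_{i+2}$ are distinct; and $e_i$, $e_{i+2}$ have no common vertex. A zigzag is periodic and is regarded as a cyclic sequence $e_1,\dots,e_n$ with $n$ minimal; the reversed sequence $Z^{-1}$ is also a zigzag and $Z\neq Z^{-1}$. A zigzag traverses each of its edges $e_i$ in a direction: from the common vertex of $e_{i-1},e_i$ to the common vertex of $e_i,e_{i+1}$. If $\Gamma$ has exactly $k$ zigzags up to reversal, a $z$-orientation $\tau$ is a set of $k$ zigzags containing exactly one of $Z,Z^{-1}$ for each zigzag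 $Z$. Each edge $e$ then occurs exactly twice in total among the zigzags of $\tau$; $e$ is of type I if these two occurrences traverse $e$ in opposite directions and of type II if in the same direction; an edge of type II is given that common direction. A vertex is of type I if all edges containing it are of type I, otherwise of type II. A face is of type I if it contains exactly two edges of type I and one edge of type II. A zigzag is homogeneous if it is a cyclic sequence of the form $\{e_i,e'_i,e''_i\}_{i=1}^n$ in which every $e_i$ is of type II and all $e'_i,e''_i$ are of type I. A $2$-cell embedding of a graph is closed if every face is homeomorphic to a closed $2$-dimensional disk. A digraph is Eulerian if it is connected and at every vertex the in-degree equals the out-degree. *)

theory Defs
  imports "HOL-Analysis.Analysis" "Graph_Theory.Digraph_Component"
begin

hide_const (open) Digraph_Component.connected

definition closed_surface :: "'a::t2_space set \<Rightarrow> bool" where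
  "closed_surface M \<longleftrightarrow>
     compact M \<and> connected M \<and> M \<noteq> {} \<and>
     (\<forall>x\<in>M. \<exists>U. x \<in> U \<and> openin (top_of_set M) U \<and> U homeomorphic ball (0::complex) 1)"


section \<open>Graphs embedded in a surface\<close>

text \<open>
  A graph embedded in M is given by its finite set V of vertices (points of M) and its finite set
  E of edges, each edge being a closed arc in M that contains exactly two vertices, namely its two
  endpoints. Hence there are no loops, and the set of endpoints of e is \<open>e \<inter> V\<close>. The
  last conjunct says that there are no multiple edges.
\<close>

definition simple_graph_embedding :: "'a::t2_space set \<Rightarrow> 'a set \<Rightarrow> 'a set set \<Rightarrow> bool" where
  "simple_graph_embedding M V E \<longleftrightarrow>
     finite V \<and> V \<noteq> {} \<and> V \<subseteq> M \<and> finite E \<and>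
     (\<forall>e\<in>E. e \<subseteq> M \<and> (\<exists>g. arc g \<and> path_image g = e \<and> e \<inter> V = {pathstart g, pathfinish g})) \<and>
     (\<forall>e\<in>E. \<forall>e'\<in>E. e \<noteq> e' \<longrightarrow> e \<inter> e' \<subseteq> V) \<and>
     (\<forall>e\<in>E. \<forall>e'\<in>E. e \<noteq> e' \<longrightarrow> e \<inter> V \<noteq> e' \<inter> V)"

definition graph_connected :: "'a set \<Rightarrow> 'a set set \<Rightarrow> bool" where
  "graph_connected V E \<longleftrightarrow>
     (\<forall>u\<in>V. \<forall>v\<in>V. (u, v) \<in> {(x, y). \<exists>e\<in>E. e \<inter> V = {x, y}}\<^sup>*)"

definition graph_faces :: "'a::t2_space set \<Rightarrow> 'a set \<Rightarrow> 'a set set \<Rightarrow> 'a set set" where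
  "graph_faces M V E = components (M - (V \<union> \<Union>E))"

definition two_cell_embedding :: "'a::t2_space set \<Rightarrow> 'a set \<Rightarrow> 'a set set \<Rightarrow> bool" where
  "two_cell_embedding M V E \<longleftrightarrow>
     simple_graph_embedding M V E \<and>
     (\<forall>F\<in>graph_faces M V E. F homeomorphic ball (0::complex) 1)"

text \<open>
  Faces are open regions here; the face together with its boundary is \<open>closure F\<close>. It is
  a closed disk \<^emph>\<open>as a cell\<close>: the homeomorphism has to match the interior of the disk
  with F and hence the bounding circle with \<open>closure F - F\<close>. Merely asking
  \<open>closure F\<close> to be homeomorphic to a disk would admit, for example, a disk slit along a
  pendant edge.
\<close>

definition closed_cell :: "'a::t2_space set \<Rightarrow> bool" where
  "closed_cell F \<longleftrightarrow>
     (\<exists>h k. homeomorphism (cball (0::complex) 1) (closure F) h k \<and> h ` ball 0 1 = F)"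

definition closed_two_cell_embedding :: "'a::t2_space set \<Rightarrow> 'a set \<Rightarrow> 'a set set \<Rightarrow> bool" where
  "closed_two_cell_embedding M V E \<longleftrightarrow>
     two_cell_embedding M V E \<and> (\<forall>F\<in>graph_faces M V E. closed_cell F)"

definition triangular :: "'a::t2_space set \<Rightarrow> 'a set set \<Rightarrow> 'a set \<Rightarrow> bool" where
  "triangular V E F \<longleftrightarrow>
     closed_cell F \<and>
     (\<exists>a b c e1 e2 e3. a \<noteq> b \<and> b \<noteq> c \<and> c \<noteq> a \<and> {e1, e2, e3} \<subseteq> E \<and>
        e1 \<inter> V = {a, b} \<and> e2 \<inter> V = {b, c} \<and> e3 \<inter> V = {c, a} \<and>
        closure F - F = e1 \<union> e2 \<union> e3)"

definition surface_triangulation :: "'a::t2_space set \<Rightarrow> 'a set \<Rightarrow> 'a set set \<Rightarrow> bool" where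
  "surface_triangulation M V E \<longleftrightarrow>
     two_cell_embedding M V E \<and> graph_connected V E \<and>
     (\<forall>F\<in>graph_faces M V E. triangular V E F) \<and>
     (\<forall>e\<in>E. card {F \<in> graph_faces M V E. e \<subseteq> closure F} = 2) \<and>
     (\<forall>F\<in>graph_faces M V E. \<forall>F'\<in>graph_faces M V E. F \<noteq> F' \<longrightarrow>
        closure F \<inter> closure F' \<in> E \<or>
        (\<exists>v\<in>V. closure F \<inter> closure F' = {v}) \<or>
        closure F \<inter> closure F' = {})"

definition face_edges :: "'a::t2_space set set \<Rightarrow> 'a set \<Rightarrow> 'a set set" where
  "face_edges E F = {e \<in> E. e \<subseteq> closure F}"


section \<open>Zigzags and z-orientations\<close>

definition zigzag_seq :: "'a::t2_space set \<Rightarrow> 'a set \<Rightarrow> 'a set set \<Rightarrow> (nat \<Rightarrow> 'a set) \<Rightarrow> bool" where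
  "zigzag_seq M V E s \<longleftrightarrow>
     (\<forall>i. s i \<noteq> s (i + 1) \<and>
        (\<exists>F\<in>graph_faces M V E. \<exists>F'\<in>graph_faces M V E. F \<noteq> F' \<and>
           {s i, s (i + 1)} \<subseteq> face_edges E F \<and>
           {s (i + 1), s (i + 2)} \<subseteq> face_edges E F') \<and>
        s i \<inter> s (i + 2) \<inter> V = {})"

definition least_period :: "(nat \<Rightarrow> 'b) \<Rightarrow> nat \<Rightarrow> bool" where
  "least_period s n \<longleftrightarrow>
     0 < n \<and> (\<forall>i. s (i + n) = s i) \<and> (\<forall>m. 0 < m \<and> m < n \<longrightarrow> (\<exists>i. s (i + m) \<noteq> s i))"

text \<open>
  A cyclic sequence is represented by the set of its linear readings, that is, by the set of all
  rotations of one list of length n, where n is the least period. By minimality of n, the n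
  readings are pairwise distinct, so a reading w amounts to a position in the cyclic
  sequence, namely that of \<open>hd w\<close>. The predecessor of this position is
  \<open>last w\<close> and its successor is \<open>w ! 1\<close>. Reversal of a cyclic sequence Z is
  \<open>rev ` Z\<close>.
\<close>

definition cyclic_seq :: "(nat \<Rightarrow> 'b) \<Rightarrow> nat \<Rightarrow> 'b list set" where
  "cyclic_seq s n = {map s [k..<k + n] |k. True}"

definition zigzags :: "'a::t2_space set \<Rightarrow> 'a set \<Rightarrow> 'a set set \<Rightarrow> 'a set list set set" where
  "zigzags M V E = {cyclic_seq s n |s n. zigzag_seq M V E s \<and> least_period s n}"

definition z_orientation ::
  "'a::t2_space set \<Rightarrow> 'a set \<Rightarrow> 'a set set \<Rightarrow> 'a set list set set \<Rightarrow> bool" where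
  "z_orientation M V E \<tau> \<longleftrightarrow>
     \<tau> \<subseteq> zigzags M V E \<and> (\<forall>Z\<in>zigzags M V E. (Z \<in> \<tau>) \<noteq> (rev ` Z \<in> \<tau>))"

text \<open>
  The occurrences of e in the zigzags of \<open>\<tau>\<close>, each given by the reading starting there.
\<close>

definition occurrences :: "'a set list set set \<Rightarrow> 'a set \<Rightarrow> 'a set list set" where
  "occurrences \<tau> e = {w \<in> \<Union>\<tau>. hd w = e}"

definition common_vertex :: "'a set \<Rightarrow> 'a set \<Rightarrow> 'a set \<Rightarrow> 'a" where
  "common_vertex V e e' = (THE v. v \<in> V \<and> v \<in> e \<and> v \<in> e')"

text \<open>Start and end of the traversal of \<open>hd w\<close> at the occurrence w.\<close>

definition direction :: "'a set \<Rightarrow> 'a set list \<Rightarrow> 'a \<times> 'a" where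
  "direction V w = (common_vertex V (last w) (hd w), common_vertex V (hd w) (w ! 1))"

definition edge_type_I :: "'a set \<Rightarrow> 'a set list set set \<Rightarrow> 'a set \<Rightarrow> bool" where
  "edge_type_I V \<tau> e \<longleftrightarrow>
     (\<exists>w w'. occurrences \<tau> e = {w, w'} \<and> w \<noteq> w' \<and>
        direction V w' = prod.swap (direction V w))"

definition edge_type_II :: "'a set \<Rightarrow> 'a set list set set \<Rightarrow> 'a set \<Rightarrow> bool" where
  "edge_type_II V \<tau> e \<longleftrightarrow>
     (\<exists>w w'. occurrences \<tau> e = {w, w'} \<and> w \<noteq> w' \<and> direction V w' = direction V w)"

definition edge_direction :: "'a set \<Rightarrow> 'a set list set set \<Rightarrow> 'a set \<Rightarrow> 'a \<times> 'a" where
  "edge_direction V \<tau> e = (THE d. \<forall>w\<in>occurrences \<tau> e. direction V w = d)"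

definition vertex_type_I :: "'a set \<Rightarrow> 'a set set \<Rightarrow> 'a set list set set \<Rightarrow> 'a \<Rightarrow> bool" where
  "vertex_type_I V E \<tau> v \<longleftrightarrow> (\<forall>e\<in>E. v \<in> e \<longrightarrow> edge_type_I V \<tau> e)"

definition face_type_I ::
  "'a::t2_space set \<Rightarrow> 'a set set \<Rightarrow> 'a set list set set \<Rightarrow> 'a set \<Rightarrow> bool" where
  "face_type_I V E \<tau> F \<longleftrightarrow>
     card {e \<in> face_edges E F. edge_type_I V \<tau> e} = 2 \<and>
     card {e \<in> face_edges E F. edge_type_II V \<tau> e} = 1"

definition homogeneous :: "'a set \<Rightarrow> 'a set list set set \<Rightarrow> 'a set list set \<Rightarrow> bool" where
  "homogeneous V \<tau> Z \<longleftrightarrow>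
     (\<exists>w\<in>Z. 3 dvd length w \<and>
        (\<forall>i<length w. if 3 dvd i then edge_type_II V \<tau> (w ! i) else edge_type_I V \<tau> (w ! i)))"


section \<open>The digraph of type II edges\<close>

definition Gamma_II ::
  "'a set \<Rightarrow> 'a set set \<Rightarrow> 'a set list set set \<Rightarrow> ('a, 'a set) pre_digraph" where
  "Gamma_II V E \<tau> =
     \<lparr>verts = {v \<in> V. \<not> vertex_type_I V E \<tau> v},
      arcs = {e \<in> E. edge_type_II V \<tau> e},
      tail = (\<lambda>e. fst (edge_direction V \<tau> e)),
      head = (\<lambda>e. snd (edge_direction V \<tau> e))\<rparr>"

definition eulerian :: "('a, 'b) pre_digraph \<Rightarrow> bool" where
  "eulerian G \<longleftrightarrow>
     Digraph_Component.connected G \<and> (\<forall>v\<in>verts G. in_degree G v = out_degree G v)"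

definition directed_cycle_boundary :: "('a::t2_space, 'a set) pre_digraph \<Rightarrow> 'a set \<Rightarrow> bool" where
  "directed_cycle_boundary G F \<longleftrightarrow>
     (\<exists>p. pre_digraph.cycle G p \<and> closure F - F = \<Union>(set p))"

end

theory Submission
  imports Defs
begin

text \<open>
  In a face of type I the edge of type II, say from x to y, and the third vertex z determine how the
  zigzags of the orientation run: zx to xy, xy to yz and zx to yz. Hence the zigzags enter the face
  through zx and leave it through yz, every edge of type I is crossed in one direction only, and the
  faces are arranged in cycles, glued along edges of type I. All three conditions are equivalent to
  z being of type I in every face. If the zigzags are homogeneous, then z is also the third vertex of
  the next face, so z stays constant along the cycle, which therefore is the whole star of z;
  conversely this determines the pattern of every zigzag. The star of a vertex of type I is a closed
  disk, glued triangle by triangle, and its boundary is a directed cycle. A cycle of faces without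
  vertex of type I is an open annulus or Moebius strip, which is not unicoherent and thus not a disk.
\<close>

text \<open>The proof splits into a part without zigzags and a part about them. The locale
  \<open>flow_triangulation\<close> keeps of the orientation only the directed edge of type II and
  the entry and exit edge of each face. The passages from disks to stars and from stars to the
  digraph happen there; zigzags are needed only to produce these data and for condition (1). Three
  obstacles shape the topology. The surface may be nonorientable, so the faces at a vertex come with
  no cyclic order; the star is obtained from the connectedness of a small punctured disk instead.
  The cells are given by unrelated homeomorphisms, which need not agree along a common edge, so a
  disk is reparametrised along its boundary before it is glued. Finally, an annulus and a Moebius
  strip would need separate models; cutting the cyclic band into one triangle and the rest exhibits
  two disjoint crosscuts in either case. Zigzags are given as infinite sequences up to rotation and
  reversal; the working form is a permutation of ordered pairs of edges of a face.\<close>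

section \<open>Gluing closed disks along an arc\<close>

text \<open>Alexander trick: the self-homeomorphism of the circle is extended radially.\<close>

lemma homeomorphism_cball_extend_sphere:
  fixes h :: "complex \<Rightarrow> 'a::t2_space" and g :: "complex \<Rightarrow> 'a"
  assumes h: "homeomorphism (cball 0 1) X h k" and hB: "h ` sphere 0 1 = B"
    and g: "continuous_on (sphere 0 1) g" "inj_on g (sphere 0 1)" "g ` sphere 0 1 = B"
  obtains h' k' where "homeomorphism (cball 0 1) X h' k'" "\<And>x. x \<in> sphere 0 1 \<Longrightarrow> h' x = g x"
proof -
  have hinj: "inj_on h (cball 0 1)" and hc: "continuous_on (cball 0 1) h" and kc: "continuous_on X k"
    and hX: "h ` cball 0 1 = X" and kh: "\<And>x. x \<in> cball 0 1 \<Longrightarrow> k (h x) = x"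
    and hk: "\<And>x. x \<in> X \<Longrightarrow> h (k x) = x"
    using h by (auto simp: homeomorphism_def intro: inj_on_inverseI)
  have kB: "k ` B = sphere 0 1"
    unfolding hB[symmetric] image_image using kh by (force simp: image_iff)
  have BX: "B \<subseteq> X" using hB hX by fastforce
  define f where "f = k \<circ> g"
  have fc: "continuous_on (sphere 0 1) f"
    unfolding f_def
    by (intro continuous_on_compose g(1) continuous_on_subset[OF kc]) (simp add: g(3) BX)
  have fim: "f ` sphere 0 1 = sphere 0 1"
    unfolding f_def image_comp[symmetric] g kB ..
  have finj: "inj_on f (sphere 0 1)"
    unfolding f_def
    by (intro comp_inj_on g(2) inj_on_inverseI[of _ h] hk subsetD[OF BX]) (simp add: g(3))
  have nf: "norm (f x) = 1" if "norm x = 1" for x using fim that by (force simp: image_iff)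
  define c where "c x = (if x = 0 then 0 else norm x *\<^sub>R f (x /\<^sub>R norm x))" for x :: complex
  have nc: "norm (c x) = norm x" for x by (auto simp: c_def nf)
  have c0: "c x = 0 \<longleftrightarrow> x = 0" for x using nc[of x] by (metis norm_eq_zero)
  have cs: "c x = f x" if "norm x = 1" for x using that by (auto simp: c_def)
  have "continuous (at x within cball 0 1) c" if "x \<in> cball 0 1" for x
  proof (cases "x = 0")
    case True
    \<comment> \<open>The direction of \<open>x\<close> has no limit at the origin; preservation of
      the norm alone gives continuity there.\<close>
    have "(c \<longlongrightarrow> 0) (at 0 within cball 0 1)"
      by (rule tendsto_norm_zero_cancel) (simp add: nc tendsto_norm_zero)
    then show ?thesis using True by (simp add: continuous_within c_def)
  next
    case False
    have "continuous_on (- {0}) (\<lambda>x. norm x *\<^sub>R f (x /\<^sub>R norm x))"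
      by (intro continuous_intros continuous_on_compose2[OF fc])
        (auto, metis left_inverse norm_eq_zero)
    then have "continuous_on (- {0}) c" by (rule continuous_on_eq) (auto simp: c_def)
    then have "continuous (at x) c" using False by (simp add: continuous_on_eq_continuous_at open_Compl)
    then show ?thesis by (rule continuous_at_imp_continuous_at_within)
  qed
  then have cc: "continuous_on (cball 0 1) c" by (simp add: continuous_on_eq_continuous_within)
  have cinj: "inj_on c (cball 0 1)"
  proof (rule inj_onI)
    fix x y assume xy: "c x = c y"
    then have n: "norm x = norm y" using nc by metis
    show "x = y"
    proof (cases "x = 0")
      case True then show ?thesis using n by simp
    next
      case False
      then have y: "y \<noteq> 0" using n by auto
      then have f: "f (x /\<^sub>R norm x) = f (y /\<^sub>R norm y)" using False xy n by (simp add: c_def)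
      have "x /\<^sub>R norm x = y /\<^sub>R norm y"
        by (rule inj_onD[OF finj f]) (use False y in simp_all)
      then show ?thesis using n False y by simp
    qed
  qed
  have cim: "c ` cball 0 1 = cball 0 1"
  proof (intro equalityI subsetI)
    fix y :: complex assume y: "y \<in> cball 0 1"
    show "y \<in> c ` cball 0 1"
    proof (cases "y = 0")
      case True then show ?thesis by (intro image_eqI[of _ _ 0]) (auto simp: c_def)
    next
      case False
      then have "y /\<^sub>R norm y \<in> f ` sphere 0 1" unfolding fim by simp
      then obtain x where x: "norm x = 1" "f x = y /\<^sub>R norm y" by auto
      show ?thesis
        by (rule image_eqI[of _ _ "norm y *\<^sub>R x"]) (use x y False in \<open>auto simp: c_def\<close>)
    qed
  qed (use nc in auto)
  \<comment> \<open>A continuous injection of a compact set into a Hausdorff space is a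
    homeomorphism onto its image, so no inverse has to be written down.\<close>
  have "\<exists>k'. homeomorphism (cball 0 1) X (h \<circ> c) k'"
  proof (rule homeomorphism_compact)
    show "continuous_on (cball 0 1) (h \<circ> c)" using cc hc cim by (intro continuous_on_compose) auto
    show "(h \<circ> c) ` cball 0 1 = X" by (simp only: image_comp[symmetric] cim hX)
    show "inj_on (h \<circ> c) (cball 0 1)" using cinj hinj cim by (intro comp_inj_on) auto
  qed auto
  moreover have "(h \<circ> c) x = g x" if "x \<in> sphere 0 1" for x
  proof -
    have "g x \<in> X" using that g(3) BX by blast
    then show ?thesis using that cs[of x] hk[of "g x"] by (simp add: f_def)
  qed
  ultimately show ?thesis using that by blast
qed

text \<open>\<open>B\<close> is recorded as the image of the circle, independently of any
  surrounding space, so that the gluing lemma can split it into arcs.\<close>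

definition closed_disk :: "'a::t2_space set \<Rightarrow> 'a set \<Rightarrow> bool" where
  "closed_disk X B \<longleftrightarrow>
     (\<exists>h k. homeomorphism (cball (0::complex) 1) X h k \<and> h ` sphere 0 1 = B)"

text \<open>The two semicircles are parametrised by the real part.\<close>

lemma closed_disk_parametrise:
  fixes X :: "'a::t2_space set"
  assumes X: "closed_disk X (path_image p \<union> path_image q)" and p: "arc p" and q: "arc q"
    and ends: "pathstart p = pathstart q" "pathfinish p = pathfinish q"
    and pq: "path_image p \<inter> path_image q = {pathstart p, pathfinish p}"
  obtains h k where "homeomorphism (cball (0::complex) 1) X h k"
    "\<And>x. \<lbrakk>norm x = 1; Im x \<le> 0\<rbrakk> \<Longrightarrow> h x = p ((Re x + 1) / 2)"
    "\<And>x. \<lbrakk>norm x = 1; Im x \<ge> 0\<rbrakk> \<Longrightarrow> h x = q ((Re x + 1) / 2)"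
proof -
  obtain h k where h: "homeomorphism (cball (0::complex) 1) X h k"
    "h ` sphere 0 1 = path_image p \<union> path_image q"
    using X by (auto simp: closed_disk_def)
  let ?t = "\<lambda>x. (Re x + 1) / 2"
  \<comment> \<open>At 1 and -1 both formulas apply; they agree because the arcs have the same
    ends.\<close>
  define g where "g x = (if Im x \<le> 0 then p (?t x) else q (?t x))" for x
  have pi: "inj_on p {0..1}" and qi: "inj_on q {0..1}" and pc: "continuous_on {0..1} p"
    and qc: "continuous_on {0..1} q"
    using p q by (auto simp: arc_def path_def)
  have t: "?t x \<in> {0..1}" if "norm x = 1" for x
    using abs_Re_le_cmod[of x] that by auto
  have real: "x = 1 \<or> x = -1" if "norm x = 1" "Im x = 0" for x
    using that by (auto simp: complex_eq_iff cmod_def)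
  have gq: "g x = q (?t x)" if "norm x = 1" "Im x \<ge> 0" for x
    using that real[of x] ends by (cases "Im x = 0") (auto simp: g_def pathstart_def pathfinish_def)
  have gp: "g x = p (?t x)" if "Im x \<le> 0" for x using that by (simp add: g_def)
  have eqI: "x = y" if "norm x = 1" "norm y = 1" "Re x = Re y" "Im x \<ge> 0 \<longleftrightarrow> Im y \<ge> 0" for x y
  proof -
    have "(Im x)\<^sup>2 = (Im y)\<^sup>2" using that by (simp add: cmod_def)
    then show ?thesis using that by (auto simp: complex_eq_iff power2_eq_iff)
  qed
  have gc: "continuous_on (sphere 0 1) g"
  proof -
    have "continuous_on ((sphere 0 1 \<inter> {x. Im x \<le> 0}) \<union> (sphere 0 1 \<inter> {x. Im x \<ge> 0})) g"
    proof (rule continuous_on_closed_Un)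
      show "closed (sphere 0 1 \<inter> {x. Im x \<le> 0})" "closed (sphere 0 1 \<inter> {x. Im x \<ge> 0})"
        by (auto intro!: closed_Int closed_Collect_le continuous_intros)
      have "continuous_on (sphere 0 1 \<inter> {x. Im x \<le> 0}) (\<lambda>x. p (?t x))"
        using t by (intro continuous_on_compose2[OF pc] continuous_intros) auto
      then show "continuous_on (sphere 0 1 \<inter> {x. Im x \<le> 0}) g"
        by (rule continuous_on_eq) (auto simp: gp)
      have "continuous_on (sphere 0 1 \<inter> {x. Im x \<ge> 0}) (\<lambda>x. q (?t x))"
        using t by (intro continuous_on_compose2[OF qc] continuous_intros) auto
      then show "continuous_on (sphere 0 1 \<inter> {x. Im x \<ge> 0}) g"
        by (rule continuous_on_eq) (auto simp: gq)
    qed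
    then show ?thesis by (rule continuous_on_subset) auto
  qed
  have mixed: False if "norm x = 1" "norm y = 1" "Im x \<le> 0" "Im y > 0" "g x = g y" for x y
  proof -
    \<comment> \<open>The common value is a common end of both arcs, so the parameter of
      \<open>y\<close> is 0 or 1, whereas \<open>Im y > 0\<close> excludes the two real points of
      the circle.\<close>
    have e: "p (?t x) = q (?t y)" using that by (simp add: g_def)
    then have "q (?t y) \<in> path_image p \<inter> path_image q"
      using t that(1,2) unfolding path_image_def by (metis IntI image_eqI)
    then have "q (?t y) = q 0 \<or> q (?t y) = q 1"
      using pq ends by (auto simp: pathstart_def pathfinish_def)
    then have "?t y = 0 \<or> ?t y = 1" using t[OF that(2)] by (auto dest: inj_onD[OF qi])
    then have "Re y = -1 \<or> Re y = 1" by auto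
    then show False using that by (auto simp: cmod_def)
  qed
  have gi: "inj_on g (sphere 0 1)"
  proof (rule inj_onI)
    fix x y assume "x \<in> sphere 0 1" "y \<in> sphere 0 1" "g x = g y"
    then have xy: "norm x = 1" "norm y = 1" "g x = g y" by auto
    consider "Im x \<le> 0" "Im y \<le> 0" | "Im x > 0" "Im y > 0"
      using mixed[OF xy(1,2) _ _ xy(3)] mixed[OF xy(2,1) _ _ xy(3)[symmetric]] by argo
    then show "x = y"
    proof cases
      case 1
      then have "?t x = ?t y" using xy t by (intro inj_onD[OF pi]) (auto simp: gp)
      \<comment> \<open>Negation moves the closed lower semicircle to the closed upper one, where
        the sign condition of \<open>eqI\<close> holds even at real points.\<close>
      then show ?thesis using xy 1 eqI[of "-x" "-y"] by simp
    next
      case 2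
      then have "?t x = ?t y" using xy t by (intro inj_onD[OF qi]) (auto simp: gq)
      then show ?thesis using xy 2 eqI[of x y] by simp
    qed
  qed
  have semi: "\<exists>x. norm x = 1 \<and> ?t x = s \<and> 0 \<le> e * Im x" if "s \<in> {0..1}" "e = 1 \<or> e = -1" for s e :: real
  proof -
    have "(2 * s - 1)\<^sup>2 \<le> 1" using that by (auto simp: abs_square_le_1)
    then show ?thesis using that
      by (intro exI[of _ "Complex (2 * s - 1) (e * sqrt (1 - (2 * s - 1)\<^sup>2))"])
        (auto simp: cmod_def power_mult_distrib)
  qed
  have gim: "g ` sphere 0 1 = path_image p \<union> path_image q"
  proof (intro equalityI subsetI)
    fix z assume "z \<in> path_image p \<union> path_image q"
    then consider s where "s \<in> {0..1}" "z = p s" | s where "s \<in> {0..1}" "z = q s"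
      by (auto simp: path_image_def)
    then show "z \<in> g ` sphere 0 1"
    proof cases
      case 1
      obtain x where "norm x = 1" "?t x = s" "Im x \<le> 0"
        using semi[of s "-1"] 1 by auto
      then show ?thesis using 1 gp[of x] by (intro image_eqI[of _ _ x]) auto
    next
      case 2
      obtain x where "norm x = 1" "?t x = s" "Im x \<ge> 0"
        using semi[of s "1"] 2 by auto
      then show ?thesis using 2 gq[of x] by (intro image_eqI[of _ _ x]) auto
    qed
  qed (use t in \<open>auto simp: g_def path_image_def\<close>)
  obtain h' k' where "homeomorphism (cball 0 1) X h' k'" "\<And>x. x \<in> sphere 0 1 \<Longrightarrow> h' x = g x"
    using homeomorphism_cball_extend_sphere[OF h gc gi gim] by blast
  then show ?thesis using gp gq that[of h' k'] by simp
qed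

text \<open>
  The disk is cut along its horizontal diameter; u and l stretch the upper and the lower half
  vertically onto the whole disk, keeping the upper and the lower semicircle fixed.
\<close>

lemma closed_disk_glue:
  fixes X Y :: "'a::t2_space set"
  assumes X: "closed_disk X (path_image p \<union> path_image q)"
    and Y: "closed_disk Y (path_image p \<union> path_image r)"
    and arcs: "arc p" "arc q" "arc r"
    and ends: "pathstart q = pathstart p" "pathfinish q = pathfinish p"
      "pathstart r = pathstart p" "pathfinish r = pathfinish p"
    and pq: "path_image p \<inter> path_image q = {pathstart p, pathfinish p}"
    and pr: "path_image p \<inter> path_image r = {pathstart p, pathfinish p}"
    and XY: "X \<inter> Y = path_image p"
  shows "closed_disk (X \<union> Y) (path_image q \<union> path_image r)"
proof -
  obtain h k where h: "homeomorphism (cball (0::complex) 1) X h k"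
    and hp: "\<And>x. \<lbrakk>norm x = 1; Im x \<le> 0\<rbrakk> \<Longrightarrow> h x = p ((Re x + 1) / 2)"
    and hq: "\<And>x. \<lbrakk>norm x = 1; Im x \<ge> 0\<rbrakk> \<Longrightarrow> h x = q ((Re x + 1) / 2)"
    using closed_disk_parametrise[OF X arcs(1,2) _ _ pq] ends by metis
  obtain h' k' where h': "homeomorphism (cball (0::complex) 1) Y h' k'"
    and hr: "\<And>x. \<lbrakk>norm x = 1; Im x \<le> 0\<rbrakk> \<Longrightarrow> h' x = r ((Re x + 1) / 2)"
    and hp': "\<And>x. \<lbrakk>norm x = 1; Im x \<ge> 0\<rbrakk> \<Longrightarrow> h' x = p ((Re x + 1) / 2)"
    using closed_disk_parametrise[of Y r p] Y arcs pr ends by (metis Un_commute Int_commute)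
  have hc: "continuous_on (cball 0 1) h" "continuous_on (cball 0 1) h'"
    and him: "h ` cball 0 1 = X" "h' ` cball 0 1 = Y"
    and hi: "inj_on h (cball 0 1)" "inj_on h' (cball 0 1)"
    using h h' by (auto simp: homeomorphism_def intro: inj_on_inverseI)
  \<comment> \<open>\<open>s x\<close> is half the length of the vertical chord through
    \<open>x\<close>. On this chord \<open>u\<close> maps the interval from 0 to \<open>s x\<close>
    affinely onto the one from \<open>- s x\<close> to \<open>s x\<close>, and \<open>l\<close> does
    the same from below. The diameter thus goes to the lower semicircle under \<open>u\<close> and
    to the upper one under \<open>l\<close>, both of which are mapped to \<open>p\<close>.\<close>
  define s where "s x = sqrt (1 - (Re x)\<^sup>2)" for x
  define u where "u x = Complex (Re x) (2 * Im x - s x)" for x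
  define l where "l x = Complex (Re x) (2 * Im x + s x)" for x
  define \<Phi> where "\<Phi> x = (if Im x \<ge> 0 then h (u x) else h' (l x))" for x
  have re: "(Re x)\<^sup>2 \<le> 1" if "norm x \<le> 1" for x
    using abs_Re_le_cmod[of x] that by (simp add: abs_square_le_1)
  have s2: "(s x)\<^sup>2 = 1 - (Re x)\<^sup>2" "s x \<ge> 0" if "norm x \<le> 1" for x
    using re[OF that] by (auto simp: s_def)
  have disk_iff: "norm (Complex a b) \<le> 1 \<longleftrightarrow> a\<^sup>2 + b\<^sup>2 \<le> 1" for a b by (simp add: cmod_def)
  have circ_iff: "norm (Complex a b) = 1 \<longleftrightarrow> a\<^sup>2 + b\<^sup>2 = 1" for a b by (simp add: cmod_def)
  have im: "\<bar>Im x\<bar> \<le> s x" if "norm x \<le> 1" for x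
  proof -
    have "(Im x)\<^sup>2 \<le> (s x)\<^sup>2" using that disk_iff[of "Re x" "Im x"] s2[OF that] by simp
    then have "\<bar>Im x\<bar> \<le> \<bar>s x\<bar>" by (simp only: abs_le_square_iff)
    then show ?thesis using s2[OF that] by simp
  qed
  have u: "norm (u x) \<le> 1" if "norm x \<le> 1" "Im x \<ge> 0" for x
  proof -
    have "\<bar>2 * Im x - s x\<bar> \<le> \<bar>s x\<bar>" using im[OF that(1)] that(2) by auto
    then have "(2 * Im x - s x)\<^sup>2 \<le> (s x)\<^sup>2" by (simp only: abs_le_square_iff)
    then show ?thesis unfolding u_def disk_iff using s2[OF that(1)] by simp
  qed
  have l: "norm (l x) \<le> 1" if "norm x \<le> 1" "Im x \<le> 0" for x
  proof -
    have "\<bar>2 * Im x + s x\<bar> \<le> \<bar>s x\<bar>" using im[OF that(1)] that(2) by auto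
    then have "(2 * Im x + s x)\<^sup>2 \<le> (s x)\<^sup>2" by (simp only: abs_le_square_iff)
    then show ?thesis unfolding l_def disk_iff using s2[OF that(1)] by simp
  qed
  have hu0: "h (u x) = p ((Re x + 1) / 2)" if "norm x \<le> 1" "Im x = 0" for x
    using s2[OF that(1)] that hp[of "u x"] unfolding u_def circ_iff by simp
  have hl0: "h' (l x) = p ((Re x + 1) / 2)" if "norm x \<le> 1" "Im x = 0" for x
    using s2[OF that(1)] that hp'[of "l x"] unfolding l_def circ_iff by simp
  have Phi_l: "\<Phi> x = h' (l x)" if "norm x \<le> 1" "Im x \<le> 0" for x
    using hu0[of x] hl0[of x] that by (auto simp: \<Phi>_def)
  have Phi_c: "continuous_on (cball 0 1) \<Phi>"
  proof -
    have sc: "continuous_on S s" for S unfolding s_def by (intro continuous_intros)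
    have uc: "continuous_on S u" and lc: "continuous_on S l" for S
      unfolding u_def l_def Complex_eq by (intro continuous_intros sc)+
    have "continuous_on ((cball 0 1 \<inter> {x. Im x \<ge> 0}) \<union> (cball 0 1 \<inter> {x. Im x \<le> 0})) \<Phi>"
    proof (rule continuous_on_closed_Un)
      show "closed (cball 0 1 \<inter> {x. Im x \<le> 0})" "closed (cball 0 1 \<inter> {x. Im x \<ge> 0})"
        by (auto intro!: closed_Int closed_Collect_le continuous_intros)
      have "continuous_on (cball 0 1 \<inter> {x. Im x \<ge> 0}) (\<lambda>x. h (u x))"
        by (intro continuous_on_compose2[OF hc(1)]) (auto intro: uc u)
      then show "continuous_on (cball 0 1 \<inter> {x. Im x \<ge> 0}) \<Phi>"
        by (rule continuous_on_eq) (auto simp: \<Phi>_def)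
      have "continuous_on (cball 0 1 \<inter> {x. Im x \<le> 0}) (\<lambda>x. h' (l x))"
        by (intro continuous_on_compose2[OF hc(2)]) (auto intro: lc l)
      then show "continuous_on (cball 0 1 \<inter> {x. Im x \<le> 0}) \<Phi>"
        by (rule continuous_on_eq) (auto simp: Phi_l)
    qed
    then show ?thesis by (rule continuous_on_subset) auto
  qed
  have mixed: False if "norm x \<le> 1" "norm y \<le> 1" "Im x \<ge> 0" "Im y < 0" "\<Phi> x = \<Phi> y" for x y
  proof -
    \<comment> \<open>The common value lies on \<open>p\<close>, which \<open>h'\<close>
      parametrises by the closed upper semicircle. So \<open>l y\<close> lies on that semicircle,
      which forces \<open>Im y = 0\<close>.\<close>
    have e: "h (u x) = h' (l y)" using that by (simp add: \<Phi>_def)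
    moreover have "h' (l y) \<in> Y" "h (u x) \<in> X" using him u l that by auto
    ultimately have "h' (l y) \<in> path_image p" using XY by auto
    then obtain t where t: "h' (l y) = p t" "t \<in> {0..1}"
      by (auto simp: path_image_def)
    define w where "w = Complex (2 * t - 1) (sqrt (1 - (2 * t - 1)\<^sup>2))"
    have "(2 * t - 1)\<^sup>2 \<le> 1" using t by (auto simp: abs_square_le_1)
    then have w: "norm w = 1" "Im w \<ge> 0" "(Re w + 1) / 2 = t" by (auto simp: w_def circ_iff)
    then have "h' (l y) = h' w" using hp'[of w] t by simp
    then have "l y = w" using l[of y] w that by (intro inj_onD[OF hi(2)]) auto
    then have n: "norm (l y) = 1" and i: "2 * Im y + s y \<ge> 0" using w by (auto simp: l_def)
    then have "(2 * Im y + s y)\<^sup>2 = (s y)\<^sup>2" using s2[OF that(2)] unfolding l_def circ_iff by simp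
    then have "2 * Im y + s y = s y" using i s2(2)[OF that(2)] by (simp add: power2_eq_iff_nonneg)
    then show False using that(4) by simp
  qed
  have Phi_i: "inj_on \<Phi> (cball 0 1)"
  proof (rule inj_onI)
    fix x y assume "x \<in> cball 0 1" "y \<in> cball 0 1" and e: "\<Phi> x = \<Phi> y"
    then have n: "norm x \<le> 1" "norm y \<le> 1" by auto
    then consider "Im x \<ge> 0" "Im y \<ge> 0" | "Im x < 0" "Im y < 0"
      using mixed[OF n _ _ e] mixed[OF n(2,1) _ _ e[symmetric]] by argo
    then show "x = y"
    proof cases
      case 1
      then have "u x = u y" using n e u by (intro inj_onD[OF hi(1)]) (auto simp: \<Phi>_def)
      then show ?thesis by (auto simp: u_def s_def complex_eq_iff)
    next
      case 2
      then have "l x = l y" using n e l by (intro inj_onD[OF hi(2)]) (auto simp: \<Phi>_def)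
      then show ?thesis by (auto simp: l_def s_def complex_eq_iff)
    qed
  qed
  have up: "\<exists>x. norm x \<le> 1 \<and> Im x \<ge> 0 \<and> u x = w" if w: "norm w \<le> 1" for w
  proof -
    \<comment> \<open>The inverse of the affine stretch: the mean of \<open>Im w\<close> and the
      height of the upper semicircle.\<close>
    define x where "x = Complex (Re w) ((Im w + s w) / 2)"
    have sx: "s x = s w" by (simp add: s_def x_def)
    have "\<bar>(Im w + s w) / 2\<bar> \<le> \<bar>s w\<bar>" using im[OF w] by auto
    then have "((Im w + s w) / 2)\<^sup>2 \<le> (s w)\<^sup>2" by (simp only: abs_le_square_iff)
    then have "norm x \<le> 1" unfolding x_def disk_iff using s2[OF w] by simp
    then show ?thesis using im[OF w] sx
      by (intro exI[of _ x]) (auto simp: x_def u_def complex_eq_iff field_simps)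
  qed
  have lo: "\<exists>x. norm x \<le> 1 \<and> Im x \<le> 0 \<and> l x = w" if w: "norm w \<le> 1" for w
  proof -
    define x where "x = Complex (Re w) ((Im w - s w) / 2)"
    have sx: "s x = s w" by (simp add: s_def x_def)
    have "\<bar>(Im w - s w) / 2\<bar> \<le> \<bar>s w\<bar>" using im[OF w] by auto
    then have "((Im w - s w) / 2)\<^sup>2 \<le> (s w)\<^sup>2" by (simp only: abs_le_square_iff)
    then have "norm x \<le> 1" unfolding x_def disk_iff using s2[OF w] by simp
    then show ?thesis using im[OF w] sx
      by (intro exI[of _ x]) (auto simp: x_def l_def complex_eq_iff field_simps)
  qed
  have Phi_im: "\<Phi> ` cball 0 1 = X \<union> Y"
  proof (intro equalityI subsetI)
    fix z assume "z \<in> X \<union> Y"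
    then consider w where "norm w \<le> 1" "z = h w" | w where "norm w \<le> 1" "z = h' w"
      using him by (auto simp: image_iff)
    then show "z \<in> \<Phi> ` cball 0 1"
    proof cases
      case 1
      then obtain x where "norm x \<le> 1" "Im x \<ge> 0" "u x = w" using up by blast
      then show ?thesis using 1 by (intro image_eqI[of _ _ x]) (auto simp: \<Phi>_def)
    next
      case 2
      then obtain x where "norm x \<le> 1" "Im x \<le> 0" "l x = w" using lo by blast
      then show ?thesis using 2 Phi_l by (intro image_eqI[of _ _ x]) auto
    qed
  qed (use him u l in \<open>auto simp: \<Phi>_def\<close>)
  have fix_u: "u x = x" if "norm x = 1" "Im x \<ge> 0" for x
  proof -
    have "Im x = s x"
      by (rule power2_eq_imp_eq) (use that s2[of x] circ_iff[of "Re x" "Im x"] in auto)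
    then show ?thesis by (simp add: u_def complex_eq_iff)
  qed
  have fix_l: "l x = x" if "norm x = 1" "Im x \<le> 0" for x
  proof -
    have "- Im x = s x"
      by (rule power2_eq_imp_eq) (use that s2[of x] circ_iff[of "Re x" "Im x"] in auto)
    then show ?thesis by (simp add: l_def complex_eq_iff)
  qed
  have sph: "\<Phi> ` sphere 0 1 = path_image q \<union> path_image r"
  proof (intro equalityI subsetI)
    fix z assume "z \<in> \<Phi> ` sphere 0 1"
    then obtain x where x: "norm x = 1" "z = \<Phi> x" by auto
    have "(Re x + 1) / 2 \<in> {0..1}" using abs_Re_le_cmod[of x] x by auto
    then show "z \<in> path_image q \<union> path_image r"
      using x fix_u[of x] fix_l[of x] hq[of x] hr[of x] by (auto simp: \<Phi>_def path_image_def)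
  next
    fix z assume "z \<in> path_image q \<union> path_image r"
    then consider t where "t \<in> {0..1}" "z = q t" | t where "t \<in> {0..1}" "z = r t"
      by (auto simp: path_image_def)
    then show "z \<in> \<Phi> ` sphere 0 1"
    proof cases
      case 1
      define w where "w = Complex (2 * t - 1) (sqrt (1 - (2 * t - 1)\<^sup>2))"
      have "(2 * t - 1)\<^sup>2 \<le> 1" using 1 by (auto simp: abs_square_le_1)
      then have w: "norm w = 1" "Im w \<ge> 0" "(Re w + 1) / 2 = t" by (auto simp: w_def circ_iff)
      then show ?thesis using 1 hq[of w] fix_u[of w] by (intro image_eqI[of _ _ w]) (auto simp: \<Phi>_def)
    next
      case 2
      define w where "w = Complex (2 * t - 1) (- sqrt (1 - (2 * t - 1)\<^sup>2))"
      have "(2 * t - 1)\<^sup>2 \<le> 1" using 2 by (auto simp: abs_square_le_1)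
      then have w: "norm w = 1" "Im w \<le> 0" "(Re w + 1) / 2 = t" by (auto simp: w_def circ_iff)
      then show ?thesis using 2 hr[of w] fix_l[of w] Phi_l[of w] by (intro image_eqI[of _ _ w]) auto
    qed
  qed
  show ?thesis unfolding closed_disk_def
    using homeomorphism_compact[OF compact_cball Phi_c Phi_im Phi_i] sph by blast
qed

section \<open>Triangulated surfaces\<close>

text \<open>Two-dimensionality enters here: removing the centre does not disconnect a planar ball.
  Shrinking to a round ball inside the chart provides such neighbourhoods arbitrarily close to
  \<open>v\<close>.\<close>

lemma connected_punctured_chart:
  fixes M :: "'a::t2_space set"
  assumes "openin (top_of_set M) U" "U homeomorphic ball (0::complex) 1" "v \<in> U"
    and "openin (top_of_set M) W" "v \<in> W"
  obtains N where "openin (top_of_set M) N" "v \<in> N" "N \<subseteq> W" "connected (N - {v})"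
proof -
  obtain h k where hk: "homeomorphism U (ball (0::complex) 1) h k"
    using assms(2) by (auto simp: homeomorphic_def)
  have hU: "h ` U = ball 0 1" and kh: "\<And>x. x \<in> U \<Longrightarrow> k (h x) = x"
    and kc: "continuous_on (ball 0 1) k"
    and hk': "\<And>y. y \<in> ball 0 1 \<Longrightarrow> h (k y) = y"
    using hk by (auto simp: homeomorphism_def)
  have "openin (top_of_set U) (U \<inter> W)"
    by (rule openin_subset_trans[OF openin_Int[OF assms(1,4)]])
      (use openin_imp_subset[OF assms(1)] in auto)
  then have "openin (top_of_set (ball 0 1)) (h ` (U \<inter> W))"
    using homeomorphism_imp_open_map[OF hk] by blast
  then have "open (h ` (U \<inter> W))" by (metis open_ball openin_open_eq)
  moreover have "h v \<in> h ` (U \<inter> W)" using assms by blast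
  ultimately obtain r where r: "r > 0" "ball (h v) r \<subseteq> h ` (U \<inter> W)" using open_contains_ball by blast
  have b1: "ball (h v) r \<subseteq> ball 0 1" using r hU by blast
  have "openin (top_of_set (ball 0 1)) (ball (h v) r)" by (rule open_subset[OF b1 open_ball])
  then have "openin (top_of_set U) (k ` ball (h v) r)"
    by (rule homeomorphism_imp_open_map[OF homeomorphism_symD[OF hk]])
  then have 1: "openin (top_of_set M) (k ` ball (h v) r)" using assms(1) openin_trans by blast
  have 2: "v \<in> k ` ball (h v) r" using kh[OF assms(3)] r(1) by (metis centre_in_ball image_eqI)
  have 3: "k ` ball (h v) r \<subseteq> W" using r kh by force
  have eq: "k ` ball (h v) r - {v} = k ` (ball (h v) r - {h v})"
    using b1 kh[OF assms(3)] hk' by fastforce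
  have "connected (ball (h v) r - {h v})"
    by (rule connected_punctured_ball) simp
  then have "connected (k ` ball (h v) r - {v})" unfolding eq
    by (intro connected_continuous_image continuous_on_subset[OF kc]) (use b1 in auto)
  then show ?thesis using that 1 2 3 by blast
qed

lemma connected_inside_arc:
  assumes "arc g"
  shows "connected (path_image g - {pathstart g, pathfinish g})" "path_image g - {pathstart g, pathfinish g} \<noteq> {}"
proof -
  have g: "continuous_on {0..1} g" "inj_on g {0..1}" using assms by (auto simp: arc_def path_def)
  have "path_image g - {pathstart g, pathfinish g} = g ` {0<..<1}"
    using g(2) by (fastforce simp: path_image_def pathstart_def pathfinish_def inj_on_def image_iff less_le)
  moreover have "connected (g ` {0<..<1})"
    by (intro connected_continuous_image continuous_on_subset[OF g(1)]) auto
  moreover have "g ` {0<..<1} \<noteq> {}" by simp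
  ultimately show "connected (path_image g - {pathstart g, pathfinish g})"
    "path_image g - {pathstart g, pathfinish g} \<noteq> {}" by auto
qed

locale triangulated_surface =
  fixes M V :: "'a::t2_space set" and E :: "'a set set"
  assumes surface: "closed_surface M" and triangulation: "surface_triangulation M V E"
begin

abbreviation faces :: "'a set set" where "faces \<equiv> graph_faces M V E"

abbreviation edges_of :: "'a set \<Rightarrow> 'a set set" where "edges_of F \<equiv> face_edges E F"

lemma embedding: "simple_graph_embedding M V E"
  using triangulation by (auto simp: surface_triangulation_def two_cell_embedding_def)

lemma finite_V: "finite V" and finite_E: "finite E" and V_subset: "V \<subseteq> M" and E_subset: "e \<in> E \<Longrightarrow> e \<subseteq> M"
  using embedding by (auto simp: simple_graph_embedding_def)

lemma edge_inter: "\<lbrakk>e \<in> E; e' \<in> E; e \<noteq> e'\<rbrakk> \<Longrightarrow> e \<inter> e' \<subseteq> V"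
  using embedding by (auto simp: simple_graph_embedding_def)

lemma edge_eqI: "\<lbrakk>e \<in> E; e' \<in> E; e \<inter> V = e' \<inter> V\<rbrakk> \<Longrightarrow> e = e'"
  using embedding by (auto simp: simple_graph_embedding_def)

lemma edge_arc:
  assumes "e \<in> E"
  obtains g where "arc g" "path_image g = e" "e \<inter> V = {pathstart g, pathfinish g}"
  using embedding assms unfolding simple_graph_embedding_def by meson

lemma edge_arc_from:
  assumes "e \<in> E" "e \<inter> V = {u, v}"
  obtains g where "arc g" "path_image g = e" "pathstart g = u" "pathfinish g = v"
proof -
  obtain g where g: "arc g" "path_image g = e" "e \<inter> V = {pathstart g, pathfinish g}"
    using edge_arc[OF assms(1)] .
  then consider "pathstart g = u" "pathfinish g = v" | "pathstart g = v" "pathfinish g = u"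
    using assms(2) by (auto simp: doubleton_eq_iff)
  then show ?thesis
  proof cases
    case 1 then show ?thesis using g that by blast
  next
    case 2 then show ?thesis using g that[of "reversepath g"] by (simp add: arc_reversepath)
  qed
qed

lemma edge_ends_ne: "\<lbrakk>e \<in> E; e \<inter> V = {u, v}\<rbrakk> \<Longrightarrow> u \<noteq> v"
  by (metis arc_distinct_ends edge_arc_from)

lemma edge_interior: assumes "e \<in> E" shows "connected (e - V)" "e - V \<noteq> {}"
proof -
  obtain g where g: "arc g" "path_image g = e" "e \<inter> V = {pathstart g, pathfinish g}"
    using edge_arc[OF assms] .
  then have "e - V = path_image g - {pathstart g, pathfinish g}" by auto
  then show "connected (e - V)" "e - V \<noteq> {}" using connected_inside_arc[OF g(1)] by auto
qed

lemma closed_edge: "e \<in> E \<Longrightarrow> closed e"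
  by (metis edge_arc arc_imp_path compact_path_image compact_imp_closed)

lemma edge_subset_eq: "\<lbrakk>e \<in> E; e' \<in> E; e \<subseteq> e'\<rbrakk> \<Longrightarrow> e = e'"
  using edge_inter[of e e'] edge_interior(2)[of e] by auto

text \<open>Distinct edges share only vertices, so an edge covered by others would lie in
  \<open>V\<close>, although its interior is nonempty. This excludes a fourth edge hidden in the
  boundary of a triangle.\<close>

lemma edge_subset_Union:
  assumes "e \<in> E" "K \<subseteq> E" "e \<subseteq> \<Union>K" shows "e \<in> K"
proof (rule ccontr)
  assume "e \<notin> K"
  then have "e \<inter> e' \<subseteq> V" if "e' \<in> K" for e'
    using assms(1,2) edge_inter[of e e'] that by blast
  then have "e \<subseteq> V" using assms(3) by blast
  then show False using edge_interior(2)[OF assms(1)] by blast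
qed

lemma closed_M: "closed M"
  using surface by (auto simp: closed_surface_def intro: compact_imp_closed)

lemma face_props:
  assumes "F \<in> faces"
  shows "connected F" "F \<noteq> {}" "F \<subseteq> M - (V \<union> \<Union>E)" "closure F \<subseteq> M"
proof -
  show "connected F" "F \<noteq> {}" and 1: "F \<subseteq> M - (V \<union> \<Union>E)"
    using assms in_components_connected in_components_nonempty in_components_subset
    by (auto simp: graph_faces_def dest: in_components_subset)
  show "closure F \<subseteq> M" by (rule closure_minimal[OF _ closed_M]) (use 1 in auto)
qed

lemma faces_disjoint: "\<lbrakk>F \<in> faces; F' \<in> faces; F \<noteq> F'\<rbrakk> \<Longrightarrow> F \<inter> F' = {}"
  unfolding graph_faces_def using components_nonoverlap by blast

text \<open>The last three arguments are the vertices of F opposite to the first, second and third edge.\<close>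

definition triangle :: "'a set \<Rightarrow> 'a set \<Rightarrow> 'a set \<Rightarrow> 'a set \<Rightarrow> 'a \<Rightarrow> 'a \<Rightarrow> 'a \<Rightarrow> bool" where
  "triangle F e1 e2 e3 a b c \<longleftrightarrow> F \<in> faces \<and> {e1, e2, e3} \<subseteq> E \<and> edges_of F = {e1, e2, e3} \<and>
     a \<noteq> b \<and> b \<noteq> c \<and> c \<noteq> a \<and> e1 \<noteq> e2 \<and> e2 \<noteq> e3 \<and> e3 \<noteq> e1 \<and>
     e1 \<inter> V = {b, c} \<and> e2 \<inter> V = {c, a} \<and> e3 \<inter> V = {a, b} \<and>
     closure F \<inter> V = {a, b, c} \<and> closure F - F = e1 \<union> e2 \<union> e3"

lemma face_triangle:
  assumes "F \<in> faces"
  obtains e1 e2 e3 a b c where "triangle F e1 e2 e3 a b c"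
proof -
  have "triangular V E F" using assms triangulation by (auto simp: surface_triangulation_def)
  then obtain a b c e1 e2 e3 where *: "a \<noteq> b" "b \<noteq> c" "c \<noteq> a" "{e1, e2, e3} \<subseteq> E"
    "e1 \<inter> V = {a, b}" "e2 \<inter> V = {b, c}" "e3 \<inter> V = {c, a}" and cl: "closure F - F = e1 \<union> e2 \<union> e3"
    unfolding triangular_def by (elim conjE exE) (rule that, assumption+)
  have FV: "F \<inter> V = {}" "F \<inter> \<Union>E = {}" using face_props[OF assms] by auto
  have "F \<subseteq> closure F" by (rule closure_subset)
  then have cF: "closure F = F \<union> (e1 \<union> e2 \<union> e3)" using cl by blast
  have "edges_of F = {e1, e2, e3}"
  proof (intro equalityI subsetI)
    fix e assume e: "e \<in> edges_of F"
    then have e: "e \<in> E" "e \<subseteq> \<Union>{e1, e2, e3}" using cF FV by (auto simp: face_edges_def)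
    show "e \<in> {e1, e2, e3}" by (rule edge_subset_Union[OF e(1) *(4) e(2)])
  qed (use cF *(4) in \<open>auto simp: face_edges_def\<close>)
  moreover have "closure F \<inter> V = {a, b, c}" using cF FV * by auto
  moreover have "e1 \<noteq> e2" "e2 \<noteq> e3" "e3 \<noteq> e1" using *(1-3,5-7) by (auto simp: doubleton_eq_iff)
  ultimately have "triangle F e2 e3 e1 a b c" using assms * cl unfolding triangle_def by auto
  then show ?thesis using that by blast
qed

lemma triangle_rotate: "triangle F e1 e2 e3 a b c \<Longrightarrow> triangle F e2 e3 e1 b c a"
  unfolding triangle_def by (elim conjE, intro conjI) (auto simp: insert_commute)

lemma triangle_swap: "triangle F e1 e2 e3 a b c \<Longrightarrow> triangle F e2 e1 e3 b a c"
  unfolding triangle_def by (elim conjE, intro conjI) (auto simp: insert_commute)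

lemma triangle_first:
  assumes "F \<in> faces" "e \<in> edges_of F"
  obtains e2 e3 a b c where "triangle F e e2 e3 a b c"
proof -
  obtain e1 e2 e3 a b c where t: "triangle F e1 e2 e3 a b c" using face_triangle[OF assms(1)] .
  then consider "e = e1" | "e = e2" | "e = e3" using assms(2) by (auto simp add: triangle_def)
  then show ?thesis
    using that[of e2 e3 a b c] that[of e3 e1 b c a] that[of e1 e2 c a b]
      t triangle_rotate[OF t] triangle_rotate[OF triangle_rotate[OF t]] by cases simp_all
qed

lemma triangle_first_two:
  assumes "F \<in> faces" "e \<in> edges_of F" "e' \<in> edges_of F" "e \<noteq> e'"
  obtains e3 a b c where "triangle F e e' e3 a b c"
proof -
  obtain e2 e3 a b c where t: "triangle F e e2 e3 a b c" using triangle_first[OF assms(1,2)] .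
  then consider "e' = e2" | "e' = e3" using assms(3,4) by (auto simp add: triangle_def)
  then show ?thesis
    using that[of e3 a b c] that[of e2 a c b]
      t triangle_swap[OF triangle_rotate[OF triangle_rotate[OF t]]] by cases simp_all
qed

section \<open>Faces around an edge and around a vertex\<close>

lemma edge_faces: "e \<in> E \<Longrightarrow> card {F \<in> faces. e \<in> edges_of F} = 2"
  using triangulation unfolding surface_triangulation_def face_edges_def by auto

lemma edge_two_faces:
  assumes "e \<in> E"
  obtains F F' where "F \<noteq> F'" "{F \<in> faces. e \<in> edges_of F} = {F, F'}"
  using edge_faces[OF assms] by (auto simp: card_2_iff)

lemma other_face:
  assumes "F \<in> faces" "e \<in> edges_of F"
  obtains F' where "F' \<in> faces" "F' \<noteq> F" "e \<in> edges_of F'"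
    "\<And>F''. \<lbrakk>F'' \<in> faces; e \<in> edges_of F''\<rbrakk> \<Longrightarrow> F'' = F \<or> F'' = F'"
proof -
  have "e \<in> E" using assms by (auto simp: face_edges_def)
  then obtain G G' where "G \<noteq> G'" "{F \<in> faces. e \<in> edges_of F} = {G, G'}" using edge_two_faces by blast
  then show ?thesis using assms that by (metis (mono_tags, lifting) insertCI insertE mem_Collect_eq singletonD)
qed

lemma faces_inter:
  "\<lbrakk>F \<in> faces; F' \<in> faces; F \<noteq> F'\<rbrakk> \<Longrightarrow>
    closure F \<inter> closure F' \<in> E \<or> (\<exists>v\<in>V. closure F \<inter> closure F' = {v}) \<or> closure F \<inter> closure F' = {}"
  using triangulation unfolding surface_triangulation_def by blast

text \<open>An interior point of \<open>e\<close> lies in both closed faces, so they meet neither in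
  a vertex nor in the empty set, but in an edge, and this edge contains \<open>e\<close>.\<close>

lemma inter_common_edge:
  assumes "F \<in> faces" "F' \<in> faces" "F \<noteq> F'" "e \<in> edges_of F" "e \<in> edges_of F'"
  shows "closure F \<inter> closure F' = e"
proof -
  have e: "e \<in> E" and sub: "e \<subseteq> closure F \<inter> closure F'" using assms by (auto simp: face_edges_def)
  obtain x where x: "x \<in> e" "x \<notin> V" using edge_interior[OF e] by blast
  then have "x \<in> closure F \<inter> closure F'" using sub by blast
  then have "closure F \<inter> closure F' \<in> E" using faces_inter[OF assms(1-3)] x(2) by (metis empty_iff singletonD)
  then show ?thesis using edge_subset_eq[OF e _ sub] by simp
qed

lemma common_edges_eq:
  assumes "F \<in> faces" "F' \<in> faces" "F \<noteq> F'" "e \<in> edges_of F" "e \<in> edges_of F'"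
    "e' \<in> edges_of F" "e' \<in> edges_of F'"
  shows "e = e'"
  using inter_common_edge[OF assms(1-5)] inter_common_edge[OF assms(1-3,6,7)] by simp

lemma faces_inter_cases:
  assumes "F \<in> faces" "F' \<in> faces" "F \<noteq> F'"
  obtains e where "e \<in> edges_of F" "e \<in> edges_of F'" "closure F \<inter> closure F' = e"
  | v where "v \<in> V" "closure F \<inter> closure F' = {v}"
  | "closure F \<inter> closure F' = {}"
proof -
  consider "closure F \<inter> closure F' \<in> E" | v where "v \<in> V" "closure F \<inter> closure F' = {v}"
    | "closure F \<inter> closure F' = {}" using faces_inter[OF assms] by blast
  then show ?thesis
  proof cases
    case 1 then show ?thesis using that(1)[of "closure F \<inter> closure F'"] by (auto simp: face_edges_def)
  qed (use that in auto)
qed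

lemma finite_faces: "finite faces"
proof -
  have "faces \<subseteq> (\<Union>e\<in>E. {F \<in> faces. e \<in> edges_of F})"
  proof
    fix F assume F: "F \<in> faces"
    obtain e1 e2 e3 a b c where "triangle F e1 e2 e3 a b c" using face_triangle[OF F] .
    then have "e1 \<in> E" "e1 \<in> edges_of F" by (simp_all add: triangle_def)
    then show "F \<in> (\<Union>e\<in>E. {F \<in> faces. e \<in> edges_of F})" using F by blast
  qed
  moreover have "finite {F \<in> faces. e \<in> edges_of F}" if "e \<in> E" for e
    using edge_faces[OF that] by (intro card_ge_0_finite) simp
  ultimately show ?thesis using finite_E by (meson finite_UN_I finite_subset)
qed

lemma closed_face_eq:
  assumes "F \<in> faces" shows "closure F = F \<union> \<Union>(edges_of F)"
proof -
  obtain e1 e2 e3 a b c where "triangle F e1 e2 e3 a b c" using face_triangle[OF assms] .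
  then have "edges_of F = {e1, e2, e3}" "closure F - F = e1 \<union> e2 \<union> e3" by (simp_all add: triangle_def)
  then show ?thesis using closure_subset[of F] by auto
qed

lemma face_Int_closure:
  assumes "F \<in> faces" "F' \<in> faces" "F \<noteq> F'" shows "F \<inter> closure F' = {}"
proof -
  have "\<Union>(edges_of F') \<subseteq> \<Union>E" by (auto simp: face_edges_def)
  then show ?thesis
    using faces_disjoint[OF assms] closed_face_eq[OF assms(2)] face_props(3)[OF assms(1)] by blast
qed

lemma edge_in_face: assumes "e \<in> E" obtains F where "F \<in> faces" "e \<in> edges_of F"
proof -
  obtain F F' where "{F \<in> faces. e \<in> edges_of F} = {F, F'}" using edge_two_faces[OF assms] .
  then have "F \<in> {F \<in> faces. e \<in> edges_of F}" by simp
  then show ?thesis using that by blast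
qed

lemma component_in_face:
  assumes "p \<in> M - (V \<union> \<Union>E)" obtains F where "F \<in> faces" "p \<in> F"
proof -
  have "p \<in> \<Union>(components (M - (V \<union> \<Union>E)))" by (rule subsetD[OF equalityD2[OF Union_components] assms])
  then show ?thesis using that unfolding graph_faces_def by (elim UnionE)
qed

text \<open>Without edges, the infinite set \<open>M\<close> would have points outside
  \<open>V\<close>, hence a face, and a triangular face brings edges. Connectedness of the graph
  then leads from \<open>v\<close> to an edge, and the first step of the path is an edge at
  \<open>v\<close>.\<close>

lemma vertex_has_edge:
  assumes "v \<in> V" obtains e where "e \<in> E" "v \<in> e"
proof -
  have "E \<noteq> {}"
  proof
    assume E: "E = {}"
    have "infinite M"
    proof -
      obtain x where x: "x \<in> M" using surface by (auto simp: closed_surface_def)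
      then obtain U where U: "openin (top_of_set M) U" "U homeomorphic ball (0::complex) 1"
        using surface unfolding closed_surface_def by blast
      then obtain h k where "homeomorphism U (ball (0::complex) 1) h k" by (auto simp: homeomorphic_def)
      then have "h ` U = ball 0 1" by (simp add: homeomorphism_def)
      moreover have "infinite (ball (0::complex) 1)"
        using finite_imp_not_open[of "ball (0::complex) 1"] by auto
      ultimately have "infinite U" by (metis finite_imageI)
      then show ?thesis using openin_imp_subset[OF U(1)] finite_subset by blast
    qed
    then have "M - V \<noteq> {}" using finite_V by (metis Diff_eq_empty_iff finite_subset)
    then obtain p where "p \<in> M - (V \<union> \<Union>E)" using E by auto
    then obtain F where "F \<in> faces" by (rule component_in_face)
    then obtain e1 e2 e3 a b c where "triangle F e1 e2 e3 a b c" by (rule face_triangle)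
    then have "e1 \<in> E" by (simp add: triangle_def)
    then show False using E by simp
  qed
  then obtain e where e: "e \<in> E" by blast
  obtain g where g: "arc g" "path_image g = e" "e \<inter> V = {pathstart g, pathfinish g}"
    using edge_arc[OF e] .
  show ?thesis
  proof (cases "v \<in> e")
    case True then show ?thesis using e that by blast
  next
    case False
    have gs: "pathstart g \<in> e" "pathstart g \<in> V" using g(3) by auto
    have "graph_connected V E" using triangulation unfolding surface_triangulation_def by simp
    then have path: "(v, pathstart g) \<in> {(x, y). \<exists>e\<in>E. e \<inter> V = {x, y}}\<^sup>*"
      using assms gs(2) unfolding graph_connected_def by simp
    have ne: "v \<noteq> pathstart g" using False gs(1) by auto
    from path obtain w where "(v, w) \<in> {(x, y). \<exists>e\<in>E. e \<inter> V = {x, y}}"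
      by (rule converse_rtranclE) (use ne in simp)
    then obtain e' where "e' \<in> E" "e' \<inter> V = {v, w}" by blast
    then show ?thesis using that[of e'] by blast
  qed
qed

lemma M_eq: "M = (\<Union>F\<in>faces. closure F)"
proof (intro equalityI subsetI)
  fix p assume p: "p \<in> M"
  consider "p \<in> M - (V \<union> \<Union>E)" | e where "e \<in> E" "p \<in> e" using p vertex_has_edge by blast
  then show "p \<in> (\<Union>F\<in>faces. closure F)"
  proof cases
    case 1
    then obtain F where "F \<in> faces" "p \<in> F" by (rule component_in_face)
    then show ?thesis using closure_subset[of F] by auto
  next
    case 2
    obtain F where "F \<in> faces" "e \<in> edges_of F" using edge_in_face[OF 2(1)] .
    then show ?thesis using 2(2) by (auto simp: face_edges_def)
  qed
qed (use face_props(4) in blast)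

text \<open>
  Otherwise the remaining faces at v and those in A would cut a small punctured disk around v into
  two nonempty relatively closed pieces.
\<close>

lemma faces_at_vertex_connected:
  assumes v: "v \<in> V" and A: "A \<subseteq> {F \<in> faces. v \<in> closure F}" "A \<noteq> {}"
    and closed_A: "\<And>F F' e. \<lbrakk>F \<in> A; F' \<in> faces; e \<in> edges_of F; e \<in> edges_of F'; v \<in> e\<rbrakk> \<Longrightarrow> F' \<in> A"
  shows "A = {F \<in> faces. v \<in> closure F}"
proof (rule ccontr)
  define B where "B = {F \<in> faces. v \<in> closure F} - A"
  assume "A \<noteq> {F \<in> faces. v \<in> closure F}"
  then have B: "B \<noteq> {}" using A by (auto simp: B_def)
  \<comment> \<open>Off \<open>K\<close> only faces at \<open>v\<close> are visible; finiteness
    makes \<open>K\<close> closed, so its complement leaves room for a punctured disk around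
    \<open>v\<close>.\<close>
  define K where "K = (\<Union>F\<in>{F \<in> faces. v \<notin> closure F}. closure F)"
  have fin: "finite A" "finite B" "finite {F \<in> faces. v \<notin> closure F}"
    using A finite_faces by (auto simp: B_def intro: finite_subset)
  have "closed K" unfolding K_def using fin by (intro closed_UN) auto
  then have W: "openin (top_of_set M) (M - K)"
    by (simp add: Diff_eq openin_open_Int open_Compl)
  have "v \<in> M" using v V_subset by blast
  moreover from this obtain U where "v \<in> U" "openin (top_of_set M) U" "U homeomorphic ball (0::complex) 1"
    using surface unfolding closed_surface_def by blast
  moreover have "v \<in> M - K" using \<open>v \<in> M\<close> by (auto simp: K_def)
  ultimately obtain N where N: "openin (top_of_set M) N" "v \<in> N" "N \<subseteq> M - K" "connected (N - {v})"
    using connected_punctured_chart W by metis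
  obtain N' where N': "open N'" "N = M \<inter> N'" using N(1) by (auto simp: openin_open)
  define CA CB where "CA = (\<Union>F\<in>A. closure F)" and "CB = (\<Union>F\<in>B. closure F)"
  have "closed CA" "closed CB" using fin by (auto simp: CA_def CB_def)
  moreover have "N - {v} \<subseteq> CA \<union> CB"
  proof
    fix p assume p: "p \<in> N - {v}"
    then have "p \<in> M" "p \<notin> K" using N(3) by auto
    then obtain F where F: "F \<in> faces" "p \<in> closure F" using M_eq by auto
    then have "v \<in> closure F" using \<open>p \<notin> K\<close> by (auto simp: K_def)
    then show "p \<in> CA \<union> CB" using F by (auto simp: CA_def CB_def B_def)
  qed
  moreover have "CA \<inter> CB \<inter> (N - {v}) = {}"
  proof -
    \<comment> \<open>A common edge would contain \<open>v\<close>, and the closure property of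
      \<open>A\<close> would then put \<open>F'\<close> into \<open>A\<close>.\<close>
    have "closure F \<inter> closure F' \<subseteq> {v}" if "F \<in> A" "F' \<in> B" for F F'
    proof -
      have F: "F \<in> faces" "F' \<in> faces" "F \<noteq> F'" "v \<in> closure F \<inter> closure F'" "F' \<notin> A"
        using that A by (auto simp: B_def)
      show ?thesis
        using F(1-3)
      proof (cases rule: faces_inter_cases)
        case (1 e) then show ?thesis using closed_A[OF that(1) F(2)] F by blast
      qed (use F in auto)
    qed
    then show ?thesis by (auto simp: CA_def CB_def)
  qed
  \<comment> \<open>As \<open>v\<close> lies in the closure of each face at \<open>v\<close> but in
    no open face, every such face reaches the punctured neighbourhood.\<close>
  moreover have meets: "F \<inter> (N - {v}) \<noteq> {}" if "F \<in> faces" "v \<in> closure F" for F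
  proof -
    have "F \<inter> N' \<noteq> {}" using that N' N(2) by (metis IntE closure_iff_nhds_not_empty disjoint_iff subset_refl)
    then show ?thesis using face_props(3)[OF that(1)] v N' by blast
  qed
  have "CA \<inter> (N - {v}) \<noteq> {}"
  proof -
    obtain F where "F \<in> A" using A by blast
    then show ?thesis using meets[of F] A(1) closure_subset[of F] by (fastforce simp: CA_def)
  qed
  moreover have "CB \<inter> (N - {v}) \<noteq> {}"
  proof -
    obtain F where "F \<in> B" using B by blast
    then show ?thesis using meets[of F] closure_subset[of F] by (fastforce simp: CB_def B_def)
  qed
  ultimately show False using N(4) unfolding connected_closed by blast
qed

lemma face_closed_disk: "F \<in> faces \<Longrightarrow> closed_disk (closure F) (\<Union>(edges_of F))"
proof -
  assume F: "F \<in> faces"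
  obtain h k where h: "homeomorphism (cball (0::complex) 1) (closure F) h k" "h ` ball 0 1 = F"
  proof -
    have "triangular V E F" using triangulation F by (simp add: surface_triangulation_def)
    then have "closed_cell F" by (simp add: triangular_def)
    then show ?thesis using that unfolding closed_cell_def by blast
  qed
  have "inj_on h (cball 0 1)" using h(1) by (auto simp: homeomorphism_def intro: inj_on_inverseI)
  then have "h ` (cball 0 1 - ball 0 1) = h ` cball 0 1 - h ` ball 0 1"
    by (intro inj_on_image_set_diff) auto
  moreover have "cball (0::complex) 1 - ball 0 1 = sphere 0 1" by auto
  moreover have "closure F - F = \<Union>(edges_of F)"
    using closed_face_eq[OF F] face_props(3)[OF F] by (auto simp: face_edges_def)
  ultimately have "h ` sphere 0 1 = \<Union>(edges_of F)" using h by (simp add: homeomorphism_def)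
  then show ?thesis using h(1) unfolding closed_disk_def by blast
qed

end

section \<open>The flow through the faces\<close>

lemma funpow_cycle:
  assumes "finite S" "bij_betw f S S" "x \<in> S"
  obtains m where "m > 0" "(f ^^ m) x = x" "inj_on (\<lambda>i. (f ^^ i) x) {..<m}"
proof -
  have bij: "bij_betw (f ^^ n) S S" for n using assms(2) by (rule bij_betw_funpow)
  have inS: "(f ^^ n) x \<in> S" for n using bij_betwE[OF bij] assms(3) by blast
  \<comment> \<open>Injectivity cancels a repetition back to the start, so the orbit has no
    preperiod.\<close>
  have cancel: "(f ^^ (j - i)) x = x" if "i \<le> j" "(f ^^ i) x = (f ^^ j) x" for i j
  proof -
    have "(f ^^ i) ((f ^^ (j - i)) x) = (f ^^ (i + (j - i))) x" by (simp only: funpow_add o_apply)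
    also have "\<dots> = (f ^^ i) x" using that by simp
    finally show ?thesis
      by (rule inj_onD[OF bij_betw_imp_inj_on[OF bij] _ inS assms(3)])
  qed
  have "\<not> inj (\<lambda>i. (f ^^ i) x)"
  proof
    assume "inj (\<lambda>i. (f ^^ i) x)"
    then have "infinite (range (\<lambda>i. (f ^^ i) x))" by (rule range_inj_infinite)
    moreover have "range (\<lambda>i. (f ^^ i) x) \<subseteq> S" using inS by blast
    ultimately show False using assms(1) finite_subset by blast
  qed
  then obtain i j where "(f ^^ i) x = (f ^^ j) x" "i < j"
    unfolding inj_def by (metis linorder_neqE_nat)
  then have "j - i > 0 \<and> (f ^^ (j - i)) x = x" using cancel[of i j] by simp
  then have ex: "\<exists>m. m > 0 \<and> (f ^^ m) x = x" by blast
  define m where "m = (LEAST m. m > 0 \<and> (f ^^ m) x = x)"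
  have m: "m > 0 \<and> (f ^^ m) x = x" unfolding m_def using ex by (rule LeastI_ex)
  have least: "\<not> (k > 0 \<and> (f ^^ k) x = x)" if "k < m" for k
    using that unfolding m_def by (rule not_less_Least)
  have "inj_on (\<lambda>i. (f ^^ i) x) {..<m}"
  proof (rule linorder_inj_onI')
    fix i j assume "i \<in> {..<m}" "j \<in> {..<m}" "i < j"
    then show "(f ^^ i) x \<noteq> (f ^^ j) x" using cancel[of i j] least[of "j - i"] by auto
  qed
  then show ?thesis using that m by blast
qed

text \<open>Convexity makes the ball unicoherent, and the homeomorphism carries this over to
  \<open>R\<close>. The pieces are meant to be one triangle of a cyclic band and the rest of
  it.\<close>

lemma connected_Int_of_open_disk:
  fixes R :: "'a::t2_space set"
  assumes "R homeomorphic ball (0::complex) 1" "connected X" "connected Y" "X \<union> Y = R"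
    "closedin (top_of_set R) X" "closedin (top_of_set R) Y"
  shows "connected (X \<inter> Y)"
proof -
  obtain h k where hk: "homeomorphism R (ball (0::complex) 1) h k"
    using assms(1) by (auto simp: homeomorphic_def)
  have sub: "X \<subseteq> R" "Y \<subseteq> R" using assms(4) by auto
  have h: "continuous_on R h" "h ` R = ball 0 1" "continuous_on (ball 0 1) k"
    and kh: "\<And>x. x \<in> R \<Longrightarrow> k (h x) = x"
    using hk by (auto simp: homeomorphism_def)
  have inj: "inj_on h R" by (rule inj_on_inverseI[of _ k]) (rule kh)
  have uni: "unicoherent (ball (0::complex) 1)" by (intro convex_imp_unicoherent convex_ball)
  have "connected (h ` X \<inter> h ` Y)"
  proof (rule unicoherentD[OF uni])
    show "connected (h ` X)" "connected (h ` Y)"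
      using assms(2,3) continuous_on_subset[OF h(1)] sub by (auto intro: connected_continuous_image)
    show "ball 0 1 = h ` X \<union> h ` Y" using h(2) assms(4) by (metis image_Un)
    show "closedin (top_of_set (ball 0 1)) (h ` X)" "closedin (top_of_set (ball 0 1)) (h ` Y)"
      using homeomorphism_imp_closed_map[OF hk] assms(5,6) by auto
  qed
  moreover have eq: "h ` X \<inter> h ` Y = h ` (X \<inter> Y)" using inj_on_image_Int[OF inj sub] by simp
  ultimately have 1: "connected (h ` (X \<inter> Y))" by simp
  have "h ` (X \<inter> Y) \<subseteq> ball 0 1" using h(2) sub by blast
  then have "connected (k ` (h ` (X \<inter> Y)))"
    by (intro connected_continuous_image 1 continuous_on_subset[OF h(3)])
  moreover have "k ` h ` (X \<inter> Y) = X \<inter> Y"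
    using kh sub by (force simp: image_image)
  ultimately show ?thesis by simp
qed

text \<open>
  A F is the edge of type II of the face F, directed from src to tgt; the flow enters F through B F
  and leaves it through C F.
\<close>

locale flow_triangulation = triangulated_surface M V E
  for M V :: "'a::t2_space set" and E :: "'a set set" +
  fixes A B C :: "'a set \<Rightarrow> 'a set" and apex :: "'a set \<Rightarrow> 'a" and src tgt :: "'a set \<Rightarrow> 'a"
  assumes flow: "F \<in> faces \<Longrightarrow> triangle F (A F) (B F) (C F) (apex F) (tgt (A F)) (src (A F))"
    and inj_B: "inj_on B faces" and inj_C: "inj_on C faces" and B_eq_C: "B ` faces = C ` faces"
    and A_B_disjoint: "A ` faces \<inter> B ` faces = {}"
begin

text \<open>With the values of \<open>A\<close> as the edges of type II, these are the vertices of
  type II.\<close>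

definition V2 :: "'a set" where "V2 = {v \<in> V. \<exists>e\<in>A ` faces. v \<in> e}"

text \<open>Every exit edge is also an entry edge by \<open>B_eq_C\<close>, and of only one face by
  \<open>inj_B\<close>.\<close>

definition next_face :: "'a set \<Rightarrow> 'a set" where "next_face F = inv_into faces B (C F)"

lemma flow_edges:
  assumes "F \<in> faces"
  shows "edges_of F = {A F, B F, C F}" "A F \<in> E" "B F \<in> E" "C F \<in> E"
    "A F \<noteq> B F" "B F \<noteq> C F" "A F \<noteq> C F"
  using flow[OF assms] unfolding triangle_def by auto

lemma flow_ends:
  assumes "F \<in> faces"
  shows "A F \<inter> V = {src (A F), tgt (A F)}" "B F \<inter> V = {src (A F), apex F}" "C F \<inter> V = {apex F, tgt (A F)}"
    "closure F \<inter> V = {apex F, src (A F), tgt (A F)}"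
    "src (A F) \<noteq> tgt (A F)" "apex F \<noteq> src (A F)" "apex F \<noteq> tgt (A F)"
proof -
  note * = flow[OF assms, unfolded triangle_def]
  show "A F \<inter> V = {src (A F), tgt (A F)}" "B F \<inter> V = {src (A F), apex F}" "C F \<inter> V = {apex F, tgt (A F)}"
    "closure F \<inter> V = {apex F, src (A F), tgt (A F)}" "apex F \<noteq> tgt (A F)"
    using * by (simp_all add: insert_commute)
  show "src (A F) \<noteq> tgt (A F)" using * by (elim conjE) (erule not_sym)
  show "apex F \<noteq> src (A F)" using * by (elim conjE) (erule not_sym)
qed

lemma next_face: assumes "F \<in> faces" shows "next_face F \<in> faces" "B (next_face F) = C F"
proof -
  have "C F \<in> B ` faces" using imageI[OF assms, of C] B_eq_C by simp
  then show "next_face F \<in> faces" "B (next_face F) = C F"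
    unfolding next_face_def by (rule inv_into_into, rule f_inv_into_f)
qed

lemma bij_next_face: "bij_betw next_face faces faces"
proof -
  have "inj_on next_face faces"
  proof (rule inj_onI)
    fix F G assume *: "F \<in> faces" "G \<in> faces" "next_face F = next_face G"
    then have "C F = C G" using next_face(2)[of F] next_face(2)[of G] by simp
    then show "F = G" using inj_onD[OF inj_C] * by blast
  qed
  moreover have "next_face ` faces = faces"
    using endo_inj_surj[OF finite_faces _ calculation] next_face(1) by blast
  ultimately show ?thesis by (simp add: bij_betw_def)
qed

lemma B_eq_C_iff: "\<lbrakk>F \<in> faces; G \<in> faces\<rbrakk> \<Longrightarrow> B G = C F \<longleftrightarrow> G = next_face F"
  using next_face[of F] inj_onD[OF inj_B, of G "next_face F"] by auto

lemma next_face_ne: "F \<in> faces \<Longrightarrow> next_face F \<noteq> F"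
  using next_face(2)[of F] flow_edges(6)[of F] by auto

lemma A_ne: "\<lbrakk>F \<in> faces; G \<in> faces\<rbrakk> \<Longrightarrow> A F \<noteq> B G" "\<lbrakk>F \<in> faces; G \<in> faces\<rbrakk> \<Longrightarrow> A F \<noteq> C G"
  using A_B_disjoint B_eq_C by (metis IntI empty_iff imageI)+

lemma edge_cases:
  assumes "e \<in> E" obtains F where "F \<in> faces" "e = A F" | F where "F \<in> faces" "e = B F"
proof -
  obtain F where F: "F \<in> faces" "e \<in> edges_of F" using edge_in_face[OF assms] .
  then consider "e = A F" | "e = B F" | "e = C F" using flow_edges(1)[OF F(1)] by blast
  then show ?thesis
  proof cases
    case 3 then show ?thesis using that(2)[of "next_face F"] next_face[OF F(1)] by simp
  qed (use that F in auto)
qed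

lemma verts_V2:
  assumes F: "F \<in> faces" shows "src (A F) \<in> V2" "tgt (A F) \<in> V2"
proof -
  have "src (A F) \<in> A F \<inter> V" "tgt (A F) \<in> A F \<inter> V"
    by (simp_all add: flow_ends(1)[OF F])
  moreover have "A F \<in> A ` faces" using F by (rule imageI)
  ultimately show "src (A F) \<in> V2" "tgt (A F) \<in> V2" unfolding V2_def by blast+
qed

text \<open>The other two vertices of a face lie on its edge of type II.\<close>

lemma vertex_is_apex:
  assumes F: "F \<in> faces" and v: "v \<in> closure F" "v \<in> V" "v \<notin> V2" shows "v = apex F"
proof -
  from v have "v \<in> closure F \<inter> V" by simp
  then have "v \<in> {apex F, src (A F), tgt (A F)}" unfolding flow_ends(4)[OF F] .
  then show ?thesis using verts_V2[OF F] v(3) by auto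
qed

lemma apex_in:
  assumes F: "F \<in> faces" shows "apex F \<in> V \<and> apex F \<in> closure F \<and> apex F \<in> B F \<and> apex F \<in> C F"
proof -
  have "apex F \<in> B F \<inter> V" "apex F \<in> C F \<inter> V" "apex F \<in> closure F \<inter> V"
    by (simp_all add: flow_ends(2-4)[OF F])
  then show ?thesis by simp
qed

lemma edges_closure: "\<lbrakk>F \<in> faces; e \<in> edges_of F\<rbrakk> \<Longrightarrow> e \<subseteq> closure F"
  by (simp add: face_edges_def)

text \<open>The apex lies on the exit edge and therefore in the next face; as a vertex of type I it
  can only be the apex there.\<close>

lemma apex_next_face:
  assumes "F \<in> faces" "apex F \<notin> V2" shows "apex (next_face F) = apex F"
proof -
  have "apex F \<in> B (next_face F)" using next_face(2) apex_in assms by simp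
  moreover have "B (next_face F) \<subseteq> closure (next_face F)"
    by (rule edges_closure[OF next_face(1)[OF assms(1)]]) (simp add: flow_edges(1) next_face(1) assms(1))
  ultimately show ?thesis using vertex_is_apex[of "next_face F" "apex F"] next_face(1) apex_in assms by auto
qed

section \<open>Orbits of the flow\<close>

definition orbit :: "'a set \<Rightarrow> 'a set set" where "orbit F = {(next_face ^^ n) F |n. True}"

lemma funpow_next_face: "F \<in> faces \<Longrightarrow> (next_face ^^ n) F \<in> faces"
  by (induction n) (auto simp: next_face(1))

lemma orbit_subset: "F \<in> faces \<Longrightarrow> orbit F \<subseteq> faces"
  using funpow_next_face by (auto simp: orbit_def)

lemma self_in_orbit: "F \<in> orbit F"
  by (auto simp: orbit_def intro: exI[of _ 0])

lemma orbit_next_face: "G \<in> orbit F \<Longrightarrow> next_face G \<in> orbit F"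
  by (auto simp: orbit_def intro: exI[of _ "Suc n" for n])

lemma orbit_trans: assumes "G \<in> orbit F" shows "orbit G \<subseteq> orbit F"
proof -
  have "(next_face ^^ n) G \<in> orbit F" for n using assms by (induction n) (auto intro: orbit_next_face)
  then show ?thesis by (auto simp: orbit_def)
qed

lemma orbit_cycle:
  assumes "F \<in> faces"
  obtains m where "m > 1" "(next_face ^^ m) F = F" "inj_on (\<lambda>i. (next_face ^^ i) F) {..<m}"
    "orbit F = (\<lambda>i. (next_face ^^ i) F) ` {..<m}"
proof -
  obtain m where m: "m > 0" "(next_face ^^ m) F = F" "inj_on (\<lambda>i. (next_face ^^ i) F) {..<m}"
    using funpow_cycle[OF finite_faces bij_next_face assms] .
  have "m \<noteq> 1"
  proof
    assume "m = 1"
    have "next_face F = F" using m(2) unfolding \<open>m = 1\<close> by simp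
    then show False using next_face_ne[OF assms] by simp
  qed
  then have m1: "m > 1" using m(1) by simp
  have "orbit F = (\<lambda>i. (next_face ^^ i) F) ` {..<m}"
  proof (intro equalityI subsetI)
    fix G assume "G \<in> orbit F"
    then obtain n where "G = (next_face ^^ n) F" unfolding orbit_def by blast
    then have "G = (next_face ^^ (n mod m)) F" using funpow_mod_eq[OF m(2)] by simp
    moreover have "n mod m \<in> {..<m}" using m(1) by simp
    ultimately show "G \<in> (\<lambda>i. (next_face ^^ i) F) ` {..<m}" by (rule image_eqI)
  next
    fix G assume "G \<in> (\<lambda>i. (next_face ^^ i) F) ` {..<m}"
    then show "G \<in> orbit F" unfolding orbit_def by blast
  qed
  then show ?thesis by (rule that[OF m1 m(2,3)])
qed

text \<open>On a cycle of length \<open>m\<close>, one step back is \<open>m - 1\<close> steps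
  forward.\<close>

lemma orbit_backward: assumes "F \<in> faces" "G \<in> faces" "next_face G \<in> orbit F" shows "G \<in> orbit F"
proof -
  obtain m where m: "m > 1" "(next_face ^^ m) G = G" by (rule orbit_cycle[OF assms(2)])
  have "(next_face ^^ (m - 1)) (next_face G) = (next_face ^^ Suc (m - 1)) G" by (simp only: funpow_Suc_right o_apply)
  also have "\<dots> = G" using m by simp
  finally have "G \<in> orbit (next_face G)" unfolding orbit_def mem_Collect_eq by metis
  then show ?thesis using orbit_trans[OF assms(3)] by blast
qed

text \<open>An edge outside the digraph is an entry or an exit edge of each of its faces, so
  crossing it is a step along the flow, forward or backward.\<close>

lemma orbit_adjacent:
  assumes "F \<in> faces" "G \<in> orbit F" "G' \<in> faces" "e \<in> edges_of G" "e \<in> edges_of G'" "e \<notin> A ` faces"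
  shows "G' \<in> orbit F"
proof -
  have G: "G \<in> faces" using orbit_subset assms by blast
  have "e = B H \<or> e = C H" if "H \<in> faces" "e \<in> edges_of H" for H
    using that assms(6) unfolding flow_edges(1)[OF that(1)] by auto
  then have "e = B G \<or> e = C G" "e = B G' \<or> e = C G'" using G assms(3-5) by auto
  then consider "e = B G" "e = B G'" | "e = C G" "e = C G'" | "B G' = C G" | "B G = C G'" by metis
  then show ?thesis
  proof cases
    case 1 then show ?thesis using inj_onD[OF inj_B] G assms(2,3) by metis
  next
    case 2 then show ?thesis using inj_onD[OF inj_C] G assms(2,3) by metis
  next
    case 3 then show ?thesis using B_eq_C_iff[OF G assms(3)] orbit_next_face assms(2) by simp
  next
    case 4 then show ?thesis using B_eq_C_iff[OF assms(3) G] orbit_backward assms(1-3) by simp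
  qed
qed

lemma apex_orbit:
  assumes "F \<in> faces" "apex F \<notin> V2" "G \<in> orbit F" shows "apex G = apex F"
proof -
  have "apex ((next_face ^^ n) F) = apex F" for n
    by (induction n) (use assms(1,2) funpow_next_face apex_next_face in auto)
  then show ?thesis using assms(3) by (auto simp: orbit_def)
qed

text \<open>No edge at a vertex of type I belongs to the digraph, so crossing edges at the apex
  never leaves the orbit; connectedness of the faces around a vertex does the rest.\<close>

lemma faces_at_inner_vertex:
  assumes "F \<in> faces" "apex F \<notin> V2"
  shows "{G \<in> faces. apex F \<in> closure G} = orbit F"
proof (rule faces_at_vertex_connected[symmetric])
  show "orbit F \<subseteq> {G \<in> faces. apex F \<in> closure G}"
  proof
    fix G assume G: "G \<in> orbit F"
    then have "G \<in> faces" using orbit_subset[OF assms(1)] by blast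
    then show "G \<in> {G \<in> faces. apex F \<in> closure G}" using apex_in[of G] apex_orbit[OF assms G] by simp
  qed
  show "orbit F \<noteq> {}" using self_in_orbit by blast
  fix G G' e assume *: "G \<in> orbit F" "G' \<in> faces" "e \<in> edges_of G" "e \<in> edges_of G'" "apex F \<in> e"
  have "e \<notin> A ` faces" using *(5) apex_in[OF assms(1)] assms(2) unfolding V2_def by blast
  then show "G' \<in> orbit F" by (rule orbit_adjacent[OF assms(1) *(1-4)])
qed (use apex_in[OF assms(1)] in simp)

section \<open>The complement of the type II subgraph\<close>

abbreviation skeleton :: "'a set" where "skeleton \<equiv> V2 \<union> \<Union>(A ` faces)"

text \<open>A common edge outside the digraph would join the orbits, and a common vertex of type I
  would be an apex whose whole star is a single orbit.\<close>

lemma orbit_separated: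
  assumes "F \<in> faces" "G \<in> orbit F" "G' \<in> faces" "G' \<notin> orbit F"
  shows "closure G \<inter> closure G' \<subseteq> skeleton"
proof -
  have G: "G \<in> faces" "G \<noteq> G'" using orbit_subset assms by auto
  show ?thesis
    using G(1) assms(3) G(2)
  proof (cases rule: faces_inter_cases)
    case (1 e) then show ?thesis using orbit_adjacent[OF assms(1-3) 1(1,2)] assms(4) by blast
  next
    case (2 v)
    have "v \<in> V2"
    proof (rule ccontr)
      assume v: "v \<notin> V2"
      then have "v = apex G" using vertex_is_apex[OF G(1)] 2 by blast
      then have "G' \<in> orbit G" using faces_at_inner_vertex[OF G(1)] v 2 assms(3) by blast
      then show False using orbit_trans[OF assms(2)] assms(4) by blast
    qed
    then show ?thesis unfolding 2(2) by simp
  next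
    case 3 then show ?thesis by simp
  qed
qed

lemma skeleton_subset: "skeleton \<subseteq> V \<union> \<Union>E"
  using flow_edges(2) by (auto simp: V2_def)

lemma edge_Int_skeleton:
  assumes "e \<in> E" "e \<notin> A ` faces" shows "(e - V) \<inter> skeleton = {}"
proof -
  have "e \<inter> A F \<subseteq> V" if "F \<in> faces" for F
  proof (rule edge_inter[OF assms(1) flow_edges(2)[OF that]])
    show "e \<noteq> A F" using assms(2) that by blast
  qed
  moreover have "V2 \<subseteq> V" by (auto simp: V2_def)
  ultimately show ?thesis by blast
qed

text \<open>The closed unions \<open>K\<close> and \<open>L\<close> of the faces inside and outside
  the orbit cover \<open>M\<close> and meet only in \<open>skeleton\<close>. A connected set that
  avoids \<open>skeleton\<close> and meets \<open>K\<close> therefore cannot meet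
  \<open>L\<close>.\<close>

lemma orbit_region_component:
  assumes "F \<in> faces" and "connected ((\<Union>G\<in>orbit F. closure G) - skeleton)"
  shows "(\<Union>G\<in>orbit F. closure G) - skeleton \<in> components (M - skeleton)"
proof -
  define R where "R = (\<Union>G\<in>orbit F. closure G) - skeleton"
  define K L where "K = (\<Union>G\<in>orbit F. closure G)" and "L = (\<Union>G\<in>faces - orbit F. closure G)"
  have fin: "finite (orbit F)" using orbit_subset[OF assms(1)] finite_faces by (rule finite_subset)
  have RK: "R = K - skeleton" by (simp add: R_def K_def)
  have K: "closed K" and L: "closed L" using fin finite_faces by (auto simp: K_def L_def)
  have "K \<union> L = (\<Union>G\<in>orbit F \<union> (faces - orbit F). closure G)"
    unfolding K_def L_def by (rule UN_Un[symmetric])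
  also have "orbit F \<union> (faces - orbit F) = faces" using orbit_subset[OF assms(1)] by blast
  finally have M: "M = K \<union> L" using M_eq by simp
  have KL: "K \<inter> L \<subseteq> skeleton"
  proof
    fix x assume "x \<in> K \<inter> L"
    then obtain G G' where "G \<in> orbit F" "G' \<in> faces" "G' \<notin> orbit F" "x \<in> closure G \<inter> closure G'"
      unfolding K_def L_def by blast
    then show "x \<in> skeleton" using orbit_separated[OF assms(1), of G G'] by blast
  qed
  have "R \<noteq> {}"
  proof -
    obtain x where x: "x \<in> F" using face_props(2)[OF assms(1)] by blast
    then have "x \<in> closure F" "x \<notin> skeleton"
      using closure_subset[of F] face_props(3)[OF assms(1)] skeleton_subset by blast+
    then have "x \<in> R" using self_in_orbit[of F] unfolding R_def by blast
    then show ?thesis by blast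
  qed
  moreover have "R \<subseteq> M - skeleton" using M RK by blast
  moreover have "connected R" using assms(2) by (simp add: R_def)
  moreover have "D = R" if D: "D \<noteq> {}" "R \<subseteq> D" "D \<subseteq> M - skeleton" "connected D" for D
  proof (rule ccontr)
    assume "D \<noteq> R"
    then obtain x where "x \<in> D" "x \<notin> R" using D(2) by blast
    then have "x \<in> L" using D(3) M RK by blast
    then have "L \<inter> D \<noteq> {}" using \<open>x \<in> D\<close> by blast
    moreover have "K \<inter> D \<noteq> {}" using \<open>R \<noteq> {}\<close> D(2) RK by blast
    moreover have "D \<subseteq> K \<union> L" using D(3) M by blast
    moreover have "K \<inter> L \<inter> D = {}" using D(3) KL by blast
    ultimately show False using D(4) K L unfolding connected_closed by blast
  qed
  ultimately show ?thesis unfolding in_components_maximal R_def[symmetric] by blast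
qed

text \<open>When the apex is of type II as well, all three corners are removed. What remains lies
  between the open face and its closure, which makes it connected.\<close>

lemma open_strip:
  assumes F: "F \<in> faces" and v: "apex F \<in> V2"
  shows "closure F - skeleton = F \<union> (B F - V) \<union> (C F - V)"
    and "connected (closure F - skeleton)"
proof -
  have "closure F = F \<union> A F \<union> B F \<union> C F"
    using closed_face_eq[OF F] flow_edges(1)[OF F] by auto
  moreover have "B F \<inter> V \<subseteq> skeleton" "C F \<inter> V \<subseteq> skeleton"
    using flow_ends(2,3)[OF F] verts_V2[OF F] v by auto
  moreover have "A F \<subseteq> skeleton" using F by auto
  moreover have "F \<inter> skeleton = {}" using face_props(3)[OF F] skeleton_subset by blast
  moreover have "(B F - V) \<inter> skeleton = {}"
    by (rule edge_Int_skeleton[OF flow_edges(3)[OF F]]) (use A_ne(1)[OF _ F] in force)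
  moreover have "(C F - V) \<inter> skeleton = {}"
    by (rule edge_Int_skeleton[OF flow_edges(4)[OF F]]) (use A_ne(2)[OF _ F] in force)
  ultimately show eq: "closure F - skeleton = F \<union> (B F - V) \<union> (C F - V)" by blast
  show "connected (closure F - skeleton)"
    by (rule connected_intermediate_closure[OF face_props(1)[OF F]]) (use eq in auto)
qed

text \<open>
  Without a vertex of type I, the region swept out by the flow would be a cyclic band of
  triangles: two connected closed pieces meeting in two disjoint crosscuts, which is impossible in
  an open disk because it is unicoherent.
\<close>

lemma apex_inner_if_disks:
  assumes disks: "\<forall>R\<in>components (M - skeleton). R homeomorphic ball (0::complex) 1" and F: "F \<in> faces"
  shows "apex F \<notin> V2"
proof
  assume aF: "apex F \<in> V2"
  obtain m where m: "m > 1" "(next_face ^^ m) F = F" "inj_on (\<lambda>i. (next_face ^^ i) F) {..<m}"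
    and orb: "orbit F = (\<lambda>i. (next_face ^^ i) F) ` {..<m}" using orbit_cycle[OF F] .
  define W where "W i = (next_face ^^ i) F" for i
  have W: "W i \<in> faces" for i unfolding W_def by (rule funpow_next_face[OF F])
  have WS: "W (Suc i) = next_face (W i)" for i by (simp add: W_def)
  \<comment> \<open>An apex of type I would stay constant along the flow, which returns to
    \<open>F\<close>.\<close>
  have apexW: "apex (W i) \<in> V2" if "i < m" for i
  proof (rule ccontr)
    assume a: "apex (W i) \<notin> V2"
    have "(next_face ^^ (m - i)) (W i) = (next_face ^^ ((m - i) + i)) F" unfolding W_def by (simp only: funpow_add o_apply)
    then have "(next_face ^^ (m - i)) (W i) = F" using m(2) that by simp
    then have "F \<in> orbit (W i)" unfolding orbit_def mem_Collect_eq by metis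
    then show False using apex_orbit[OF W a] a aF by metis
  qed
  define P where "P i = closure (W i) - skeleton" for i
  have P: "P i = W i \<union> (B (W i) - V) \<union> (C (W i) - V)" "connected (P i)" if "i < m" for i
    using open_strip[OF W apexW[OF that]] by (auto simp: P_def)
  have CB: "B (W (Suc i)) = C (W i)" for i unfolding WS by (rule next_face(2)[OF W])
  \<comment> \<open>Consecutive strips share an open edge. The lower index is free because both the
    whole band and the band without its first triangle are needed.\<close>
  have chain: "connected (\<Union>i\<in>{k..<n}. P i)" if "n \<le> m" for k n
    using that
  proof (induction n)
    case (Suc n)
    show ?case
    proof (cases "k < n")
      case True
      have "C (W (n - 1)) - V \<subseteq> P (n - 1)" "C (W (n - 1)) - V \<subseteq> P n"
        using P(1)[of "n - 1"] P(1)[of n] CB[of "n - 1"] True Suc.prems by auto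
      moreover have "C (W (n - 1)) - V \<noteq> {}" by (rule edge_interior(2)[OF flow_edges(4)[OF W]])
      moreover have "n - 1 \<in> {k..<n}" using True by auto
      ultimately have "(\<Union>i\<in>{k..<n}. P i) \<inter> P n \<noteq> {}" by blast
      then have "connected ((\<Union>i\<in>{k..<n}. P i) \<union> P n)"
        using Suc P(2)[of n] by (intro connected_Un) auto
      moreover have "(\<Union>i\<in>{k..<Suc n}. P i) = (\<Union>i\<in>{k..<n}. P i) \<union> P n"
      proof -
        have "{k..<Suc n} = insert n {k..<n}" using True by auto
        then show ?thesis by (simp add: Un_commute)
      qed
      ultimately show ?thesis by simp
    next
      case False
      then have "k = n \<or> n < k" by linarith
      then show ?thesis using P(2)[of n] Suc.prems by (elim disjE) simp_all
    qed
  qed simp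
  define R where "R = (\<Union>G\<in>orbit F. closure G) - skeleton"
  have R: "R = (\<Union>i\<in>{0..<m}. P i)" unfolding R_def orb P_def W_def by auto
  then have "R \<in> components (M - skeleton)"
    using orbit_region_component[OF F] chain[of m 0] unfolding R_def by simp
  then have disk: "R homeomorphic ball (0::complex) 1" using disks by blast
  define Y where "Y = (\<Union>i\<in>{1..<m}. P i)"
  have RXY: "P 0 \<union> Y = R"
  proof -
    have "{0..<m} = insert 0 {1..<m}" using m(1) by auto
    then show ?thesis unfolding R Y_def by simp
  qed
  have cP: "P 0 = R \<inter> closure (W 0)" and cY: "Y = R \<inter> (\<Union>i\<in>{1..<m}. closure (W i))"
    unfolding RXY[symmetric] Y_def P_def by auto
  have "connected (P 0 \<inter> Y)"
  proof (rule connected_Int_of_open_disk[OF disk _ _ RXY])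
    show "connected (P 0)" using P(2) m(1) by simp
    show "connected Y" unfolding Y_def by (rule chain) simp
    show "closedin (top_of_set R) (P 0)" unfolding cP by (intro closedin_closed_Int closed_closure)
    show "closedin (top_of_set R) Y" unfolding cY by (intro closedin_closed_Int closed_UN) auto
  qed
  moreover have Bm: "B (W 0) = C (W (m - 1))"
    using CB[of "m - 1"] m(1,2) by (simp add: W_def)
  \<comment> \<open>The band closes up: the last triangle is left through the edge by which the
    first one is entered. The first triangle therefore touches the rest along both of its edges
    outside the digraph.\<close>
  have "P 0 \<inter> Y = (B (W 0) - V) \<union> (C (W 0) - V)"
  proof (intro equalityI subsetI)
    fix x assume x: "x \<in> P 0 \<inter> Y"
    then obtain i where i: "1 \<le> i" "i < m" "x \<in> P i" by (auto simp: Y_def)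
    have "W 0 \<noteq> W i" using inj_onD[OF m(3), of 0 i] i m(1) by (auto simp: W_def)
    then have "x \<notin> W 0" using face_Int_closure[OF W W] i(3) by (auto simp: P_def)
    then show "x \<in> (B (W 0) - V) \<union> (C (W 0) - V)" using x P(1)[of 0] m(1) by auto
  next
    fix x assume "x \<in> (B (W 0) - V) \<union> (C (W 0) - V)"
    then have x: "x \<in> C (W (m - 1)) - V \<or> x \<in> B (W 1) - V" using Bm CB[of 0] by auto
    have "1 \<in> {1..<m}" "m - 1 \<in> {1..<m}" using m(1) by auto
    then have "x \<in> Y" using x P(1)[of 1] P(1)[of "m - 1"] unfolding Y_def by auto
    moreover have "x \<in> P 0" using \<open>x \<in> _ \<union> _\<close> P(1)[of 0] m(1) by auto
    ultimately show "x \<in> P 0 \<inter> Y" by blast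
  qed
  ultimately have conn: "connected ((B (W 0) - V) \<union> (C (W 0) - V))" by simp
  let ?S = "(B (W 0) - V) \<union> (C (W 0) - V)"
  \<comment> \<open>The two closed edges meet only in vertices, and those have been removed, so the
    edges themselves separate the intersection.\<close>
  have "B (W 0) \<inter> C (W 0) \<inter> ?S = {}"
    using edge_inter[OF flow_edges(3,4,6)[OF W[of 0]]] by blast
  moreover have "B (W 0) \<inter> ?S \<noteq> {}" "C (W 0) \<inter> ?S \<noteq> {}"
    using edge_interior(2)[OF flow_edges(3)[OF W[of 0]]] edge_interior(2)[OF flow_edges(4)[OF W[of 0]]]
    by blast+
  moreover have "?S \<subseteq> B (W 0) \<union> C (W 0)" by blast
  ultimately show False
    using conn closed_edge[OF flow_edges(3)[OF W[of 0]]] closed_edge[OF flow_edges(4)[OF W[of 0]]]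
    unfolding connected_closed by blast
qed

end

section \<open>The star of a vertex of type I\<close>

text \<open>The assumptions are the output of \<open>orbit_cycle\<close>: the indices below
  \<open>m\<close> list the triangles of the star without repetition.\<close>

locale inner_star = flow_triangulation +
  fixes F0 :: "'a set" and m :: nat
  assumes F0: "F0 \<in> faces" and inner: "apex F0 \<notin> V2"
    and m: "m > 1" "(next_face ^^ m) F0 = F0" "inj_on (\<lambda>i. (next_face ^^ i) F0) {..<m}"
    and orbit_eq: "orbit F0 = (\<lambda>i. (next_face ^^ i) F0) ` {..<m}"
begin

text \<open>The triangle \<open>W i\<close> has the rim edge \<open>a i\<close> from
  \<open>p i\<close> to \<open>p (Suc i)\<close> and the spokes \<open>b i\<close> and
  \<open>b (Suc i)\<close> to \<open>z\<close>. All indices are allowed and everything repeats with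
  period \<open>m\<close>.\<close>

definition W :: "nat \<Rightarrow> 'a set" where "W i = (next_face ^^ i) F0"
definition z :: 'a where "z = apex F0"
definition a :: "nat \<Rightarrow> 'a set" where "a i = A (W i)"
definition b :: "nat \<Rightarrow> 'a set" where "b i = B (W i)"
definition p :: "nat \<Rightarrow> 'a" where "p i = src (a i)"

lemma W: "W i \<in> faces" unfolding W_def by (rule funpow_next_face[OF F0])

lemma W_inj: "\<lbrakk>i < m; j < m; W i = W j\<rbrakk> \<Longrightarrow> i = j"
  using inj_onD[OF m(3), of i j] by (simp add: W_def)

lemma apex_W: "apex (W i) = z"
  unfolding z_def by (rule apex_orbit[OF F0 inner]) (auto simp: W_def orbit_def)

lemma C_W: "C (W i) = b (Suc i)"
  using next_face(2)[OF W, of i] by (simp add: W_def b_def)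

lemma W_m: "W m = W 0" using m(2) by (simp add: W_def)

lemma b_m: "b m = b 0" and p_m: "p m = p 0" by (simp_all add: b_def p_def a_def W_m)

lemma edges: "a i \<in> E" "b i \<in> E" "edges_of (W i) = {a i, b i, b (Suc i)}"
  using flow_edges[OF W[of i]] C_W[of i] by (simp_all add: a_def b_def)

lemma b_ends: "b i \<inter> V = {p i, z}"
  using flow_ends(2)[OF W[of i]] by (simp add: a_def b_def p_def apex_W)

lemma p_ne_z: "p i \<noteq> z"
  using edge_ends_ne[OF edges(2) b_ends] .

text \<open>The exit spoke of one triangle is the entry spoke of the next, and its end other than
  \<open>z\<close> is the target of the former rim edge and the source of the latter.\<close>

lemma tgt_a: "tgt (a i) = p (Suc i)"
proof -
  have "b (Suc i) \<inter> V = {z, tgt (a i)}"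
    using flow_ends(3)[OF W[of i]] by (simp add: apex_W C_W a_def)
  then have "{z, tgt (a i)} = {p (Suc i), z}" by (simp only: b_ends)
  then show ?thesis using p_ne_z[of "Suc i"] by (auto simp: doubleton_eq_iff)
qed

lemma a_ends: "a i \<inter> V = {p i, p (Suc i)}"
  using flow_ends(1)[OF W[of i]] tgt_a[of i] by (simp add: a_def p_def)

lemma b_inj: "\<lbrakk>i < m; j < m; b i = b j\<rbrakk> \<Longrightarrow> i = j"
  using inj_onD[OF inj_B _ W W] W_inj by (simp add: b_def)

lemma p_inj: "\<lbrakk>i < m; j < m; p i = p j\<rbrakk> \<Longrightarrow> i = j"
  using b_inj edge_eqI[OF edges(2) edges(2), of i j] b_ends by simp

lemma a_ne_b: "a i \<noteq> b j"
  unfolding a_def b_def by (rule A_ne(1)[OF W W])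

lemma edge_Int: "\<lbrakk>e \<in> E; e' \<in> E; e \<noteq> e'\<rbrakk> \<Longrightarrow> e \<inter> e' = (e \<inter> V) \<inter> (e' \<inter> V)"
  using edge_inter[of e e'] by auto

lemma b_Int_b: assumes "i < m" "j < m" "i \<noteq> j" shows "b i \<inter> b j = {z}"
proof -
  have "b i \<noteq> b j" "p i \<noteq> p j" using b_inj p_inj assms by auto
  then show ?thesis using edge_Int[OF edges(2) edges(2), of i j] p_ne_z by (auto simp: b_ends)
qed

lemma a_Int_b: "a i \<inter> b j = {p i, p (Suc i)} \<inter> {p j}"
  using edge_Int[OF edges(1) edges(2) a_ne_b, of i j] p_ne_z by (auto simp: a_ends b_ends)

lemma z_notin_a: "z \<notin> a i"
proof
  assume "z \<in> a i"
  moreover have "z \<in> V" using b_ends[of 0] by blast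
  ultimately have "z \<in> a i \<inter> V" by simp
  then show False unfolding a_ends using p_ne_z[of i] p_ne_z[of "Suc i"] by simp
qed

lemma closure_W: "closure (W i) = W i \<union> (a i \<union> b i \<union> b (Suc i))"
  using closed_face_eq[OF W[of i]] by (auto simp: edges)

text \<open>All triangles contain \<open>z\<close>, so two of them meet in \<open>z\<close> alone or
  in an edge through \<open>z\<close>, which must be a spoke. Distinctness of the spokes leaves only
  cyclically adjacent indices; the second part of the union accounts for the pair \<open>0\<close>
  and \<open>m - 1\<close>.\<close>

lemma closure_Int:
  assumes "i < k" "k < m"
  shows "closure (W i) \<inter> closure (W k) =
    (if Suc i = k then b k else {z}) \<union> (if i = 0 \<and> Suc k = m then b 0 else {})"
proof -
  have ne: "W i \<noteq> W k" using W_inj[of i k] assms by auto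
  have z: "z \<in> closure (W j)" for j using apex_in[OF W[of j]] by (simp add: apex_W)
  have zb: "z \<in> b j" for j using b_ends[of j] by blast
  have sub: "closure (W i) \<inter> closure (W k) \<subseteq>
    (if Suc i = k then b k else {z}) \<union> (if i = 0 \<and> Suc k = m then b 0 else {})"
    using W[of i] W[of k] ne
  proof (cases rule: faces_inter_cases)
    case (1 e)
    have "z \<in> e" using z 1(3) by blast
    then have "e = b i \<or> e = b (Suc i)" "e = b k \<or> e = b (Suc k)"
      using 1(1,2) z_notin_a unfolding edges(3) by blast+
    moreover have "b i \<noteq> b k" using b_inj[of i k] assms by auto
    moreover have "b (Suc i) \<noteq> b (Suc k)"
      using b_inj[of "Suc i" "Suc k"] b_inj[of "Suc i" 0] assms b_m by (cases "Suc k = m") auto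
    ultimately have "e = b k \<and> b (Suc i) = b k \<or> e = b i \<and> b i = b (Suc k)" by metis
    moreover have "Suc i = k" if "b (Suc i) = b k" using b_inj[OF _ _ that] assms by simp
    moreover have "i = 0 \<and> Suc k = m" if "b i = b (Suc k)"
    proof (cases "Suc k = m")
      case True then show ?thesis using b_inj[of i 0] that assms b_m by simp
    next
      case False then show ?thesis using b_inj[OF _ _ that] assms by simp
    qed
    ultimately show ?thesis unfolding 1(3) by auto
  next
    case (2 v)
    have "z \<in> closure (W i) \<inter> closure (W k)" using z by simp
    then have "v = z" unfolding 2(2) by simp
    then show ?thesis unfolding 2(2) using zb by auto
  next
    case 3 then show ?thesis by simp
  qed
  have "b k \<subseteq> closure (W i) \<inter> closure (W k)" if "Suc i = k"
    using that by (auto simp: closure_W)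
  moreover have "b 0 \<subseteq> closure (W i) \<inter> closure (W k)" if "i = 0" "Suc k = m"
    using that b_m by (auto simp: closure_W)
  ultimately show ?thesis using sub z by auto
qed

section \<open>Gluing the triangles of a star\<close>

definition rim :: "nat \<Rightarrow> 'a set" where "rim k = (\<Union>i<k. a i)"

lemma p_in_a: "p i \<in> a i" "p (Suc i) \<in> a i"
  using a_ends[of i] by auto

text \<open>A spoke meets rim edges only in its outer end. The condition \<open>0 < k\<close> in the
  index set is there because \<open>rim 0\<close> is empty and does not contain
  \<open>p 0\<close>.\<close>

lemma b_Int_rim: assumes "k < m" shows "b j \<inter> rim k = {p j} \<inter> p ` {i. i \<le> k \<and> 0 < k}"
proof -
  have "b j \<inter> rim k = (\<Union>i<k. a i \<inter> b j)" by (auto simp: rim_def)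
  also have "\<dots> = {p j} \<inter> (\<Union>i<k. {p i, p (Suc i)})" unfolding a_Int_b by auto
  also have "(\<Union>i<k. {p i, p (Suc i)}) = p ` {i. i \<le> k \<and> 0 < k}"
  proof (intro equalityI subsetI)
    fix x assume "x \<in> p ` {i. i \<le> k \<and> 0 < k}"
    then obtain i where i: "x = p i" "i \<le> k" "0 < k" by auto
    show "x \<in> (\<Union>i<k. {p i, p (Suc i)})"
    proof (cases i)
      case 0 then show ?thesis using i by auto
    next
      case (Suc j) then show ?thesis using i by auto
    qed
  qed auto
  finally show ?thesis .
qed

lemma b0_Int_rim: "\<lbrakk>0 < k; k < m\<rbrakk> \<Longrightarrow> b 0 \<inter> rim k = {p 0}"
  unfolding b_Int_rim by auto

lemma bk_Int_rim: "\<lbrakk>0 < k; k < m\<rbrakk> \<Longrightarrow> b k \<inter> rim k = {p k}"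
  unfolding b_Int_rim by auto

text \<open>For \<open>k < m\<close> the vertices up to \<open>p k\<close> are distinct, so each new
  edge meets the earlier ones only in its starting point. At \<open>k = m\<close> the rim closes
  up.\<close>

lemma rim_arc:
  assumes "0 < k" "k < m"
  obtains g where "arc g" "path_image g = rim k" "pathstart g = p 0" "pathfinish g = p k"
proof -
  have "\<exists>g. arc g \<and> path_image g = rim k \<and> pathstart g = p 0 \<and> pathfinish g = p k"
    using assms
  proof (induction k)
    case (Suc k)
    obtain h where h: "arc h" "path_image h = a k" "pathstart h = p k" "pathfinish h = p (Suc k)"
      using edge_arc_from[OF edges(1) a_ends] .
    show ?case
    proof (cases "k = 0")
      case True then show ?thesis using h by (auto simp: rim_def)
    next
      case False
      then obtain g where g: "arc g" "path_image g = rim k" "pathstart g = p 0" "pathfinish g = p k"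
        using Suc by auto
      have "a i \<inter> a k \<subseteq> {p k}" if "i < k" for i
      proof -
        have ne: "p i \<noteq> p (Suc k)" "p (Suc i) \<noteq> p (Suc k)"
          using p_inj[of i "Suc k"] p_inj[of "Suc i" "Suc k"] that Suc.prems by auto
        have "p (Suc k) \<notin> {p i, p (Suc i)}" using ne by auto
        then have "a i \<noteq> a k" using a_ends[of i] a_ends[of k] by auto
        then have "a i \<inter> a k = {p i, p (Suc i)} \<inter> {p k, p (Suc k)}"
          using edge_Int[OF edges(1) edges(1)] a_ends by simp
        then show ?thesis using ne by auto
      qed
      then have "rim k \<inter> a k \<subseteq> {p k}" by (auto simp: rim_def)
      then have "arc (g +++ h)" using g h by (intro arc_join) auto
      moreover have "path_image (g +++ h) = rim (Suc k)"
        using g h by (simp add: path_image_join rim_def lessThan_Suc Un_commute)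
      ultimately show ?thesis using g h by (intro exI[of _ "g +++ h"]) simp
    qed
  qed simp
  then show ?thesis using that by blast
qed

definition fan :: "nat \<Rightarrow> 'a set" where "fan k = (\<Union>i<k. closure (W i))"

text \<open>Each new triangle is attached along the single spoke \<open>b k\<close>. The bound
  \<open>k < m\<close> keeps the first spoke apart from the current one, so that the rest of the
  boundary is an arc too.\<close>

lemma fan_closed_disk:
  assumes "0 < k" "k < m"
  shows "closed_disk (fan k) (b 0 \<union> rim k \<union> b k)"
  using assms
proof (induction k)
  case (Suc k)
  show ?case
  proof (cases "k = 0")
    case True
    have "a 0 \<union> b 0 \<union> b 1 = b 0 \<union> a 0 \<union> b 1" by auto
    then show ?thesis using face_closed_disk[OF W[of 0]] True
      by (simp add: fan_def rim_def edges lessThan_Suc Un_assoc)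
  next
    case False
    then have k: "0 < k" "k < m" "Suc k < m" using Suc.prems by auto
    obtain \<alpha> where \<alpha>: "arc \<alpha>" "path_image \<alpha> = b k" "pathstart \<alpha> = p k" "pathfinish \<alpha> = z"
      using edge_arc_from[OF edges(2) b_ends] .
    obtain \<beta>1 where \<beta>1: "arc \<beta>1" "path_image \<beta>1 = rim k" "pathstart \<beta>1 = p 0" "pathfinish \<beta>1 = p k"
      using rim_arc[OF k(1,2)] .
    obtain \<beta>2 where \<beta>2: "arc \<beta>2" "path_image \<beta>2 = b 0" "pathstart \<beta>2 = p 0" "pathfinish \<beta>2 = z"
      using edge_arc_from[OF edges(2) b_ends] .
    obtain \<gamma>1 where \<gamma>1: "arc \<gamma>1" "path_image \<gamma>1 = a k" "pathstart \<gamma>1 = p k" "pathfinish \<gamma>1 = p (Suc k)"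
      using edge_arc_from[OF edges(1) a_ends] .
    obtain \<gamma>2 where \<gamma>2: "arc \<gamma>2" "path_image \<gamma>2 = b (Suc k)" "pathstart \<gamma>2 = p (Suc k)" "pathfinish \<gamma>2 = z"
      using edge_arc_from[OF edges(2) b_ends] .
    \<comment> \<open>Both arcs complement the spoke \<open>b k\<close> and run from
      \<open>p k\<close> to \<open>z\<close>: \<open>\<beta>\<close> back along the rim and then
      along \<open>b 0\<close>, \<open>\<gamma>\<close> along the other two sides of the new
      triangle.\<close>
    define \<beta> \<gamma> where "\<beta> = reversepath \<beta>1 +++ \<beta>2" and "\<gamma> = \<gamma>1 +++ \<gamma>2"
    have pk: "p (Suc k) \<noteq> p k" using p_inj[of "Suc k" k] k by auto
    have bb: "b k \<inter> b 0 = {z}" "b k \<inter> b (Suc k) = {z}" using b_Int_b[of k] k by auto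
    have ab: "a k \<inter> b k = {p k}" "a k \<inter> b (Suc k) = {p (Suc k)}" unfolding a_Int_b by auto
    have br: "b 0 \<inter> rim k = {p 0}" "b k \<inter> rim k = {p k}"
      using b0_Int_rim bk_Int_rim k by auto
    have \<beta>: "arc \<beta>" "path_image \<beta> = rim k \<union> b 0" "pathstart \<beta> = p k" "pathfinish \<beta> = z"
    proof -
      show "arc \<beta>" unfolding \<beta>_def
        by (rule arc_join) (use \<beta>1 \<beta>2 br in \<open>auto simp: arc_reversepath\<close>)
    qed (use \<beta>1 \<beta>2 in \<open>simp_all add: \<beta>_def path_image_join\<close>)
    have \<gamma>: "arc \<gamma>" "path_image \<gamma> = a k \<union> b (Suc k)" "pathstart \<gamma> = p k" "pathfinish \<gamma> = z"
    proof -
      show "arc \<gamma>" unfolding \<gamma>_def by (rule arc_join) (use \<gamma>1 \<gamma>2 ab in auto)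
    qed (use \<gamma>1 \<gamma>2 in \<open>simp_all add: \<gamma>_def path_image_join\<close>)
    have "closed_disk (fan k \<union> closure (W k)) (path_image \<beta> \<union> path_image \<gamma>)"
    proof (rule closed_disk_glue)
      show "arc \<alpha>" "arc \<beta>" "arc \<gamma>" by fact+
      show "pathstart \<beta> = pathstart \<alpha>" "pathfinish \<beta> = pathfinish \<alpha>" "pathstart \<gamma> = pathstart \<alpha>"
        "pathfinish \<gamma> = pathfinish \<alpha>" using \<alpha> \<beta> \<gamma> by simp_all
      have "b 0 \<union> rim k \<union> b k = path_image \<alpha> \<union> path_image \<beta>" unfolding \<alpha>(2) \<beta>(2) by auto
      then show "closed_disk (fan k) (path_image \<alpha> \<union> path_image \<beta>)" using Suc.IH[OF k(1,2)] by simp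
      have "\<Union>(edges_of (W k)) = path_image \<alpha> \<union> path_image \<gamma>" unfolding \<alpha>(2) \<gamma>(2) edges(3) by auto
      then show "closed_disk (closure (W k)) (path_image \<alpha> \<union> path_image \<gamma>)"
        using face_closed_disk[OF W[of k]] by simp
      have "b k \<inter> (rim k \<union> b 0) = (b k \<inter> rim k) \<union> (b k \<inter> b 0)" by auto
      then show "path_image \<alpha> \<inter> path_image \<beta> = {pathstart \<alpha>, pathfinish \<alpha>}"
        unfolding \<alpha>(2-4) \<beta>(2) bb br by auto
      have "b k \<inter> (a k \<union> b (Suc k)) = (a k \<inter> b k) \<union> (b k \<inter> b (Suc k))" by auto
      then show "path_image \<alpha> \<inter> path_image \<gamma> = {pathstart \<alpha>, pathfinish \<alpha>}"
        unfolding \<alpha>(2-4) \<gamma>(2) bb ab by auto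
      have "fan k \<inter> closure (W k) = (\<Union>i<k. closure (W i) \<inter> closure (W k))" by (auto simp: fan_def)
      also have "\<dots> = (\<Union>i<k. if Suc i = k then b k else {z})"
        using k closure_Int by (intro SUP_cong) auto
      also have "\<dots> = b k"
      proof (intro equalityI subsetI)
        fix x assume x: "x \<in> b k"
        show "x \<in> (\<Union>i<k. if Suc i = k then b k else {z})"
          by (rule UN_I[of "k - 1"]) (use x k in simp_all)
      qed (use bb in \<open>auto split: if_splits\<close>)
      finally show "fan k \<inter> closure (W k) = path_image \<alpha>" by (simp add: \<alpha>)
    qed
    moreover have "fan k \<union> closure (W k) = fan (Suc k)" by (simp add: fan_def lessThan_Suc Un_commute)
    moreover have "path_image \<beta> \<union> path_image \<gamma> = b 0 \<union> rim (Suc k) \<union> b (Suc k)"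
      unfolding \<beta>(2) \<gamma>(2) by (auto simp: rim_def lessThan_Suc)
    ultimately show ?thesis by simp
  qed
qed simp

text \<open>The last triangle fills the gap between two spokes at once: the gluing arc runs from
  \<open>p k\<close> through \<open>z\<close> to \<open>p 0\<close>. Both spokes thereby become
  interior and only the rim remains.\<close>

lemma star_closed_disk: "closed_disk (fan m) (rim m)"
proof -
  define k where "k = m - 1"
  have k: "0 < k" "k < m" "Suc k = m" using m(1) by (auto simp: k_def)
  obtain \<alpha>1 where \<alpha>1: "arc \<alpha>1" "path_image \<alpha>1 = b k" "pathstart \<alpha>1 = p k" "pathfinish \<alpha>1 = z"
    using edge_arc_from[OF edges(2) b_ends] .
  obtain \<alpha>2 where \<alpha>2: "arc \<alpha>2" "path_image \<alpha>2 = b 0" "pathstart \<alpha>2 = p 0" "pathfinish \<alpha>2 = z"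
    using edge_arc_from[OF edges(2) b_ends] .
  obtain \<beta>1 where \<beta>1: "arc \<beta>1" "path_image \<beta>1 = rim k" "pathstart \<beta>1 = p 0" "pathfinish \<beta>1 = p k"
    using rim_arc[OF k(1,2)] .
  have pSk: "p (Suc k) = p 0" "b (Suc k) = b 0" using p_m b_m k(3) by auto
  obtain \<gamma> where \<gamma>: "arc \<gamma>" "path_image \<gamma> = a k" "pathstart \<gamma> = p k" "pathfinish \<gamma> = p 0"
    using edge_arc_from[OF edges(1) a_ends, of k] pSk by metis
  define \<alpha> \<beta> where "\<alpha> = \<alpha>1 +++ reversepath \<alpha>2" and "\<beta> = reversepath \<beta>1"
  have bb: "b k \<inter> b 0 = {z}" using b_Int_b[of k 0] k by auto
  have ab: "a k \<inter> b k = {p k}" "a k \<inter> b 0 = {p 0}" unfolding a_Int_b pSk by auto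
  have br: "b 0 \<inter> rim k = {p 0}" "b k \<inter> rim k = {p k}"
    using b0_Int_rim bk_Int_rim k by auto
  have \<alpha>: "arc \<alpha>" "path_image \<alpha> = b k \<union> b 0" "pathstart \<alpha> = p k" "pathfinish \<alpha> = p 0"
  proof -
    show "arc \<alpha>" unfolding \<alpha>_def
      by (rule arc_join) (use \<alpha>1 \<alpha>2 bb in \<open>auto simp: arc_reversepath\<close>)
  qed (use \<alpha>1 \<alpha>2 in \<open>simp_all add: \<alpha>_def path_image_join\<close>)
  have \<beta>: "arc \<beta>" "path_image \<beta> = rim k" "pathstart \<beta> = p k" "pathfinish \<beta> = p 0"
    using \<beta>1 by (simp_all add: \<beta>_def arc_reversepath)
  have "closed_disk (fan k \<union> closure (W k)) (path_image \<beta> \<union> path_image \<gamma>)"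
  proof (rule closed_disk_glue)
    show "arc \<alpha>" "arc \<beta>" "arc \<gamma>" by fact+
    show "pathstart \<beta> = pathstart \<alpha>" "pathfinish \<beta> = pathfinish \<alpha>" "pathstart \<gamma> = pathstart \<alpha>"
      "pathfinish \<gamma> = pathfinish \<alpha>" using \<alpha> \<beta> \<gamma> by simp_all
    have "b 0 \<union> rim k \<union> b k = path_image \<alpha> \<union> path_image \<beta>" unfolding \<alpha>(2) \<beta>(2) by auto
    then show "closed_disk (fan k) (path_image \<alpha> \<union> path_image \<beta>)"
      using fan_closed_disk[OF k(1,2)] by simp
    have "\<Union>(edges_of (W k)) = path_image \<alpha> \<union> path_image \<gamma>"
      unfolding \<alpha>(2) \<gamma>(2) edges(3) pSk by auto
    then show "closed_disk (closure (W k)) (path_image \<alpha> \<union> path_image \<gamma>)"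
      using face_closed_disk[OF W[of k]] by simp
    have "(b k \<union> b 0) \<inter> rim k = (b k \<inter> rim k) \<union> (b 0 \<inter> rim k)" by auto
    then show "path_image \<alpha> \<inter> path_image \<beta> = {pathstart \<alpha>, pathfinish \<alpha>}"
      unfolding \<alpha>(2-4) \<beta>(2) br by auto
    have "(b k \<union> b 0) \<inter> a k = (a k \<inter> b k) \<union> (a k \<inter> b 0)" by auto
    then show "path_image \<alpha> \<inter> path_image \<gamma> = {pathstart \<alpha>, pathfinish \<alpha>}"
      unfolding \<alpha>(2-4) \<gamma>(2) ab by auto
    have "fan k \<inter> closure (W k) = (\<Union>i<k. closure (W i) \<inter> closure (W k))" by (auto simp: fan_def)
    also have "\<dots> = (\<Union>i<k. (if Suc i = k then b k else {z}) \<union> (if i = 0 then b 0 else {}))"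
      using k closure_Int by (intro SUP_cong) auto
    also have "\<dots> = b k \<union> b 0"
    proof (intro equalityI subsetI)
      fix x assume "x \<in> b k \<union> b 0"
      then show "x \<in> (\<Union>i<k. (if Suc i = k then b k else {z}) \<union> (if i = 0 then b 0 else {}))"
      proof
        assume "x \<in> b k" then show ?thesis
          by (intro UN_I[of "k - 1"]) (use k in simp_all)
      next
        assume "x \<in> b 0" then show ?thesis
          by (intro UN_I[of 0]) (use k in simp_all)
      qed
    qed (use bb in \<open>auto split: if_splits\<close>)
    finally show "fan k \<inter> closure (W k) = path_image \<alpha>" by (simp add: \<alpha>)
  qed
  moreover have "fan k \<union> closure (W k) = fan m"
    unfolding k(3)[symmetric] by (simp add: fan_def lessThan_Suc Un_commute)
  moreover have "path_image \<beta> \<union> path_image \<gamma> = rim m"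
    unfolding \<beta>(2) \<gamma>(2) k(3)[symmetric] by (auto simp: rim_def lessThan_Suc)
  ultimately show ?thesis by simp
qed

lemma fan_orbit: "fan m = (\<Union>G\<in>orbit F0. closure G)"
  unfolding fan_def orbit_eq W_def by auto

lemma rim_skeleton: "rim m \<subseteq> skeleton"
  using W by (auto simp: rim_def a_def)

text \<open>Open faces and \<open>z\<close> avoid \<open>skeleton\<close>, and a spoke meets it at
  most in its outer end, which lies on a rim edge anyway.\<close>

lemma fan_Int_skeleton: "fan m \<inter> skeleton = rim m"
proof
  show "fan m \<inter> skeleton \<subseteq> rim m"
  proof
    fix x assume x: "x \<in> fan m \<inter> skeleton"
    then obtain i where i: "i < m" "x \<in> closure (W i)" by (auto simp: fan_def)
    have "z \<in> V" using b_ends[of 0] by blast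
    then have z: "z \<notin> skeleton" using inner by (auto simp: z_def V2_def)
    have bs: "b j \<inter> skeleton \<subseteq> {p j}" for j
    proof -
      have "b j \<notin> A ` faces" using A_ne(1)[OF _ W[of j]] unfolding b_def by force
      then have "(b j - V) \<inter> skeleton = {}" by (rule edge_Int_skeleton[OF edges(2)])
      then have "b j \<inter> skeleton \<subseteq> (b j \<inter> V) \<inter> skeleton" by blast
      then show ?thesis unfolding b_ends using z by blast
    qed
    have "x \<notin> W i" using face_props(3)[OF W[of i]] skeleton_subset x by blast
    then have "x \<in> a i \<or> x = p i \<or> x = p (Suc i)"
      using i(2) x bs[of i] bs[of "Suc i"] unfolding closure_W by blast
    then have "x \<in> a i" using p_in_a by auto
    then show "x \<in> rim m" using i(1) by (auto simp: rim_def)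
  qed
  show "rim m \<subseteq> fan m \<inter> skeleton"
    using rim_skeleton closure_W by (auto simp: rim_def fan_def)
qed

definition region :: "'a set" where "region = fan m - skeleton"

lemma region_eq: "region = fan m - rim m"
  unfolding region_def using fan_Int_skeleton by blast

lemma region_disk:
  obtains h k where "homeomorphism (cball (0::complex) 1) (fan m) h k" "h ` ball 0 1 = region"
proof -
  obtain h k where h: "homeomorphism (cball (0::complex) 1) (fan m) h k" "h ` sphere 0 1 = rim m"
    using star_closed_disk unfolding closed_disk_def by blast
  have "inj_on h (cball 0 1)" using h(1) by (auto simp: homeomorphism_def intro: inj_on_inverseI)
  then have "h ` (cball 0 1 - sphere 0 1) = h ` cball 0 1 - h ` sphere 0 1"
    by (intro inj_on_image_set_diff) auto
  moreover have "cball (0::complex) 1 - sphere 0 1 = ball 0 1" by auto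
  ultimately have "h ` ball 0 1 = region" using h by (simp add: homeomorphism_def region_eq)
  then show ?thesis using that h(1) by blast
qed

lemma region_homeomorphic: "region homeomorphic ball (0::complex) 1"
proof -
  obtain h k where h: "homeomorphism (cball (0::complex) 1) (fan m) h k" "h ` ball 0 1 = region"
    by (rule region_disk)
  have "region \<subseteq> fan m" by (auto simp: region_def)
  then have "homeomorphism (ball 0 1) region h k"
    by (intro homeomorphism_of_subsets[OF h(1)] h(2)) auto
  then show ?thesis using homeomorphic_def homeomorphic_sym by blast
qed

lemma region_component: "region \<in> components (M - skeleton)"
proof -
  have "connected region"
    using region_homeomorphic homeomorphic_connectedness connected_ball by blast
  then show ?thesis
    unfolding region_def fan_orbit by (rule orbit_region_component[OF F0])
qed

lemma closure_region: "closure region = fan m"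
proof
  have "closed (fan m)" unfolding fan_def by (intro closed_UN) auto
  then show "closure region \<subseteq> fan m" by (rule closure_minimal[rotated]) (auto simp: region_def)
  have "closure (W i) \<subseteq> closure region" if "i < m" for i
  proof (rule closure_mono)
    have "W i \<inter> skeleton = {}" using face_props(3)[OF W[of i]] skeleton_subset by blast
    then show "W i \<subseteq> region" using closure_subset[of "W i"] that by (auto simp: region_def fan_def)
  qed
  then show "fan m \<subseteq> closure region" by (auto simp: fan_def)
qed

lemma closed_cell_region: "closed_cell region"
proof -
  obtain h k where "homeomorphism (cball (0::complex) 1) (fan m) h k" "h ` ball 0 1 = region"
    by (rule region_disk)
  then show ?thesis unfolding closed_cell_def closure_region by (intro exI conjI)
qed

lemma region_boundary: "closure region - region = rim m"
proof -
  have "rim m \<subseteq> fan m" using fan_Int_skeleton by blast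
  then show ?thesis unfolding closure_region unfolding region_eq by blast
qed

end

section \<open>The digraph of type II edges\<close>

context flow_triangulation
begin

text \<open>This is \<open>Gamma_II\<close> written in terms of the flow.\<close>

definition flow_digraph :: "('a, 'a set) pre_digraph" where
  "flow_digraph = \<lparr>verts = V2, arcs = A ` faces, tail = src, head = tgt\<rparr>"

lemma A_ends: "e \<in> A ` faces \<Longrightarrow> e \<inter> V = {src e, tgt e}"
  using flow_ends(1) by blast

lemma ends_V2: assumes "e \<in> A ` faces" shows "src e \<in> V2" "tgt e \<in> V2"
  using assms verts_V2 by blast+

lemma A_subset_E: "A ` faces \<subseteq> E"
  using flow_edges(2) by blast

text \<open>By \<open>A_ne\<close> such an edge is never an entry or exit edge, so it plays the role
  of \<open>A\<close> in both of its faces.\<close>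

lemma faces_of_A:
  assumes "e \<in> A ` faces" shows "card {F \<in> faces. A F = e} = 2"
proof -
  have "{F \<in> faces. A F = e} = {F \<in> faces. e \<in> edges_of F}"
  proof (intro Collect_cong conj_cong refl)
    fix F assume F: "F \<in> faces"
    have "e \<noteq> B F" "e \<noteq> C F" using assms A_ne F by blast+
    then show "A F = e \<longleftrightarrow> e \<in> edges_of F" unfolding flow_edges(1)[OF F] by auto
  qed
  then show ?thesis using edge_faces A_subset_E assms by auto
qed

lemma card_faces_over:
  assumes "S \<subseteq> A ` faces" shows "card {F \<in> faces. A F \<in> S} = 2 * card S"
proof -
  have fin: "finite S" using assms finite_faces by (meson finite_imageI finite_subset)
  have "{F \<in> faces. A F \<in> S} = (\<Union>e\<in>S. {F \<in> faces. A F = e})" by auto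
  also have "card \<dots> = (\<Sum>e\<in>S. card {F \<in> faces. A F = e})"
    by (rule card_UN_disjoint[OF fin]) (use finite_faces in auto)
  also have "\<dots> = (\<Sum>e\<in>S. 2)" using faces_of_A assms by (intro sum.cong) auto
  finally show ?thesis by simp
qed

text \<open>
  The flow enters and leaves each edge at v outside the digraph equally often, so there are as
  many faces in which v is the tail of the digraph edge as faces in which it is the head.
\<close>

lemma degrees_equal:
  assumes v: "v \<in> V"
  shows "card {e \<in> A ` faces. tgt e = v} = card {e \<in> A ` faces. src e = v}"
proof -
  have fin: "finite {F \<in> faces. P F}" for P using finite_faces by simp
  have "B ` {F \<in> faces. v \<in> B F} = {e \<in> B ` faces. v \<in> e}" by blast
  moreover have "C ` {F \<in> faces. v \<in> C F} = {e \<in> B ` faces. v \<in> e}" unfolding B_eq_C by blast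
  ultimately have eq: "card {F \<in> faces. v \<in> B F} = card {F \<in> faces. v \<in> C F}"
    by (metis (no_types, lifting) card_image inj_B inj_C inj_on_subset mem_Collect_eq subsetI)
  have "v \<in> B F \<longleftrightarrow> src (A F) = v \<or> apex F = v" "v \<in> C F \<longleftrightarrow> tgt (A F) = v \<or> apex F = v"
    if F: "F \<in> faces" for F
  proof -
    have "v \<in> B F \<longleftrightarrow> v \<in> B F \<inter> V" "v \<in> C F \<longleftrightarrow> v \<in> C F \<inter> V" using v by auto
    then show "v \<in> B F \<longleftrightarrow> src (A F) = v \<or> apex F = v" "v \<in> C F \<longleftrightarrow> tgt (A F) = v \<or> apex F = v"
      unfolding flow_ends(2,3)[OF F] by auto
  qed
  \<comment> \<open>Faces with apex \<open>v\<close> contribute equally to both counts and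
    cancel.\<close>
  then have "{F \<in> faces. v \<in> B F} = {F \<in> faces. src (A F) = v} \<union> {F \<in> faces. apex F = v}"
    "{F \<in> faces. v \<in> C F} = {F \<in> faces. tgt (A F) = v} \<union> {F \<in> faces. apex F = v}" by auto
  moreover have "{F \<in> faces. src (A F) = v} \<inter> {F \<in> faces. apex F = v} = {}"
    "{F \<in> faces. tgt (A F) = v} \<inter> {F \<in> faces. apex F = v} = {}"
    using flow_ends(6,7) by auto
  ultimately have "card {F \<in> faces. v \<in> B F} = card {F \<in> faces. src (A F) = v} + card {F \<in> faces. apex F = v}"
    "card {F \<in> faces. v \<in> C F} = card {F \<in> faces. tgt (A F) = v} + card {F \<in> faces. apex F = v}"
    using fin by (simp_all add: card_Un_disjoint)
  then have "card {F \<in> faces. src (A F) = v} = card {F \<in> faces. tgt (A F) = v}" using eq by simp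
  \<comment> \<open>Each arc is counted by its two faces; the factor 2 is the same on both
    sides.\<close>
  moreover have "{F \<in> faces. src (A F) = v} = {F \<in> faces. A F \<in> {e \<in> A ` faces. src e = v}}"
    "{F \<in> faces. tgt (A F) = v} = {F \<in> faces. A F \<in> {e \<in> A ` faces. tgt e = v}}" by auto
  ultimately show ?thesis
    using card_faces_over[of "{e \<in> A ` faces. src e = v}"] card_faces_over[of "{e \<in> A ` faces. tgt e = v}"]
    by simp
qed

lemma faces_nonempty: "faces \<noteq> {}"
proof -
  have "V \<noteq> {}" using embedding by (simp add: simple_graph_embedding_def)
  then obtain v where "v \<in> V" by blast
  then obtain e where "e \<in> E" by (rule vertex_has_edge)
  then show ?thesis using edge_in_face by blast
qed

lemma flow_digraph: "digraph flow_digraph"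
proof
  show "finite (verts flow_digraph)" using finite_V by (simp add: flow_digraph_def V2_def)
  show "finite (arcs flow_digraph)" using finite_faces by (simp add: flow_digraph_def)
  fix e assume "e \<in> arcs flow_digraph"
  then have e: "e \<in> A ` faces" by (simp add: flow_digraph_def)
  show "tail flow_digraph e \<in> verts flow_digraph" "head flow_digraph e \<in> verts flow_digraph"
    using ends_V2[OF e] by (simp_all add: flow_digraph_def)
  show "tail flow_digraph e \<noteq> head flow_digraph e"
    using edge_ends_ne[OF _ A_ends[OF e]] A_subset_E e by (auto simp: flow_digraph_def)
next
  fix e e' assume "e \<in> arcs flow_digraph" "e' \<in> arcs flow_digraph"
    and eq: "arc_to_ends flow_digraph e = arc_to_ends flow_digraph e'"
  then have e: "e \<in> A ` faces" "e' \<in> A ` faces" by (simp_all add: flow_digraph_def)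
  have "e \<inter> V = e' \<inter> V"
    using eq unfolding A_ends[OF e(1)] A_ends[OF e(2)] by (simp add: arc_to_ends_def flow_digraph_def)
  then show "e = e'" using edge_eqI e A_subset_E by blast
qed

lemma embedding_V2: "simple_graph_embedding M V2 (A ` faces)"
proof -
  have V2V: "V2 \<subseteq> V" by (auto simp: V2_def)
  have eV: "e \<inter> V2 = e \<inter> V" if "e \<in> A ` faces" for e
    using V2V ends_V2[OF that] A_ends[OF that] by auto
  have "V2 \<noteq> {}" using faces_nonempty verts_V2 by blast
  moreover have "finite V2" "V2 \<subseteq> M" using finite_V V_subset V2V finite_subset by blast+
  moreover have "finite (A ` faces)" using finite_faces by simp
  moreover have "e \<subseteq> M \<and> (\<exists>g. arc g \<and> path_image g = e \<and> e \<inter> V2 = {pathstart g, pathfinish g})"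
    if e: "e \<in> A ` faces" for e
  proof -
    have "e \<in> E" using e A_subset_E by blast
    then obtain g where "arc g" "path_image g = e" "e \<inter> V = {pathstart g, pathfinish g}"
      by (rule edge_arc)
    then show ?thesis using E_subset[OF \<open>e \<in> E\<close>] eV[OF e] by auto
  qed
  moreover have "e \<inter> e' \<subseteq> V2" if "e \<in> A ` faces" "e' \<in> A ` faces" "e \<noteq> e'" for e e'
    using edge_inter[of e e'] eV[OF that(1)] A_subset_E that by blast
  moreover have "e \<inter> V2 \<noteq> e' \<inter> V2" if "e \<in> A ` faces" "e' \<in> A ` faces" "e \<noteq> e'" for e e'
    using edge_eqI[of e e'] eV[OF that(1)] eV[OF that(2)] A_subset_E that by blast
  ultimately show ?thesis unfolding simple_graph_embedding_def by (intro conjI ballI impI; simp)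
qed

end

text \<open>The rim edges follow each other head to tail by \<open>tgt_a\<close>, and
  \<open>p_inj\<close> makes their sources distinct. Distinctness is required of the tail of the
  vertex list because the closed walk repeats its start at the end.\<close>

lemma (in inner_star) directed_cycle: "directed_cycle_boundary flow_digraph region"
proof -
  define q where "q = map a [0..<m]"
  have set_q: "set q = a ` {..<m}" by (auto simp: q_def)
  have cas: "pre_digraph.cas flow_digraph (p i) (map a [i..<i + n]) (p (i + n))" for i n
  proof (induction n arbitrary: i)
    case 0 then show ?case by (simp add: pre_digraph.cas.simps)
  next
    case (Suc n)
    have "[i..<i + Suc n] = i # [Suc i..<Suc i + n]" by (simp add: upt_conv_Cons)
    then show ?case using Suc[of "Suc i"] tgt_a[of i]
      by (simp add: pre_digraph.cas.simps flow_digraph_def p_def)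
  qed
  have ne: "q \<noteq> []" using m(1) by (simp add: q_def)
  have verts: "pre_digraph.awalk_verts flow_digraph (p 0) q = map p [0..<m] @ [p 0]"
  proof -
    have "last q = a (m - 1)" using m(1) by (simp add: q_def last_map)
    moreover have "tgt (a (m - 1)) = p 0" using tgt_a[of "m - 1"] p_m m(1) by simp
    ultimately show ?thesis
      using ne by (simp add: pre_digraph.awalk_verts_conv flow_digraph_def) (simp add: q_def p_def)
  qed
  have "distinct (tl (map p [0..<m] @ [p 0]))"
  proof -
    have "[0..<m] = 0 # [1..<m]" using m(1) by (simp add: upt_conv_Cons)
    then have "tl (map p [0..<m] @ [p 0]) = map p [1..<m] @ [p 0]" by simp
    moreover have "inj_on p {1..<m}" by (rule inj_onI) (use p_inj in auto)
    moreover have "p 0 \<notin> p ` {1..<m}" using p_inj[of 0] m(1) by fastforce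
    ultimately show ?thesis by (simp add: distinct_map)
  qed
  moreover have "pre_digraph.awalk flow_digraph (p 0) q (p 0)"
  proof -
    have "p 0 \<in> V2" unfolding p_def a_def by (rule verts_V2(1)[OF W])
    moreover have "set q \<subseteq> A ` faces" unfolding set_q a_def using W by blast
    ultimately show ?thesis
      using cas[of 0 m] p_m unfolding pre_digraph.awalk_def by (simp add: flow_digraph_def q_def)
  qed
  ultimately have "pre_digraph.cycle flow_digraph q"
    unfolding pre_digraph.cycle_def using verts ne by auto
  moreover have "closure region - region = \<Union>(set q)"
    unfolding region_boundary set_q rim_def ..
  ultimately show ?thesis unfolding directed_cycle_boundary_def by blast
qed

section \<open>Regions and connectedness of the digraph\<close>

locale disk_flow = flow_triangulation +
  assumes apex_inner: "F \<in> faces \<Longrightarrow> apex F \<notin> V2"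
begin

lemma inner_star_ex:
  assumes "F \<in> faces" obtains m where "inner_star M V E A B C apex src tgt F m"
proof -
  obtain m where "m > 1" "(next_face ^^ m) F = F" "inj_on (\<lambda>i. (next_face ^^ i) F) {..<m}"
    "orbit F = (\<lambda>i. (next_face ^^ i) F) ` {..<m}" using orbit_cycle[OF assms] .
  then have "inner_star M V E A B C apex src tgt F m"
    by unfold_locales (use assms apex_inner in auto)
  then show ?thesis by (rule that)
qed

text \<open>A point of the component lies in some closed face, hence in the region of the star of
  its apex; components that meet coincide.\<close>

lemma component_region:
  assumes "R \<in> components (M - skeleton)"
  shows "R homeomorphic ball (0::complex) 1 \<and> closed_cell R \<and> directed_cycle_boundary flow_digraph R"
proof -
  obtain x where x: "x \<in> R" using in_components_nonempty[OF assms] by blast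
  have "x \<in> M - skeleton" using in_components_subset[OF assms] x by blast
  then obtain F where F: "F \<in> faces" "x \<in> closure F" "x \<notin> skeleton"
    using equalityD1[OF M_eq] by blast
  obtain m where star: "inner_star M V E A B C apex src tgt F m" by (rule inner_star_ex[OF F(1)])
  interpret S: inner_star M V E A B C apex src tgt F m by (rule star)
  have "x \<in> S.region" unfolding S.region_def S.fan_orbit using F self_in_orbit by blast
  then have "R \<inter> S.region \<noteq> {}" using x by blast
  then have "R = S.region" using components_nonoverlap[OF assms S.region_component] by blast
  then show ?thesis
    using S.region_homeomorphic S.closed_cell_region S.directed_cycle by simp
qed

lemma closed_two_cell: "closed_two_cell_embedding M V2 (A ` faces)"
proof -
  have "graph_faces M V2 (A ` faces) = components (M - skeleton)" by (rule graph_faces_def)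
  then show ?thesis unfolding closed_two_cell_embedding_def two_cell_embedding_def
    using component_region embedding_V2 by simp
qed

text \<open>Both orientations of each arc are included because connectedness of a digraph refers to
  its symmetric closure.\<close>

definition link :: "('a \<times> 'a) set" where
  "link = (\<Union>e\<in>A ` faces. {(src e, tgt e), (tgt e, src e)})"

lemma link_orbit:
  assumes F: "F \<in> faces" and G: "G \<in> orbit F"
  shows "(src (A F), src (A G)) \<in> link\<^sup>*"
proof -
  obtain m where star: "inner_star M V E A B C apex src tgt F m" by (rule inner_star_ex[OF F])
  interpret S: inner_star M V E A B C apex src tgt F m by (rule star)
  have "(S.p 0, S.p n) \<in> link\<^sup>*" for n
  proof (induction n)
    case (Suc n)
    have "S.a n \<in> A ` faces" unfolding S.a_def using S.W by blast
    then have "(src (S.a n), tgt (S.a n)) \<in> link" unfolding link_def by blast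
    then have "(S.p n, S.p (Suc n)) \<in> link" unfolding S.tgt_a by (simp only: S.p_def)
    then show ?case using Suc by (rule rtrancl_into_rtrancl[rotated])
  qed simp
  moreover obtain n where "G = S.W n" using G unfolding orbit_def S.W_def by blast
  moreover have "F = S.W 0" by (simp add: S.W_def)
  ultimately show ?thesis by (simp add: S.p_def S.a_def)
qed

text \<open>A path of the triangulation through a vertex of type I is rerouted along the rim of the
  star of that vertex.\<close>

lemma link_V2: assumes u: "u \<in> V2" and v: "v \<in> V2" shows "(u, v) \<in> link\<^sup>*"
proof -
  let ?r = "{(x, y). \<exists>e\<in>E. e \<inter> V = {x, y}}"
  \<comment> \<open>At a vertex of type I the invariant speaks of every face with this apex, since
    the path may leave the star along any spoke.\<close>
  define P where "P v \<longleftrightarrow> (v \<in> V2 \<longrightarrow> (u, v) \<in> link\<^sup>*) \<and>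
    (\<forall>F\<in>faces. v \<notin> V2 \<longrightarrow> apex F = v \<longrightarrow> (u, src (A F)) \<in> link\<^sup>*)" for v
  have "(u, v) \<in> ?r\<^sup>*"
  proof -
    have "graph_connected V E" using triangulation by (simp add: surface_triangulation_def)
    moreover have "u \<in> V" "v \<in> V" using u v by (simp_all add: V2_def)
    ultimately show ?thesis unfolding graph_connected_def by simp
  qed
  then have "P v"
  proof (induction rule: rtrancl_induct)
    case base show ?case using u by (simp add: P_def)
  next
    case (step v w)
    then obtain e where e: "e \<in> E" "e \<inter> V = {v, w}" by blast
    from e(1) show ?case
    proof (cases rule: edge_cases)
      case (1 F)
      then have eA: "e \<in> A ` faces" by blast
      then have "{v, w} = {src e, tgt e}" using A_ends e(2) by simp
      then have vw: "(v, w) \<in> link" "v \<in> V2" "w \<in> V2"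
        using eA ends_V2[OF eA] unfolding link_def by (auto simp: doubleton_eq_iff)
      then have "(u, w) \<in> link\<^sup>*" using step.IH unfolding P_def by (meson rtrancl_into_rtrancl)
      then show ?thesis using vw(3) by (simp add: P_def)
    next
      case (2 F)
      then have "{v, w} = {src (A F), apex F}" using e(2) flow_ends(2) by simp
      then consider "v = src (A F)" "w = apex F" | "v = apex F" "w = src (A F)"
        by (auto simp: doubleton_eq_iff)
      then show ?thesis
      proof cases
        case 1
        have uv: "(u, src (A F)) \<in> link\<^sup>*" using step.IH verts_V2(1)[OF 2(1)] 1(1) by (simp add: P_def)
        \<comment> \<open>All faces with this apex lie on one orbit, and their rim vertices are
          linked along the rim.\<close>
        have "(u, src (A G)) \<in> link\<^sup>*" if G: "G \<in> faces" "apex G = w" for G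
        proof -
          have "apex F \<in> closure G" using apex_in[OF G(1)] G(2) 1(2) by simp
          then have "G \<in> orbit F"
            using faces_at_inner_vertex[OF 2(1) apex_inner[OF 2(1)]] G(1) by blast
          then show ?thesis using rtrancl_trans[OF uv link_orbit[OF 2(1)]] by blast
        qed
        then show ?thesis using apex_inner[OF 2(1)] 1(2) by (simp add: P_def)
      next
        case down: 2
        have "(u, src (A F)) \<in> link\<^sup>*"
          using step.IH apex_inner[OF 2(1)] down(1) 2(1) by (auto simp: P_def)
        then show ?thesis using verts_V2(1)[OF 2(1)] down(2) by (simp add: P_def)
      qed
    qed
  qed
  then show ?thesis using v by (simp add: P_def)
qed

lemma eulerian_flow_digraph: "eulerian flow_digraph"
  unfolding eulerian_def
proof
  interpret D: digraph flow_digraph by (rule flow_digraph)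
  interpret S: pair_wf_digraph "mk_symmetric flow_digraph" by (rule D.wellformed_mk_symmetric)
  have wf: "wf_digraph (with_proj (mk_symmetric flow_digraph))" by unfold_locales
  have V2: "verts flow_digraph = V2" by (simp add: flow_digraph_def)
  have parcs: "parcs (mk_symmetric flow_digraph) = link"
    by (simp add: parcs_mk_symmetric link_def flow_digraph_def)
  have "u \<rightarrow>\<^sup>*\<^bsub>mk_symmetric flow_digraph\<^esub> v" if "u \<in> V2" "v \<in> V2" for u v
  proof (cases "u = v")
    case True then show ?thesis using that by (simp add: V2)
  next
    case False
    then have "(u, v) \<in> (arcs_ends (mk_symmetric flow_digraph))\<^sup>+"
      using link_V2[OF that] by (simp add: parcs rtrancl_eq_or_trancl)
    then show ?thesis by (rule wf_digraph.reachable1_reachable[OF wf])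
  qed
  moreover have "V2 \<noteq> {}" using embedding_V2 by (simp add: simple_graph_embedding_def)
  ultimately show "Digraph_Component.connected flow_digraph"
    unfolding Digraph_Component.connected_def strongly_connected_def by (simp add: V2)
  show "\<forall>v\<in>verts flow_digraph. in_degree flow_digraph v = out_degree flow_digraph v"
    using degrees_equal
    by (auto simp: in_degree_def out_degree_def in_arcs_def out_arcs_def flow_digraph_def V2_def)
qed

end

section \<open>Zigzags\<close>

context triangulated_surface
begin

text \<open>These are the states of a zigzag: two consecutive edges determine its continuation in
  both directions.\<close>

definition corners :: "('a set \<times> 'a set) set" where
  "corners = {(e, e'). e \<noteq> e' \<and> (\<exists>F\<in>faces. e \<in> edges_of F \<and> e' \<in> edges_of F)}"

text \<open>The condition at one index of a zigzag; \<open>e2 \<noteq> e3\<close>, which a sequence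
  inherits from the next index, is included to make the relation symmetric under reversal.\<close>

definition zigzag_step :: "'a set \<Rightarrow> 'a set \<Rightarrow> 'a set \<Rightarrow> bool" where
  "zigzag_step e1 e2 e3 \<longleftrightarrow> e1 \<noteq> e2 \<and> e2 \<noteq> e3 \<and>
     (\<exists>F\<in>faces. \<exists>F'\<in>faces. F \<noteq> F' \<and> {e1, e2} \<subseteq> edges_of F \<and> {e2, e3} \<subseteq> edges_of F') \<and>
     e1 \<inter> e3 \<inter> V = {}"

lemma zigzag_step_sym: "zigzag_step e1 e2 e3 \<longleftrightarrow> zigzag_step e3 e2 e1"
  unfolding zigzag_step_def by (auto simp: Int_commute Int_left_commute)

lemma zigzag_step_corners: "zigzag_step e1 e2 e3 \<Longrightarrow> (e1, e2) \<in> corners \<and> (e2, e3) \<in> corners"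
  unfolding zigzag_step_def corners_def by auto

lemma corners_sym: "(e, e') \<in> corners \<Longrightarrow> (e', e) \<in> corners"
  by (auto simp: corners_def)

lemma zigzag_seq_iff: "zigzag_seq M V E s \<longleftrightarrow> (\<forall>i. zigzag_step (s i) (s (Suc i)) (s (Suc (Suc i))))"
proof -
  have "zigzag_step (s i) (s (Suc i)) (s (Suc (Suc i))) \<Longrightarrow> s i \<noteq> s (Suc i)" for i by (simp add: zigzag_step_def)
  then show ?thesis unfolding zigzag_seq_def zigzag_step_def by auto
qed

text \<open>
  The faces F = uvw and F' = uvw' on both sides of the edge e = uv, with other edges eu = uw, ev = vw,
  eu' = uw' and ev' = vw'.
\<close>

definition diamond where
  "diamond e F F' u v w w' eu ev eu' ev' \<longleftrightarrow>
     F \<noteq> F' \<and> triangle F e ev eu w u v \<and> triangle F' e ev' eu' w' u v"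

lemma triangle_flip: "triangle F e ev eu w u v \<Longrightarrow> triangle F e eu ev w v u"
  using triangle_rotate triangle_swap by meson

lemma diamond_flip:
  "diamond e F F' u v w w' eu ev eu' ev' \<Longrightarrow> diamond e F F' v u w w' ev eu ev' eu'"
  unfolding diamond_def using triangle_flip by simp

lemma diamond_exchange:
  "diamond e F F' u v w w' eu ev eu' ev' \<Longrightarrow> diamond e F' F u v w' w eu' ev' eu ev"
  unfolding diamond_def by auto

lemma diamond_ex:
  assumes t: "triangle F e ev eu w u v"
  obtains F' w' eu' ev' where "diamond e F F' u v w w' eu ev eu' ev'"
proof -
  have F: "F \<in> faces" "e \<in> edges_of F" and ee: "e \<inter> V = {u, v}" using t by (simp_all add: triangle_def)
  obtain F' where F': "F' \<in> faces" "F' \<noteq> F" "e \<in> edges_of F'" using other_face[OF F] by metis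
  obtain f g x y y' where t': "triangle F' e f g x y y'" using triangle_first[OF F'(1,3)] .
  then have "e \<inter> V = {y, y'}" by (simp add: triangle_def)
  then have "{y, y'} = {u, v}" using ee by simp
  then consider "y = u" "y' = v" | "y = v" "y' = u" by (auto simp: doubleton_eq_iff)
  then show ?thesis
  proof cases
    case 1
    then show ?thesis using that[of F' x g f] t t' F'(2) unfolding diamond_def by simp
  next
    case 2
    then show ?thesis using that[of F' x f g] t triangle_flip[OF t'] F'(2) unfolding diamond_def by simp
  qed
qed

lemma diamond_facts:
  assumes d: "diamond e F F' u v w w' eu ev eu' ev'"
  shows "{G \<in> faces. e \<in> edges_of G} = {F, F'}" "w \<noteq> w'"
    "edges_of F = {e, ev, eu}" "edges_of F' = {e, ev', eu'}" "eu \<notin> edges_of F'" "ev \<notin> edges_of F'"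
    "F \<in> faces" "F' \<in> faces" "F \<noteq> F'"
proof -
  have t: "triangle F e ev eu w u v" "triangle F' e ev' eu' w' u v" and ne: "F \<noteq> F'"
    using d by (simp_all add: diamond_def)
  show F: "F \<in> faces" "F' \<in> faces" "F \<noteq> F'" and ed: "edges_of F = {e, ev, eu}" "edges_of F' = {e, ev', eu'}"
    using t ne by (simp_all add: triangle_def)
  have dist: "e \<noteq> ev" "eu \<noteq> e" "ev \<in> E" "ev' \<in> E" "ev \<inter> V = {v, w}" "ev' \<inter> V = {v, w'}" "e \<in> E"
    using t by (simp_all add: triangle_def)
  have "e \<in> edges_of F" "e \<in> edges_of F'" "eu \<in> edges_of F" "ev \<in> edges_of F" by (simp_all add: ed)
  then show nin: "eu \<notin> edges_of F'" "ev \<notin> edges_of F'"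
    using common_edges_eq[OF F, of e] dist(1,2) by metis+
  show "w \<noteq> w'"
  proof
    assume "w = w'"
    \<comment> \<open>Simplicity of the graph identifies edges with the same ends, which would give
      the two faces a second common edge.\<close>
    then have "ev = ev'" using edge_eqI dist by simp
    then show False using nin ed by simp
  qed
  have c: "card {G \<in> faces. e \<in> edges_of G} = 2" by (rule edge_faces[OF dist(7)])
  have "{F, F'} = {G \<in> faces. e \<in> edges_of G}"
    by (rule card_subset_eq) (use F ed c in \<open>auto intro: card_ge_0_finite\<close>)
  then show "{G \<in> faces. e \<in> edges_of G} = {F, F'}" by simp
qed

lemma diamond_corners:
  assumes d: "diamond e F F' u v w w' eu ev eu' ev'"
  shows "(e, x) \<in> corners \<longleftrightarrow> x \<in> {eu, ev, eu', ev'}"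
proof -
  note f = diamond_facts[OF d]
  have ne: "eu \<noteq> e" "e \<noteq> ev" "eu' \<noteq> e" "e \<noteq> ev'"
    using d by (simp_all add: diamond_def triangle_def)
  have "(e, x) \<in> corners \<longleftrightarrow> x \<noteq> e \<and> (\<exists>G\<in>{G \<in> faces. e \<in> edges_of G}. x \<in> edges_of G)"
    unfolding corners_def by auto
  then show ?thesis unfolding f(1) using ne by (cases "x = e") (simp_all add: f(3,4) disj_ac eq_commute[of e])
qed

text \<open>The third edge must lie in the other face and avoid \<open>u\<close>, the vertex common
  to \<open>eu\<close> and \<open>e\<close>; only \<open>ev'\<close> does.\<close>

lemma diamond_zigzag_step:
  assumes d: "diamond e F F' u v w w' eu ev eu' ev'"
  shows "zigzag_step eu e x \<longleftrightarrow> x = ev'"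
proof -
  note f = diamond_facts[OF d]
  have t: "eu \<noteq> e" "e \<noteq> ev'" "eu \<inter> V = {w, u}" "ev' \<inter> V = {v, w'}" "eu' \<inter> V = {w', u}"
    "u \<noteq> v" "v \<noteq> w" "w' \<noteq> u"
    using d by (simp_all add: diamond_def triangle_def)
  show ?thesis
  proof
    assume z: "zigzag_step eu e x"
    then obtain G G' where G: "G \<in> faces" "G' \<in> faces" "G \<noteq> G'" "eu \<in> edges_of G" "e \<in> edges_of G"
      "e \<in> edges_of G'" "x \<in> edges_of G'" and x: "e \<noteq> x" "eu \<inter> x \<inter> V = {}"
      unfolding zigzag_step_def by auto
    have "G \<in> {F, F'}" "G' \<in> {F, F'}" using G f(1) by blast+
    then have "G' = F'" using G(3,4) f(5) by (metis insertE singletonD)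
    then have "x \<in> {e, ev', eu'}" using G(7) f(4) by simp
    then have "x = ev' \<or> x = eu'" using x(1) by auto
    moreover have "x \<noteq> eu'"
    proof
      assume "x = eu'"
      then have "(eu \<inter> V) \<inter> (eu' \<inter> V) = {}" using x(2) by blast
      then show False unfolding t(3,5) by simp
    qed
    ultimately show "x = ev'" by blast
  next
    assume x: "x = ev'"
    have "eu \<inter> ev' \<inter> V = (eu \<inter> V) \<inter> (ev' \<inter> V)" by blast
    also have "\<dots> = {}" unfolding t(3,4) using t f(2) by auto
    finally have i: "eu \<inter> ev' \<inter> V = {}" .
    have m: "{eu, e} \<subseteq> edges_of F" "{e, ev'} \<subseteq> edges_of F'" by (simp_all add: f(3,4))
    show "zigzag_step eu e x" unfolding zigzag_step_def x using f(7-9) i m t(1,2) by blast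
  qed
qed

lemma corner_zigzag_step: "(e1, e2) \<in> corners \<Longrightarrow> \<exists>!x. zigzag_step e1 e2 x"
proof -
  assume "(e1, e2) \<in> corners"
  then obtain F where F: "F \<in> faces" "e1 \<in> edges_of F" "e2 \<in> edges_of F" "e2 \<noteq> e1"
    unfolding corners_def by blast
  obtain e3 a b c where "triangle F e2 e1 e3 a b c" using triangle_first_two[OF F(1,3,2,4)] .
  then obtain F' w' eu' ev' where "diamond e2 F F' b c a w' e3 e1 eu' ev'" by (rule diamond_ex)
  then have "zigzag_step e1 e2 x \<longleftrightarrow> x = eu'" for x by (rule diamond_zigzag_step[OF diamond_flip])
  then show ?thesis by simp
qed

text \<open>Zigzags become the cycles of a permutation of the finite set
  \<open>corners\<close>.\<close>

definition T :: "'a set \<times> 'a set \<Rightarrow> 'a set \<times> 'a set" where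
  "T p = (snd p, THE x. zigzag_step (fst p) (snd p) x)"

lemma T_eq: "zigzag_step e1 e2 e3 \<Longrightarrow> T (e1, e2) = (e2, e3)"
  unfolding T_def using corner_zigzag_step[of e1 e2] zigzag_step_corners[of e1 e2 e3] by (simp add: the1_equality)

lemma T_zigzag_step: assumes "p \<in> corners" shows "zigzag_step (fst p) (snd p) (snd (T p))" "fst (T p) = snd p"
proof -
  have "\<exists>!x. zigzag_step (fst p) (snd p) x" using corner_zigzag_step[of "fst p" "snd p"] assms by simp
  then show "zigzag_step (fst p) (snd p) (snd (T p))" unfolding T_def by (simp add: theI')
qed (simp add: T_def)

lemma T_corners: "p \<in> corners \<Longrightarrow> T p \<in> corners"
  using T_zigzag_step[of p] zigzag_step_corners[of "fst p" "snd p" "snd (T p)"] by (metis prod.collapse)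

lemma finite_corners: "finite corners"
proof (rule finite_subset)
  show "corners \<subseteq> E \<times> E" by (auto simp: corners_def face_edges_def)
qed (use finite_E in simp)

text \<open>By symmetry of \<open>zigzag_step\<close>, reversal conjugates \<open>T\<close> to its
  inverse. Injectivity of \<open>T\<close> follows from this, as does the description of reversed
  zigzags.\<close>

lemma T_swap: assumes "p \<in> corners" shows "T (prod.swap (T p)) = prod.swap p"
proof -
  have "zigzag_step (snd (T p)) (snd p) (fst p)" using T_zigzag_step(1)[OF assms] zigzag_step_sym by blast
  then show ?thesis using T_eq T_zigzag_step(2)[OF assms] by (simp add: prod.swap_def)
qed

lemma bij_T: "bij_betw T corners corners"
proof -
  have inj: "inj_on T corners" by (rule inj_onI) (metis T_swap swap_swap)
  moreover have "T ` corners = corners"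
    using endo_inj_surj[OF finite_corners _ inj] T_corners by blast
  ultimately show ?thesis by (simp add: bij_betw_def)
qed

lemma funpow_T: "p \<in> corners \<Longrightarrow> (T ^^ n) p \<in> corners"
  by (induction n) (auto simp: T_corners)

lemma T_swap_funpow: "p \<in> corners \<Longrightarrow> (T ^^ n) (prod.swap ((T ^^ n) p)) = prod.swap p"
proof (induction n arbitrary: p)
  case (Suc n)
  have "(T ^^ Suc n) (prod.swap ((T ^^ Suc n) p)) = (T ^^ n) (T (prod.swap (T ((T ^^ n) p))))"
    by (simp add: funpow_swap1)
  also have "\<dots> = (T ^^ n) (prod.swap ((T ^^ n) p))" by (simp add: T_swap funpow_T Suc.prems)
  finally show ?case using Suc by simp
qed simp

section \<open>Periods, readings and reversal\<close>

definition walk :: "'a set \<times> 'a set \<Rightarrow> nat \<Rightarrow> 'a set" where "walk p i = fst ((T ^^ i) p)"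

lemma funpow_T_walk: "(T ^^ i) p = (walk p i, walk p (Suc i))" if "p \<in> corners"
  using T_zigzag_step(2)[OF funpow_T[OF that]] by (simp add: walk_def prod_eq_iff)

lemma walk_shift: "walk p (i + k) = walk ((T ^^ k) p) i"
  by (simp add: walk_def funpow_add)

lemma zigzag_walk: assumes "p \<in> corners" shows "zigzag_seq M V E (walk p)"
  unfolding zigzag_seq_iff
proof
  fix i
  have "zigzag_step (fst ((T ^^ i) p)) (snd ((T ^^ i) p)) (snd ((T ^^ Suc i) p))"
    using T_zigzag_step(1)[OF funpow_T[OF assms]] by simp
  then show "zigzag_step (walk p i) (walk p (Suc i)) (walk p (Suc (Suc i)))"
    unfolding funpow_T_walk[OF assms] by simp
qed

lemma zigzag_seq_walk:
  assumes "zigzag_seq M V E s"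
  shows "(s 0, s 1) \<in> corners" "s = walk (s 0, s 1)"
proof -
  have z: "zigzag_step (s i) (s (Suc i)) (s (Suc (Suc i)))" for i using assms by (simp add: zigzag_seq_iff)
  show "(s 0, s 1) \<in> corners" using zigzag_step_corners[OF z[of 0]] by simp
  have "(T ^^ i) (s 0, s 1) = (s i, s (Suc i))" for i
    by (induction i) (use T_eq[OF z] in auto)
  then show "s = walk (s 0, s 1)" by (auto simp: walk_def)
qed

definition period :: "'a set \<times> 'a set \<Rightarrow> nat" where "period p = (LEAST n. 0 < n \<and> (T ^^ n) p = p)"

lemma period: assumes "p \<in> corners" shows "0 < period p" "(T ^^ period p) p = p"
proof -
  obtain m where "m > 0" "(T ^^ m) p = p" using funpow_cycle[OF finite_corners bij_T assms] .
  then have "\<exists>n. 0 < n \<and> (T ^^ n) p = p" by blast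
  then have "0 < period p \<and> (T ^^ period p) p = p" unfolding period_def by (rule LeastI_ex)
  then show "0 < period p" "(T ^^ period p) p = p" by auto
qed

lemma less_period: "\<lbrakk>0 < n; n < period p\<rbrakk> \<Longrightarrow> (T ^^ n) p \<noteq> p"
  unfolding period_def using not_less_Least by blast

lemma least_period_walk: assumes "p \<in> corners" shows "least_period (walk p) (period p)"
  unfolding least_period_def
proof (intro conjI allI impI)
  show "0 < period p" by (rule period(1)[OF assms])
  show "walk p (i + period p) = walk p i" for i
    by (simp add: walk_shift period(2)[OF assms])
  fix n assume n: "0 < n \<and> n < period p"
  show "\<exists>i. walk p (i + n) \<noteq> walk p i"
  proof (rule ccontr)
    assume "\<not> ?thesis"
    \<comment> \<open>Agreement at two consecutive places already makes the states equal, so a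
      shorter period of edges would be a shorter period of \<open>T\<close>.\<close>
    then have "walk p (0 + n) = walk p 0" "walk p (1 + n) = walk p 1" by blast+
    then have "(T ^^ n) p = (T ^^ 0) p" using funpow_T_walk[OF assms, of n] funpow_T_walk[OF assms, of 0]
      by simp
    then show False using less_period n by simp
  qed
qed

lemma least_period_unique: "\<lbrakk>least_period s n; least_period s n'\<rbrakk> \<Longrightarrow> n = n'"
  unfolding least_period_def by (meson linorder_neqE_nat)

lemma period_eqI: assumes "\<And>n. (T ^^ n) p = p \<longleftrightarrow> (T ^^ n) q = q" shows "period p = period q"
  unfolding period_def using assms by simp

lemma period_T: assumes p: "p \<in> corners" shows "period (T p) = period p"
proof (rule period_eqI)
  fix n
  have "(T ^^ n) (T p) = T ((T ^^ n) p)" by (simp add: funpow_swap1)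
  then show "(T ^^ n) (T p) = T p \<longleftrightarrow> (T ^^ n) p = p"
    using inj_on_eq_iff[OF bij_betw_imp_inj_on[OF bij_T] funpow_T[OF p] p] by simp
qed

lemma period_funpow_T: "p \<in> corners \<Longrightarrow> period ((T ^^ k) p) = period p"
  by (induction k) (simp_all add: period_T funpow_T)

lemma swap_corners: "p \<in> corners \<Longrightarrow> prod.swap p \<in> corners"
  using corners_sym by (cases p) auto

lemma period_swap: assumes p: "p \<in> corners" shows "period (prod.swap p) = period p"
proof (rule period_eqI)
  fix n
  have "(T ^^ n) (prod.swap q) = prod.swap q" if "q \<in> corners" "(T ^^ n) q = q" for q
    using T_swap_funpow[OF that(1), of n] that(2) by simp
  from this[OF p] this[OF swap_corners[OF p]]
  show "(T ^^ n) (prod.swap p) = prod.swap p \<longleftrightarrow> (T ^^ n) p = p" by auto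
qed

text \<open>This guarantees that a reading has a second entry, as the computation of directions
  requires.\<close>

lemma period_gt_1: assumes p: "p \<in> corners" shows "1 < period p"
proof (rule ccontr)
  assume "\<not> 1 < period p"
  then have "period p = 1" using period(1)[OF p] by simp
  then have "T p = p" using period(2)[OF p] by simp
  then have "fst p = snd p" using T_zigzag_step(2)[OF p] by simp
  moreover have "fst p \<noteq> snd p" using p by (auto simp: corners_def)
  ultimately show False by simp
qed

definition reading :: "'a set \<times> 'a set \<Rightarrow> 'a set list" where "reading p = map (walk p) [0..<period p]"

definition zigzag_of :: "'a set \<times> 'a set \<Rightarrow> 'a set list set" where
  "zigzag_of p = {reading ((T ^^ k) p) |k. True}"

lemma cyclic_seq_walk: assumes p: "p \<in> corners" shows "cyclic_seq (walk p) (period p) = zigzag_of p"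
proof -
  have "map (walk p) [k..<k + period p] = reading ((T ^^ k) p)" for k
    by (rule nth_equalityI)
      (auto simp: reading_def period_funpow_T[OF p] walk_shift[symmetric] add.commute)
  then show ?thesis unfolding cyclic_seq_def zigzag_of_def by simp
qed

lemma zigzags_eq: "zigzags M V E = zigzag_of ` corners"
proof (intro equalityI subsetI)
  fix Z assume "Z \<in> zigzags M V E"
  then obtain s n where s: "Z = cyclic_seq s n" "zigzag_seq M V E s" "least_period s n"
    unfolding zigzags_def by blast
  define p where "p = (s 0, s 1)"
  have p: "p \<in> corners" "s = walk p" using zigzag_seq_walk[OF s(2)] by (simp_all add: p_def)
  then have "n = period p" using least_period_unique[OF s(3)] least_period_walk[OF p(1)] by simp
  then have "Z = zigzag_of p" using s(1) p(2) cyclic_seq_walk[OF p(1)] by simp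
  then show "Z \<in> zigzag_of ` corners" using p(1) by blast
next
  fix Z assume "Z \<in> zigzag_of ` corners"
  then obtain p where p: "p \<in> corners" "Z = zigzag_of p" by blast
  then have "Z = cyclic_seq (walk p) (period p)" using cyclic_seq_walk by simp
  then show "Z \<in> zigzags M V E"
    unfolding zigzags_def using zigzag_walk[OF p(1)] least_period_walk[OF p(1)] by blast
qed

lemma reading_props:
  assumes p: "p \<in> corners"
  shows "hd (reading p) = fst p" "reading p ! 1 = snd p" "zigzag_step (last (reading p)) (fst p) (snd p)"
proof -
  note n = period_gt_1[OF p]
  have w: "walk p 0 = fst p" "walk p 1 = snd p"
    using T_zigzag_step(2)[OF p] by (simp_all add: walk_def)
  show "hd (reading p) = fst p" using n w(1) by (simp add: reading_def hd_map)
  show "reading p ! 1 = snd p" using n w(2) by (simp add: reading_def)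
  define k where "k = period p - 1"
  have k: "Suc k = period p" using n by (simp add: k_def)
  have "last (reading p) = walk p k" unfolding reading_def k[symmetric] by simp
  moreover have "walk p (Suc k) = fst p" "walk p (Suc (Suc k)) = snd p"
    using walk_shift[of p 0 "period p"] walk_shift[of p 1 "period p"] period(2)[OF p] w by (simp_all add: k)
  moreover have "zigzag_step (walk p k) (walk p (Suc k)) (walk p (Suc (Suc k)))"
    using zigzag_walk[OF p] by (simp add: zigzag_seq_iff)
  ultimately show "zigzag_step (last (reading p)) (fst p) (snd p)" by simp
qed

text \<open>The first two entries recover the pair, so occurrences of an edge can be counted as
  pairs in \<open>corners\<close>.\<close>

lemma inj_reading: "inj_on reading corners"
  by (rule inj_onI) (metis reading_props(1,2) prod_eqI)

lemma reading_in_zigzag: "reading p \<in> zigzag_of p"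
  unfolding zigzag_of_def by (auto intro: exI[of _ 0])

lemma zigzag_of_T: assumes p: "p \<in> corners" shows "zigzag_of (T p) = zigzag_of p"
proof -
  have "\<exists>k'. (T ^^ k) p = (T ^^ Suc k') p" for k
  proof (cases k)
    case 0
    \<comment> \<open>The unshifted reading is recovered after one full turn.\<close>
    have "(T ^^ 0) p = (T ^^ Suc (period p - 1)) p" using period[OF p] by simp
    then show ?thesis using 0 by blast
  qed blast
  note shift = this
  have "zigzag_of p \<subseteq> {reading ((T ^^ Suc k) p) |k. True}"
  proof
    fix w assume "w \<in> zigzag_of p"
    then obtain k where "w = reading ((T ^^ k) p)" unfolding zigzag_of_def by blast
    moreover obtain k' where "(T ^^ k) p = (T ^^ Suc k') p" using shift[of k] ..
    ultimately have "w = reading ((T ^^ Suc k') p)" by simp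
    then show "w \<in> {reading ((T ^^ Suc k) p) |k. True}" by blast
  qed
  moreover have "{reading ((T ^^ Suc k) p) |k. True} \<subseteq> zigzag_of p" unfolding zigzag_of_def by blast
  moreover have "zigzag_of (T p) = {reading ((T ^^ Suc k) p) |k. True}"
    unfolding zigzag_of_def by (simp only: funpow_Suc_right o_apply)
  ultimately show ?thesis by blast
qed

lemma zigzag_of_funpow: "p \<in> corners \<Longrightarrow> zigzag_of ((T ^^ k) p) = zigzag_of p"
  by (induction k) (simp_all add: zigzag_of_T funpow_T)

text \<open>The reversed list starts with the entries at positions \<open>period q - 1\<close> and
  \<open>period q - 2\<close>, which is the state after \<open>period q - 2\<close> steps,
  swapped.\<close>

lemma rev_reading:
  assumes q: "q \<in> corners"
  shows "rev (reading q) = reading (prod.swap ((T ^^ (period q - 2)) q))"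
proof (rule nth_equalityI)
  let ?n = "period q" let ?r = "prod.swap ((T ^^ (?n - 2)) q)"
  note n = period_gt_1[OF q]
  have period_r: "period ?r = ?n" by (simp add: period_swap funpow_T q period_funpow_T)
  then show "length (rev (reading q)) = length (reading ?r)" by (simp add: reading_def)
  fix i assume "i < length (rev (reading q))"
  then have i: "i < ?n" by (simp add: reading_def)
  have r: "(T ^^ j) ?r = prod.swap ((T ^^ (?n - 2 - j)) q)" if "j \<le> ?n - 2" for j
  proof -
    have "?n - 2 = j + (?n - 2 - j)" using that by linarith
    then have "(T ^^ (?n - 2)) q = (T ^^ (j + (?n - 2 - j))) q" by (rule arg_cong)
    also have "\<dots> = (T ^^ j) ((T ^^ (?n - 2 - j)) q)" by (simp only: funpow_add o_apply)
    finally show ?thesis using T_swap_funpow[OF funpow_T[OF q], of j "?n - 2 - j"] by simp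
  qed
  have "walk ?r i = walk q (?n - 1 - i)"
  proof (cases "i \<le> ?n - 2")
    case True
    have "walk ?r i = snd ((T ^^ (?n - 2 - i)) q)" using r[OF True] by (simp add: walk_def)
    also have "\<dots> = walk q (Suc (?n - 2 - i))" by (simp add: funpow_T_walk[OF q])
    also have "Suc (?n - 2 - i) = ?n - 1 - i" using True n by simp
    finally show ?thesis .
  next
    case False
    \<comment> \<open>The last entry lies one step beyond \<open>prod.swap q\<close>, where the
      formula \<open>r\<close> ends, so \<open>T\<close> is applied once more.\<close>
    then have iS: "i = Suc (?n - 2)" using i by simp
    have "(T ^^ i) ?r = T (prod.swap q)" using r[of "?n - 2"] unfolding iS by simp
    then have "walk ?r i = fst q" using T_zigzag_step(2)[OF swap_corners[OF q]] by (simp add: walk_def)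
    then show ?thesis using i iS by (simp add: walk_def)
  qed
  then show "rev (reading q) ! i = reading ?r ! i"
    using i period_r by (simp add: reading_def rev_nth Suc_diff_Suc)
qed

lemma rev_zigzag_of: assumes p: "p \<in> corners" shows "rev ` zigzag_of p = zigzag_of (prod.swap p)"
proof -
  have sub: "rev ` zigzag_of q \<subseteq> zigzag_of (prod.swap q)" if q: "q \<in> corners" for q
  proof
    fix w assume "w \<in> rev ` zigzag_of q"
    then obtain k where "w = rev (reading ((T ^^ k) q))" unfolding zigzag_of_def by blast
    moreover define l where "l = period ((T ^^ k) q) - 2 + k"
    ultimately have w: "w = reading (prod.swap ((T ^^ l) q))"
      using rev_reading[OF funpow_T[OF q], of k] by (simp add: funpow_add)
    have c: "prod.swap ((T ^^ l) q) \<in> corners" by (rule swap_corners[OF funpow_T[OF q]])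
    have "zigzag_of (prod.swap ((T ^^ l) q)) = zigzag_of ((T ^^ l) (prod.swap ((T ^^ l) q)))"
      by (rule zigzag_of_funpow[OF c, symmetric])
    also have "\<dots> = zigzag_of (prod.swap q)" by (simp add: T_swap_funpow[OF q])
    finally show "w \<in> zigzag_of (prod.swap q)" using w reading_in_zigzag by metis
  qed
  have "rev ` zigzag_of (prod.swap p) \<subseteq> zigzag_of p" using sub[OF swap_corners[OF p]] by simp
  then have "rev ` rev ` zigzag_of (prod.swap p) \<subseteq> rev ` zigzag_of p" by (rule image_mono)
  then have "zigzag_of (prod.swap p) \<subseteq> rev ` zigzag_of p" by (simp add: image_image)
  then show ?thesis using sub[OF p] by blast
qed

section \<open>Directions of traversal\<close>

lemma common_vertex_triangle:
  assumes "triangle F e1 e2 e3 a b c" shows "common_vertex V e1 e2 = c"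
proof -
  have t: "e1 \<inter> V = {b, c}" "e2 \<inter> V = {c, a}" "a \<noteq> b" using assms by (simp_all add: triangle_def)
  have "v \<in> V \<and> v \<in> e1 \<and> v \<in> e2 \<longleftrightarrow> v \<in> (e1 \<inter> V) \<inter> (e2 \<inter> V)" for v by auto
  then have "v \<in> V \<and> v \<in> e1 \<and> v \<in> e2 \<longleftrightarrow> v = c" for v unfolding t using t(3) by auto
  then show ?thesis unfolding common_vertex_def by simp
qed

text \<open>A zigzag that goes on to \<open>eu\<close> leaves \<open>e\<close> at \<open>u\<close>,
  and it must have come from \<open>ev'\<close>, which meets \<open>e\<close> at \<open>v\<close>.
  The outgoing edge alone therefore determines the direction on \<open>e\<close>.\<close>

lemma diamond_direction:
  assumes d: "diamond e F F' u v w w' eu ev eu' ev'"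
  shows "direction V (reading (e, eu)) = (v, u)" "(e, eu) \<in> corners"
    "T (ev', e) = (e, eu)" "(ev', e) \<in> corners"
proof -
  have t: "triangle F e ev eu w u v" "triangle F' e ev' eu' w' u v" using d by (simp_all add: diamond_def)
  show c: "(e, eu) \<in> corners" using diamond_corners[OF d] by simp
  have z: "zigzag_step x e eu \<longleftrightarrow> x = ev'" for x using diamond_zigzag_step[OF d] zigzag_step_sym by metis
  have "last (reading (e, eu)) = ev'" using reading_props(3)[OF c] z by simp
  moreover have "common_vertex V ev' e = v"
    by (rule common_vertex_triangle[OF triangle_swap[OF t(2)]])
  moreover have "common_vertex V e eu = u"
    by (rule common_vertex_triangle[OF triangle_flip[OF t(1)]])
  ultimately show "direction V (reading (e, eu)) = (v, u)"
    using reading_props(1,2)[OF c] by (simp add: direction_def)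
  have zigzag_step: "zigzag_step ev' e eu" using z by simp
  then show "T (ev', e) = (e, eu)" by (rule T_eq)
  show "(ev', e) \<in> corners" using zigzag_step_corners[OF zigzag_step] by simp
qed

end

section \<open>Zigzags and the flow\<close>

lemma (in triangulated_surface) zigzag_stepI:
  assumes "F \<in> faces" "F' \<in> faces" "F \<noteq> F'" "e1 \<in> edges_of F" "e2 \<in> edges_of F"
    "e2 \<in> edges_of F'" "e3 \<in> edges_of F'" "e1 \<noteq> e2" "e2 \<noteq> e3" "(e1 \<inter> V) \<inter> (e3 \<inter> V) = {}"
  shows "zigzag_step e1 e2 e3"
proof -
  have "e1 \<inter> e3 \<inter> V = {}" using assms(10) by blast
  moreover have "{e1, e2} \<subseteq> edges_of F" "{e2, e3} \<subseteq> edges_of F'" using assms(4-7) by simp_all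
  ultimately show ?thesis unfolding zigzag_step_def using assms(1-3,8,9) by blast
qed

lemma (in triangulated_surface) walk_edge: "p \<in> corners \<Longrightarrow> walk p i \<in> E"
  using funpow_T[of p i] unfolding walk_def corners_def face_edges_def by auto

section \<open>Steps of zigzags through consecutive faces\<close>

context flow_triangulation
begin

lemma in_edges_of: "F \<in> faces \<Longrightarrow> A F \<in> edges_of F" "F \<in> faces \<Longrightarrow> B F \<in> edges_of F"
    "F \<in> faces \<Longrightarrow> C F \<in> edges_of F"
  by (simp_all add: flow_edges(1))

lemma B_next_face_ends:
  assumes "F \<in> faces" shows "{src (A (next_face F)), apex (next_face F)} = {apex F, tgt (A F)}"
  using flow_ends(2)[OF next_face(1)[OF assms]] flow_ends(3)[OF assms] unfolding next_face(2)[OF assms] by simp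

text \<open>The exit edge joins apex and target, so the next face either continues to turn around
  the same apex or exchanges the roles of these two vertices.\<close>

lemma src_next_face:
  assumes "F \<in> faces"
  shows "apex (next_face F) = apex F \<and> src (A (next_face F)) = tgt (A F) \<or>
    apex (next_face F) = tgt (A F) \<and> src (A (next_face F)) = apex F"
  using B_next_face_ends[OF assms] by (auto simp: doubleton_eq_iff)

text \<open>Adjacent faces share no second edge, and edges are determined by their ends. This is
  what keeps the vertices opposite to \<open>C F\<close> in the two faces distinct.\<close>

lemma no_common_other_edge:
  assumes "F \<in> faces" "e \<in> edges_of F" "e \<noteq> C F" "e' \<in> edges_of (next_face F)" shows "e \<inter> V \<noteq> e' \<inter> V"
proof
  assume "e \<inter> V = e' \<inter> V"
  then have "e = e'" using edge_eqI assms(2,4) by (simp add: face_edges_def)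
  then have "e = C F"
    using common_edges_eq[of F "next_face F" e "C F"] assms next_face next_face_ne[OF assms(1)] in_edges_of by metis
  then show False using assms(3) by simp
qed

lemma tgt_next_face_ne:
  assumes F: "F \<in> faces" and a: "apex (next_face F) = apex F"
  shows "tgt (A (next_face F)) \<noteq> src (A F)"
proof
  assume "tgt (A (next_face F)) = src (A F)"
  then have "C (next_face F) \<inter> V = B F \<inter> V"
    using flow_ends(2)[OF F] flow_ends(3)[OF next_face(1)[OF F]] a by (simp add: insert_commute)
  then show False
    using no_common_other_edge[OF F in_edges_of(2)[OF F] flow_edges(6)[OF F] in_edges_of(3)[OF next_face(1)[OF F]]]
    by simp
qed

text \<open>With a constant apex, the edge after \<open>A F\<close> and \<open>C F\<close> is a
  spoke again, so two edges of type I follow one of type II.\<close>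

lemma zigzag_step_A_C_C:
  assumes F: "F \<in> faces" and a: "apex (next_face F) = apex F" shows "zigzag_step (A F) (C F) (C (next_face F))"
proof (rule zigzag_stepI[OF F next_face(1)[OF F]])
  note G = next_face(1)[OF F]
  have s: "src (A (next_face F)) = tgt (A F)" using src_next_face[OF F] a flow_ends(7)[OF F] by auto
  show "F \<noteq> next_face F" using next_face_ne[OF F] by simp
  show "A F \<in> edges_of F" "C F \<in> edges_of F" "C (next_face F) \<in> edges_of (next_face F)" "C F \<in> edges_of (next_face F)"
    using in_edges_of F G next_face(2)[OF F] by metis+
  show "A F \<noteq> C F" by (rule flow_edges(7)[OF F])
  show "C F \<noteq> C (next_face F)" using flow_edges(6)[OF G] next_face(2)[OF F] by simp
  show "A F \<inter> V \<inter> (C (next_face F) \<inter> V) = {}"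
    unfolding flow_ends(1)[OF F] flow_ends(3)[OF G] a
    using flow_ends(5-7)[OF F] flow_ends(5)[OF G] s tgt_next_face_ne[OF F a] by auto
qed

lemma zigzag_step_B_C_A:
  assumes F: "F \<in> faces" and a: "apex (next_face F) = apex F" shows "zigzag_step (B F) (C F) (A (next_face F))"
proof (rule zigzag_stepI[OF F next_face(1)[OF F]])
  note G = next_face(1)[OF F]
  have s: "src (A (next_face F)) = tgt (A F)" using src_next_face[OF F] a flow_ends(7)[OF F] by auto
  show "F \<noteq> next_face F" using next_face_ne[OF F] by simp
  show "B F \<in> edges_of F" "C F \<in> edges_of F" "A (next_face F) \<in> edges_of (next_face F)" "C F \<in> edges_of (next_face F)"
    using in_edges_of F G next_face(2)[OF F] by metis+
  show "B F \<noteq> C F" by (rule flow_edges(6)[OF F])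
  show "C F \<noteq> A (next_face F)" using A_ne(2)[OF G F] by simp
  show "B F \<inter> V \<inter> (A (next_face F) \<inter> V) = {}"
    unfolding flow_ends(2)[OF F] flow_ends(1)[OF G]
    using flow_ends(5-7)[OF F] flow_ends(5-7)[OF G] s a tgt_next_face_ne[OF F a] by auto
qed

text \<open>A change of apex leaves a single edge of type I between two edges of type II, which no
  homogeneous zigzag permits.\<close>

lemma zigzag_step_A_C_A:
  assumes F: "F \<in> faces" and a: "apex (next_face F) \<noteq> apex F" shows "zigzag_step (A F) (C F) (A (next_face F))"
proof (rule zigzag_stepI[OF F next_face(1)[OF F]])
  note G = next_face(1)[OF F]
  have s: "apex (next_face F) = tgt (A F)" "src (A (next_face F)) = apex F" using src_next_face[OF F] a by auto
  show "F \<noteq> next_face F" using next_face_ne[OF F] by simp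
  show "A F \<in> edges_of F" "C F \<in> edges_of F" "A (next_face F) \<in> edges_of (next_face F)" "C F \<in> edges_of (next_face F)"
    using in_edges_of F G next_face(2)[OF F] by metis+
  show "A F \<noteq> C F" by (rule flow_edges(7)[OF F])
  show "C F \<noteq> A (next_face F)" using A_ne(2)[OF G F] by simp
  have "tgt (A (next_face F)) \<noteq> src (A F)"
  proof
    assume "tgt (A (next_face F)) = src (A F)"
    then have "B F \<inter> V = A (next_face F) \<inter> V"
      using flow_ends(2)[OF F] flow_ends(1)[OF G] s by (simp add: insert_commute)
    then show False
      using no_common_other_edge[OF F in_edges_of(2)[OF F] flow_edges(6)[OF F] in_edges_of(1)[OF G]]
      by simp
  qed
  then show "A F \<inter> V \<inter> (A (next_face F) \<inter> V) = {}"
    unfolding flow_ends(1)[OF F] flow_ends(1)[OF G]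
    using flow_ends(5-7)[OF F] flow_ends(5-7)[OF G] s by auto
qed

text \<open>Both faces use the same source and target of their common edge, so \<open>B F\<close>
  and \<open>C F'\<close> leave it at opposite ends. Equal apexes would make \<open>C F\<close> and
  \<open>C F'\<close> equal, against \<open>inj_C\<close>.\<close>

lemma zigzag_step_B_A_C:
  assumes F: "F \<in> faces" "F' \<in> faces" "F \<noteq> F'" and a: "A F' = A F" shows "zigzag_step (B F) (A F) (C F')"
proof (rule zigzag_stepI[OF F])
  show "B F \<in> edges_of F" "A F \<in> edges_of F" "A F \<in> edges_of F'" "C F' \<in> edges_of F'"
    using in_edges_of F a by metis+
  show "B F \<noteq> A F" using flow_edges(5)[OF F(1)] by simp
  show "A F \<noteq> C F'" by (rule A_ne(2)[OF F(1,2)])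
  have "apex F' \<noteq> apex F"
  proof
    assume "apex F' = apex F"
    then have "C F \<inter> V = C F' \<inter> V" using flow_ends(3) F a by simp
    then have "C F = C F'" using edge_eqI flow_edges(4) F(1,2) by blast
    then show False using inj_onD[OF inj_C] F by blast
  qed
  then show "B F \<inter> V \<inter> (C F' \<inter> V) = {}"
    unfolding flow_ends(2)[OF F(1)] flow_ends(3)[OF F(2)]
    using flow_ends(5-7)[OF F(1)] flow_ends(5-7)[OF F(2)] a by auto
qed

text \<open>The faces with a given apex are closed under crossing edges at that vertex and hence
  form its whole star. An edge of type II at the vertex would be the edge \<open>A G\<close> of such
  a face, which is opposite to the apex.\<close>

lemma apex_inner_if_constant:
  assumes const: "\<And>F. F \<in> faces \<Longrightarrow> apex (next_face F) = apex F" and F: "F \<in> faces"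
  shows "apex F \<notin> V2"
proof
  assume "apex F \<in> V2"
  then obtain G where G: "G \<in> faces" "apex F \<in> A G" by (auto simp: V2_def)
  have "{G \<in> faces. apex G = apex F} = {G \<in> faces. apex F \<in> closure G}"
  proof (rule faces_at_vertex_connected)
    show "apex F \<in> V" using apex_in[OF F] by simp
    show "{G \<in> faces. apex G = apex F} \<noteq> {}" using F by blast
    show "{G \<in> faces. apex G = apex F} \<subseteq> {G \<in> faces. apex F \<in> closure G}"
    proof
      fix H assume "H \<in> {G \<in> faces. apex G = apex F}"
      then show "H \<in> {G \<in> faces. apex F \<in> closure G}" using apex_in[of H] by simp
    qed
    fix H H' e
    assume "H \<in> {G \<in> faces. apex G = apex F}" and H': "H' \<in> faces" and e: "e \<in> edges_of H" "e \<in> edges_of H'"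
      and ze: "apex F \<in> e"
    then have H: "H \<in> faces" "apex H = apex F" by auto
    have "apex H \<notin> A H"
    proof
      assume "apex H \<in> A H"
      then have "apex H \<in> A H \<inter> V" using apex_in[OF H(1)] by simp
      then show False unfolding flow_ends(1)[OF H(1)] using flow_ends(6,7)[OF H(1)] by simp
    qed
    then have "e \<noteq> A H" using ze H(2) by auto
    then have "e = B H \<or> e = C H" using e(1) flow_edges(1)[OF H(1)] by auto
    moreover have "e = A H' \<or> e = B H' \<or> e = C H'" using e(2) flow_edges(1)[OF H'] by auto
    ultimately consider "B H = B H'" | "C H = C H'" | "B H' = C H" | "B H = C H'"
      using A_ne[OF H' H(1)] by metis
    then have "apex H' = apex H"
    proof cases
      case 1 then show ?thesis using inj_onD[OF inj_B] H(1) H' by metis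
    next
      case 2 then show ?thesis using inj_onD[OF inj_C] H(1) H' by metis
    next
      case 3 then show ?thesis using B_eq_C_iff[OF H(1) H'] const[OF H(1)] by simp
    next
      case 4 then show ?thesis using B_eq_C_iff[OF H' H(1)] const[OF H'] by simp
    qed
    then show "H' \<in> {G \<in> faces. apex G = apex F}" using H H' by simp
  qed
  moreover have "apex F \<in> closure G" using G edges_closure[OF G(1) in_edges_of(1)[OF G(1)]] by blast
  ultimately have "apex G = apex F" using G(1) by blast
  then have "apex G \<in> A G \<inter> V" using G apex_in[OF F] by simp
  then show False unfolding flow_ends(1)[OF G(1)] using flow_ends(6,7)[OF G(1)] by simp
qed

lemma flow_corners:
  assumes "F \<in> faces" shows "(A F, C F) \<in> corners" "(B F, C F) \<in> corners" "(B F, A F) \<in> corners"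
  using assms in_edges_of[OF assms] flow_edges(5-7)[OF assms] unfolding corners_def by auto

end

section \<open>The pattern of period three\<close>

context disk_flow
begin

lemma T_A_C: "F \<in> faces \<Longrightarrow> T (A F, C F) = (B (next_face F), C (next_face F))"
  using T_eq[OF zigzag_step_A_C_C] apex_next_face apex_inner next_face(2) by simp

lemma T_B_C: "F \<in> faces \<Longrightarrow> T (B F, C F) = (B (next_face F), A (next_face F))"
  using T_eq[OF zigzag_step_B_C_A] apex_next_face apex_inner next_face(2) by simp

lemma T_B_A: assumes F: "F \<in> faces" obtains F' where "F' \<in> faces" "T (B F, A F) = (A F', C F')"
proof -
  obtain F' where F': "F' \<in> faces" "F' \<noteq> F" "A F \<in> edges_of F'"
    using other_face[OF F in_edges_of(1)[OF F]] by metis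
  then have "A F = A F'" using flow_edges(1)[OF F'(1)] A_ne[OF F F'(1)] by auto
  then have "T (B F, A F) = (A F', C F')"
    using T_eq[OF zigzag_step_B_A_C[OF F F'(1)]] F'(2) by auto
  then show ?thesis using that F'(1) by blast
qed

text \<open>At these pairs a zigzag is about to run through the types II, I, I; three steps lead
  back into the set.\<close>

definition starts :: "('a set \<times> 'a set) set" where "starts = {(A F, C F) |F. F \<in> faces}"

lemma T_starts:
  assumes "p \<in> starts"
  obtains F where "F \<in> faces" "fst p \<in> A ` faces" "T p = (B F, C F)" "T (T p) = (B (next_face F), A (next_face F))"
    "T (T (T p)) \<in> starts"
proof -
  obtain F where F: "F \<in> faces" "p = (A F, C F)" using assms by (auto simp: starts_def)
  note G = next_face(1)[OF F(1)]
  obtain F' where F': "F' \<in> faces" "T (B (next_face (next_face F)), A (next_face (next_face F))) = (A F', C F')"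
    using T_B_A[OF next_face(1)[OF G]] .
  show ?thesis
    \<comment> \<open>The face in the conclusion is the one after the face of \<open>p\<close>,
      because \<open>T\<close> has already crossed \<open>C F\<close>.\<close>
    by (rule that[of "next_face F"])
      (use F G F' in \<open>auto simp: T_A_C T_B_C starts_def\<close>)
qed

lemma starts_corners: "starts \<subseteq> corners"
  using flow_corners(1) by (auto simp: starts_def)

lemma walk_type:
  assumes p: "p \<in> starts" shows "walk p n \<in> A ` faces \<longleftrightarrow> 3 dvd n"
proof -
  have st: "(T ^^ (3 * k)) p \<in> starts" for k
  proof (induction k)
    case (Suc k)
    have "(T ^^ (3 * Suc k)) p = T (T (T ((T ^^ (3 * k)) p)))" by (simp add: numeral_3_eq_3)
    then show ?case using T_starts[OF Suc] by metis
  qed (use p in simp)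
  define q where "q = (T ^^ (3 * (n div 3))) p"
  have q: "q \<in> starts" unfolding q_def by (rule st)
  have w: "walk p n = walk q (n mod 3)"
    using walk_shift[of p "n mod 3" "3 * (n div 3)"] by (simp add: q_def)
  obtain F where F: "F \<in> faces" "fst q \<in> A ` faces" "T q = (B F, C F)"
    "T (T q) = (B (next_face F), A (next_face F))" using T_starts[OF q] by metis
  have B: "B G \<notin> A ` faces" if "G \<in> faces" for G using A_ne(1)[OF _ that] by force
  have "walk q 0 \<in> A ` faces" "walk q 1 \<notin> A ` faces" "walk q 2 \<notin> A ` faces"
    using F B next_face(1)[OF F(1)] by (simp_all add: walk_def numeral_2_eq_2)
  moreover have "n mod 3 = 0 \<or> n mod 3 = 1 \<or> n mod 3 = 2" by presburger
  ultimately show ?thesis unfolding w dvd_eq_mod_eq_0 by auto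
qed

text \<open>After one period the walk is back at its initial edge of type II, and such edges occur
  only at multiples of 3.\<close>

lemma period_starts: assumes p: "p \<in> starts" shows "3 dvd period p"
proof -
  have "p \<in> corners" using p starts_corners by blast
  then have "walk p (period p) = walk p 0" using walk_shift[of p 0 "period p"] period(2) by simp
  then show ?thesis using walk_type[OF p] by (metis dvd_0_right)
qed

text \<open>Up to reversal a face has three pairs of edges: one is in \<open>starts\<close>,
  \<open>(B F, A F)\<close> reaches \<open>starts\<close> in one step and \<open>(B F, C F)\<close>
  in two.\<close>

lemma corner_zigzag:
  assumes "c \<in> corners"
  obtains p where "p \<in> starts" "zigzag_of c = zigzag_of p \<or> zigzag_of c = rev ` zigzag_of p"
proof -
  have main: "\<exists>p\<in>starts. zigzag_of c = zigzag_of p"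
    if F: "F \<in> faces" and c: "c \<in> {(A F, C F), (B F, C F), (B F, A F)}" for F c
  proof -
    have BA: "\<exists>p\<in>starts. zigzag_of (B G, A G) = zigzag_of p" if G: "G \<in> faces" for G
    proof -
      obtain F' where "F' \<in> faces" "T (B G, A G) = (A F', C F')" using T_B_A[OF G] .
      then show ?thesis using zigzag_of_T[OF flow_corners(3)[OF G]] by (auto simp: starts_def)
    qed
    have eq: "zigzag_of (B F, C F) = zigzag_of (B (next_face F), A (next_face F))"
      using zigzag_of_T[OF flow_corners(2)[OF F]] T_B_C[OF F] by simp
    from c consider "c = (A F, C F)" | "c = (B F, C F)" | "c = (B F, A F)" by blast
    then show ?thesis
    proof cases
      case 1 then have "c \<in> starts" using F by (auto simp: starts_def)
      then show ?thesis by blast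
    next
      case 2 show ?thesis unfolding 2 eq by (rule BA[OF next_face(1)[OF F]])
    next
      case 3 show ?thesis unfolding 3 by (rule BA[OF F])
    qed
  qed
  obtain F where F: "F \<in> faces" "fst c \<in> edges_of F" "snd c \<in> edges_of F" "fst c \<noteq> snd c"
  proof -
    have "(fst c, snd c) \<in> corners" using assms by simp
    then show ?thesis using that unfolding corners_def by blast
  qed
  have "fst c \<in> {A F, B F, C F}" "snd c \<in> {A F, B F, C F}"
    using F(2,3) unfolding flow_edges(1)[OF F(1)] .
  then have "c \<in> {(A F, C F), (B F, C F), (B F, A F)} \<or>
      prod.swap c \<in> {(A F, C F), (B F, C F), (B F, A F)}"
    using F(4) by (cases c) auto
  then show ?thesis
  proof
    assume "c \<in> {(A F, C F), (B F, C F), (B F, A F)}"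
    then show ?thesis using main[OF F(1)] that by blast
  next
    assume "prod.swap c \<in> {(A F, C F), (B F, C F), (B F, A F)}"
    then obtain p where "p \<in> starts" "zigzag_of (prod.swap c) = zigzag_of p" using main[OF F(1)] by blast
    moreover have "zigzag_of c = rev ` zigzag_of (prod.swap c)"
      using rev_zigzag_of[OF swap_corners[OF assms]] by simp
    ultimately show ?thesis using that by simp
  qed
qed

end

section \<open>Edge types in terms of chosen pairs\<close>

locale z_oriented = triangulated_surface +
  fixes \<tau> :: "'a set list set set"
  assumes z_orientation: "z_orientation M V E \<tau>"
begin

text \<open>The pairs of edges that are consecutive in the direction chosen by the orientation.\<close>

definition Q :: "('a set \<times> 'a set) set" where "Q = {p \<in> corners. zigzag_of p \<in> \<tau>}"

lemma Q_swap: "p \<in> corners \<Longrightarrow> prod.swap p \<in> Q \<longleftrightarrow> p \<notin> Q"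
  using z_orientation rev_zigzag_of[of p] swap_corners[of p] zigzags_eq
  unfolding z_orientation_def Q_def by auto

lemma Q_T: "p \<in> corners \<Longrightarrow> T p \<in> Q \<longleftrightarrow> p \<in> Q"
  using zigzag_of_T[of p] T_corners[of p] by (simp add: Q_def)

lemma occurrences_eq: "occurrences \<tau> e = reading ` {p \<in> Q. fst p = e}"
proof (intro equalityI subsetI)
  fix w assume "w \<in> occurrences \<tau> e"
  then obtain Z where Z: "Z \<in> \<tau>" "w \<in> Z" "hd w = e" by (auto simp: occurrences_def)
  have "Z \<in> zigzags M V E" using Z(1) z_orientation unfolding z_orientation_def by blast
  then obtain p where p: "p \<in> corners" "Z = zigzag_of p" unfolding zigzags_eq by blast
  then obtain k where k: "w = reading ((T ^^ k) p)" using Z(2) unfolding zigzag_of_def by blast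
  let ?q = "(T ^^ k) p"
  have q: "?q \<in> corners" by (rule funpow_T[OF p(1)])
  have "?q \<in> Q" using q Z(1) p zigzag_of_funpow[OF p(1)] by (simp add: Q_def)
  moreover have "fst ?q = e" using reading_props(1)[OF q] k Z(3) by simp
  ultimately show "w \<in> reading ` {p \<in> Q. fst p = e}" using k by blast
next
  fix w assume "w \<in> reading ` {p \<in> Q. fst p = e}"
  then obtain p where p: "p \<in> corners" "zigzag_of p \<in> \<tau>" "fst p = e" "w = reading p" by (auto simp: Q_def)
  then show "w \<in> occurrences \<tau> e"
    using reading_in_zigzag[of p] reading_props(1)[OF p(1)] unfolding occurrences_def by blast
qed

text \<open>One zigzag passage joins \<open>eu\<close>, \<open>e\<close> and \<open>ev'\<close>; the
  two pairs belong to its two readings, of which the orientation chooses one.\<close>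

lemma diamond_Q:
  assumes d: "diamond e F F' u v w w' eu ev eu' ev'"
  shows "(e, eu) \<in> Q \<longleftrightarrow> (e, ev') \<notin> Q"
proof -
  note t = diamond_direction(3,4)[OF d]
  have "(e, eu) \<in> Q \<longleftrightarrow> (ev', e) \<in> Q" using Q_T[OF t(2)] t(1) by simp
  then show ?thesis using Q_swap[OF t(2)] by simp
qed

lemma types_of_two_occurrences:
  assumes o: "occurrences \<tau> e = {w1, w2}" and ne: "w1 \<noteq> w2"
  shows "edge_type_I V \<tau> e \<longleftrightarrow> direction V w2 = prod.swap (direction V w1)"
    "edge_type_II V \<tau> e \<longleftrightarrow> direction V w2 = direction V w1"
    "direction V w1 = d \<Longrightarrow> direction V w2 = d \<Longrightarrow> edge_direction V \<tau> e = d"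
proof -
  show "edge_type_I V \<tau> e \<longleftrightarrow> direction V w2 = prod.swap (direction V w1)"
    unfolding edge_type_I_def o using ne by (metis doubleton_eq_iff swap_swap)
  show "edge_type_II V \<tau> e \<longleftrightarrow> direction V w2 = direction V w1"
    unfolding edge_type_II_def o using ne by (metis doubleton_eq_iff)
  assume "direction V w1 = d" "direction V w2 = d"
  then show "edge_direction V \<tau> e = d" unfolding edge_direction_def o by auto
qed

text \<open>Two passages cross \<open>e\<close>: one joins \<open>eu\<close> and \<open>ev'\<close>,
  the other \<open>ev\<close> and \<open>eu'\<close>, and \<open>Q\<close> contains one reading of
  each. Going on to \<open>eu\<close> or \<open>eu'\<close> traverses \<open>e\<close> towards
  \<open>u\<close>, going on to \<open>ev\<close> or \<open>ev'\<close> towards \<open>v\<close>. So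
  \<open>e\<close> is of type I precisely if both chosen passages leave into the same face.\<close>

lemma diamond_types:
  assumes d: "diamond e F F' u v w w' eu ev eu' ev'"
  shows "edge_type_I V \<tau> e \<longleftrightarrow> ((e, eu) \<in> Q \<longleftrightarrow> (e, ev) \<in> Q)"
    "edge_type_II V \<tau> e \<longleftrightarrow> ((e, eu) \<in> Q \<longleftrightarrow> (e, ev) \<notin> Q)"
    "(e, eu) \<in> Q \<Longrightarrow> (e, ev) \<notin> Q \<Longrightarrow> edge_direction V \<tau> e = (v, u)"
proof -
  note df = diamond_flip[OF d] and dx = diamond_exchange[OF d]
  note dfx = diamond_flip[OF dx]
  note dir = diamond_direction(1)[OF d] diamond_direction(1)[OF df]
    diamond_direction(1)[OF dx] diamond_direction(1)[OF dfx]
  note cor = diamond_direction(2)[OF d] diamond_direction(2)[OF df]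
    diamond_direction(2)[OF dx] diamond_direction(2)[OF dfx]
  have u: "(e, eu) \<in> Q \<longleftrightarrow> (e, ev') \<notin> Q" and v: "(e, ev) \<in> Q \<longleftrightarrow> (e, eu') \<notin> Q"
    by (rule diamond_Q[OF d], rule diamond_Q[OF df])
  have uv: "u \<noteq> v" using d by (simp add: diamond_def triangle_def)
  have ne: "ev \<noteq> eu" "ev' \<noteq> eu'" "eu \<noteq> eu'" "ev \<noteq> ev'"
    using d diamond_facts(4-6)[OF d] by (auto simp add: diamond_def triangle_def)
  have inj: "reading (e, x) \<noteq> reading (e, y)" if "(e, x) \<in> corners" "(e, y) \<in> corners" "x \<noteq> y" for x y
    using inj_onD[OF inj_reading _ that(1,2)] that(3) by auto
  have "{p \<in> Q. fst p = e} = {p \<in> {(e, eu), (e, ev), (e, eu'), (e, ev')}. p \<in> Q}"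
  proof (intro equalityI subsetI)
    fix p assume p: "p \<in> {p \<in> Q. fst p = e}"
    then have "(e, snd p) \<in> corners" by (auto simp: Q_def)
    then have "snd p \<in> {eu, ev, eu', ev'}" unfolding diamond_corners[OF d] .
    then show "p \<in> {p \<in> {(e, eu), (e, ev), (e, eu'), (e, ev')}. p \<in> Q}" using p by (cases p) auto
  qed auto
  note Qe = this
  have occ: "occurrences \<tau> e = {reading (e, x), reading (e, y)}"
    if "{p \<in> {(e, eu), (e, ev), (e, eu'), (e, ev')}. p \<in> Q} = {(e, x), (e, y)}" for x y
    unfolding occurrences_eq Qe that by simp
  have goal: "(edge_type_I V \<tau> e \<longleftrightarrow> ((e, eu) \<in> Q \<longleftrightarrow> (e, ev) \<in> Q)) \<and>
    (edge_type_II V \<tau> e \<longleftrightarrow> ((e, eu) \<in> Q \<longleftrightarrow> (e, ev) \<notin> Q)) \<and>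
    ((e, eu) \<in> Q \<and> (e, ev) \<notin> Q \<longrightarrow> edge_direction V \<tau> e = (v, u))"
  proof (cases "(e, eu) \<in> Q"; cases "(e, ev) \<in> Q")
    assume q: "(e, eu) \<in> Q" "(e, ev) \<in> Q"
    then have "occurrences \<tau> e = {reading (e, eu), reading (e, ev)}"
      using u v by (intro occ) auto
    from types_of_two_occurrences(1,2)[OF this] show ?thesis
      using q dir uv inj[OF cor(1,2)] ne by auto
  next
    assume q: "(e, eu) \<in> Q" "(e, ev) \<notin> Q"
    then have "occurrences \<tau> e = {reading (e, eu), reading (e, eu')}"
      using u v by (intro occ) auto
    from types_of_two_occurrences[OF this] show ?thesis
      using q dir uv inj[OF cor(1,3)] ne by auto
  next
    assume q: "(e, eu) \<notin> Q" "(e, ev) \<in> Q"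
    then have "occurrences \<tau> e = {reading (e, ev), reading (e, ev')}"
      using u v by (intro occ) auto
    from types_of_two_occurrences(1,2)[OF this] show ?thesis
      using q dir uv inj[OF cor(2,4)] ne by auto
  next
    assume q: "(e, eu) \<notin> Q" "(e, ev) \<notin> Q"
    then have "occurrences \<tau> e = {reading (e, eu'), reading (e, ev')}"
      using u v by (intro occ) auto
    from types_of_two_occurrences(1,2)[OF this] show ?thesis
      using q dir uv inj[OF cor(3,4)] ne by auto
  qed
  then show "edge_type_I V \<tau> e \<longleftrightarrow> ((e, eu) \<in> Q \<longleftrightarrow> (e, ev) \<in> Q)"
    "edge_type_II V \<tau> e \<longleftrightarrow> ((e, eu) \<in> Q \<longleftrightarrow> (e, ev) \<notin> Q)" by blast+
  show "(e, eu) \<in> Q \<Longrightarrow> (e, ev) \<notin> Q \<Longrightarrow> edge_direction V \<tau> e = (v, u)" using goal by blast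
qed

lemma triangle_types:
  assumes "triangle F e ev eu w u v"
  shows "edge_type_I V \<tau> e \<longleftrightarrow> ((e, eu) \<in> Q \<longleftrightarrow> (e, ev) \<in> Q)"
    "edge_type_II V \<tau> e \<longleftrightarrow> ((e, eu) \<in> Q \<longleftrightarrow> (e, ev) \<notin> Q)"
    "(e, eu) \<in> Q \<Longrightarrow> (e, ev) \<notin> Q \<Longrightarrow> edge_direction V \<tau> e = (v, u)"
proof -
  obtain F' w' eu' ev' where d: "diamond e F F' u v w w' eu ev eu' ev'" using diamond_ex[OF assms] .
  show "edge_type_I V \<tau> e \<longleftrightarrow> ((e, eu) \<in> Q \<longleftrightarrow> (e, ev) \<in> Q)"
    "edge_type_II V \<tau> e \<longleftrightarrow> ((e, eu) \<in> Q \<longleftrightarrow> (e, ev) \<notin> Q)"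
    "(e, eu) \<in> Q \<Longrightarrow> (e, ev) \<notin> Q \<Longrightarrow> edge_direction V \<tau> e = (v, u)"
    by (rule diamond_types[OF d])+
qed

lemma type_II_iff: assumes "e \<in> E" shows "edge_type_II V \<tau> e \<longleftrightarrow> \<not> edge_type_I V \<tau> e"
proof -
  obtain F where "F \<in> faces" "e \<in> edges_of F" using edge_in_face[OF assms] .
  then obtain e2 e3 a b c where "triangle F e e2 e3 a b c" by (rule triangle_first)
  then show ?thesis using triangle_types by simp
qed

lemma triangle_swap_Q: "triangle F e1 e2 e3 a b c \<Longrightarrow> (e2, e1) \<in> Q \<longleftrightarrow> (e1, e2) \<notin> Q"
proof -
  assume "triangle F e1 e2 e3 a b c"
  then have "F \<in> faces" "e1 \<in> edges_of F" "e2 \<in> edges_of F" "e1 \<noteq> e2"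
    by (simp_all add: triangle_def)
  then have "(e1, e2) \<in> corners" unfolding corners_def by blast
  then show ?thesis using Q_swap[of "(e1, e2)"] by simp
qed

definition src :: "'a set \<Rightarrow> 'a" where "src e = fst (edge_direction V \<tau> e)"
definition tgt :: "'a set \<Rightarrow> 'a" where "tgt e = snd (edge_direction V \<tau> e)"

text \<open>The components are packed into one tuple so that a single choice yields them all,
  consistently with the chosen pairs.\<close>

definition flow_face :: "'a set \<Rightarrow> 'a set \<times> 'a set \<times> 'a set \<times> 'a \<Rightarrow> bool" where
  "flow_face F = (\<lambda>(a, b, c, z). triangle F a b c z (tgt a) (src a) \<and>
     edge_type_II V \<tau> a \<and> edge_type_I V \<tau> b \<and> edge_type_I V \<tau> c \<and>
     (b, c) \<in> Q \<and> (b, a) \<in> Q \<and> (a, c) \<in> Q)"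

text \<open>The choice at the corner of \<open>b\<close> and \<open>c\<close> settles the other two:
  type I at \<open>b\<close> carries it to \<open>(b, a)\<close>, and type I at \<open>c\<close>
  carries the rejection of \<open>(c, b)\<close> to \<open>(c, a)\<close>. Both then fix the
  direction of \<open>a\<close>.\<close>

lemma flow_face_from:
  assumes t: "triangle F a b c z y x" and ty: "edge_type_II V \<tau> a" "edge_type_I V \<tau> b" "edge_type_I V \<tau> c"
    and bc: "(b, c) \<in> Q"
  shows "flow_face F (a, b, c, z)"
proof -
  note t2 = triangle_rotate[OF t] and t3 = triangle_rotate[OF triangle_rotate[OF t]]
  have ba: "(b, a) \<in> Q" using triangle_types(1)[OF t2] ty(2) bc by simp
  have "(c, b) \<notin> Q" using triangle_swap_Q[OF t2] bc by simp
  then have "(c, a) \<notin> Q" using triangle_types(1)[OF t3] ty(3) by simp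
  then have ac: "(a, c) \<in> Q" using triangle_swap_Q[OF triangle_flip[OF t]] by simp
  have "(a, b) \<notin> Q" using triangle_swap_Q[OF t] ba by simp
  then have "edge_direction V \<tau> a = (x, y)" using triangle_types(3)[OF t ac] by simp
  then show ?thesis using t ty bc ba ac by (simp add: flow_face_def src_def tgt_def)
qed

lemma flow_face_ex:
  assumes F: "F \<in> faces" and ty: "face_type_I V E \<tau> F" shows "\<exists>q. flow_face F q"
proof -
  have "card {e \<in> edges_of F. edge_type_II V \<tau> e} = 1" using ty by (simp add: face_type_I_def)
  then obtain a where a: "{e \<in> edges_of F. edge_type_II V \<tau> e} = {a}" by (auto simp: card_1_singleton_iff)
  then have "a \<in> edges_of F" "edge_type_II V \<tau> a" by blast+
  obtain b c z y x where t: "triangle F a b c z y x" using triangle_first[OF F \<open>a \<in> edges_of F\<close>] .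
  have "b \<in> edges_of F" "c \<in> edges_of F" "b \<noteq> a" "c \<noteq> a" "b \<in> E" "c \<in> E"
    using t by (auto simp: triangle_def)
  then have bc: "edge_type_I V \<tau> b" "edge_type_I V \<tau> c" using a type_II_iff by blast+
  show ?thesis
  proof (cases "(b, c) \<in> Q")
    case True
    then show ?thesis using flow_face_from[OF t \<open>edge_type_II V \<tau> a\<close> bc] by blast
  next
    case False
    then have "(c, b) \<in> Q" using triangle_swap_Q[OF triangle_rotate[OF t]] by simp
    then show ?thesis
      using flow_face_from[OF triangle_flip[OF t] \<open>edge_type_II V \<tau> a\<close> bc(2,1)] by blast
  qed
qed

text \<open>At an edge of type I both chosen passages leave into the same face, so whether
  \<open>(e, x)\<close> is in \<open>Q\<close> depends only on the face containing \<open>x\<close>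
  and flips across \<open>e\<close>.\<close>

lemma flow_across:
  assumes F: "F \<in> faces" "F' \<in> faces" "F \<noteq> F'" and e: "e \<in> edges_of F" "e \<in> edges_of F'"
    and ty: "edge_type_I V \<tau> e"
    and x: "x \<in> edges_of F" "x \<noteq> e" and y: "y \<in> edges_of F'" "y \<noteq> e"
  shows "(e, x) \<in> Q \<longleftrightarrow> (e, y) \<notin> Q"
proof -
  obtain ev eu w u v where t: "triangle F e ev eu w u v" using triangle_first[OF F(1) e(1)] .
  obtain G w' eu' ev' where d: "diamond e F G u v w w' eu ev eu' ev'" using diamond_ex[OF t] .
  note f = diamond_facts[OF d]
  have "F' \<in> {F, G}" unfolding f(1)[symmetric] using F(2) e(2) by simp
  then have G: "G = F'" using F(3) by auto
  have "x \<in> {eu, ev}" using x unfolding f(3) by auto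
  moreover have "y \<in> {eu', ev'}" using y unfolding G[symmetric] f(4) by auto
  moreover have "(e, eu) \<in> Q \<longleftrightarrow> (e, ev) \<in> Q" using diamond_types(1)[OF d] ty by simp
  moreover have "(e, eu) \<in> Q \<longleftrightarrow> (e, ev') \<notin> Q" "(e, ev) \<in> Q \<longleftrightarrow> (e, eu') \<notin> Q"
    by (rule diamond_Q[OF d], rule diamond_Q[OF diamond_flip[OF d]])
  ultimately show ?thesis by auto
qed

end

section \<open>The flow of a z-orientation\<close>

locale z_flow = z_oriented +
  assumes faces_type_I: "F \<in> faces \<Longrightarrow> face_type_I V E \<tau> F"
begin

definition parts :: "'a set \<Rightarrow> 'a set \<times> 'a set \<times> 'a set \<times> 'a" where
  "parts F = (SOME q. flow_face F q)"
definition A :: "'a set \<Rightarrow> 'a set" where "A F = fst (parts F)"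
definition B :: "'a set \<Rightarrow> 'a set" where "B F = fst (snd (parts F))"
definition C :: "'a set \<Rightarrow> 'a set" where "C F = fst (snd (snd (parts F)))"
definition apex :: "'a set \<Rightarrow> 'a" where "apex F = snd (snd (snd (parts F)))"

lemma parts:
  assumes "F \<in> faces"
  shows "triangle F (A F) (B F) (C F) (apex F) (tgt (A F)) (src (A F))"
    "edge_type_II V \<tau> (A F)" "edge_type_I V \<tau> (B F)" "edge_type_I V \<tau> (C F)"
    "(B F, C F) \<in> Q" "(B F, A F) \<in> Q" "(A F, C F) \<in> Q"
proof -
  have "flow_face F (parts F)"
    unfolding parts_def using flow_face_ex[OF assms faces_type_I[OF assms]] by (rule someI_ex)
  then have "flow_face F (A F, B F, C F, apex F)" by (simp add: A_def B_def C_def apex_def)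
  then show "triangle F (A F) (B F) (C F) (apex F) (tgt (A F)) (src (A F))"
    "edge_type_II V \<tau> (A F)" "edge_type_I V \<tau> (B F)" "edge_type_I V \<tau> (C F)"
    "(B F, C F) \<in> Q" "(B F, A F) \<in> Q" "(A F, C F) \<in> Q" by (simp_all add: flow_face_def)
qed

lemma parts_edges:
  assumes "F \<in> faces"
  shows "edges_of F = {A F, B F, C F}" "A F \<in> E" "B F \<in> E" "C F \<in> E" "A F \<noteq> B F" "B F \<noteq> C F" "C F \<noteq> A F"
    "(C F, B F) \<notin> Q"
  using parts(1)[OF assms] triangle_swap_Q[OF triangle_rotate[OF parts(1)[OF assms]]] parts(5)[OF assms]
  by (simp_all add: triangle_def)

text \<open>If two faces were entered through one edge, the chosen passages would leave it into both
  faces, against \<open>flow_across\<close>.\<close>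

lemma same_B: assumes "F \<in> faces" "G \<in> faces" "B F = B G" shows "F = G"
proof (rule ccontr)
  assume ne: "F \<noteq> G"
  have "(B F, C F) \<in> Q \<longleftrightarrow> (B F, C G) \<notin> Q"
    by (rule flow_across[OF assms(1,2) ne])
      (use parts_edges[OF assms(1)] parts_edges[OF assms(2)] parts(3)[OF assms(1)] assms(3) in auto)
  then show False using parts(5)[OF assms(1)] parts(5)[OF assms(2)] assms(3) by simp
qed

lemma same_C: assumes "F \<in> faces" "G \<in> faces" "C F = C G" shows "F = G"
proof (rule ccontr)
  assume ne: "F \<noteq> G"
  have "(C F, B F) \<in> Q \<longleftrightarrow> (C F, B G) \<notin> Q"
    by (rule flow_across[OF assms(1,2) ne])
      (use parts_edges[OF assms(1)] parts_edges[OF assms(2)] parts(4)[OF assms(1)] assms(3) in auto)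
  then show False using parts_edges(8)[OF assms(1)] parts_edges(8)[OF assms(2)] assms(3) by simp
qed

lemma type_I_edge:
  assumes F: "F \<in> faces" and e: "e \<in> edges_of F" "edge_type_I V \<tau> e" shows "e = B F \<or> e = C F"
proof -
  have "e \<noteq> A F" using type_II_iff[OF parts_edges(2)[OF F]] parts(2)[OF F] e(2) by auto
  then show ?thesis using e(1) unfolding parts_edges(1)[OF F] by simp
qed

sublocale flow_triangulation M V E A B C apex src tgt
proof
  show "F \<in> faces \<Longrightarrow> triangle F (A F) (B F) (C F) (apex F) (tgt (A F)) (src (A F))" for F
    by (rule parts(1))
  show "inj_on B faces" by (rule inj_onI) (rule same_B)
  show "inj_on C faces" by (rule inj_onI) (rule same_C)
  \<comment> \<open>An edge of type I is an entry or exit edge of each of its two faces; it cannot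
    enter both or leave both, so it does one each.\<close>
  show "B ` faces = C ` faces"
  proof (intro equalityI subsetI)
    fix e assume "e \<in> B ` faces"
    then obtain F where F: "F \<in> faces" "e = B F" by blast
    have eF: "e \<in> edges_of F" by (simp add: parts_edges(1)[OF F(1)] F(2))
    obtain G where G: "G \<in> faces" "G \<noteq> F" "e \<in> edges_of G" using other_face[OF F(1) eF] by metis
    have "e = B G \<or> e = C G" using type_I_edge[OF G(1,3)] parts(3)[OF F(1)] F(2) by simp
    then have "e = C G" using same_B[OF F(1) G(1)] F(2) G(2) by auto
    then show "e \<in> C ` faces" using G(1) by blast
  next
    fix e assume "e \<in> C ` faces"
    then obtain F where F: "F \<in> faces" "e = C F" by blast
    have eF: "e \<in> edges_of F" by (simp add: parts_edges(1)[OF F(1)] F(2))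
    obtain G where G: "G \<in> faces" "G \<noteq> F" "e \<in> edges_of G" using other_face[OF F(1) eF] by metis
    have "e = B G \<or> e = C G" using type_I_edge[OF G(1,3)] parts(4)[OF F(1)] F(2) by simp
    then have "e = B G" using same_C[OF F(1) G(1)] F(2) G(2) by auto
    then show "e \<in> B ` faces" using G(1) by blast
  qed
  show "A ` faces \<inter> B ` faces = {}"
  proof (rule ccontr)
    assume "A ` faces \<inter> B ` faces \<noteq> {}"
    then obtain F G where FG: "F \<in> faces" "G \<in> faces" "A F = B G" by blast
    then show False using parts(2)[OF FG(1)] parts(3)[OF FG(2)] type_II_iff[OF parts_edges(2)[OF FG(1)]] by simp
  qed
qed

lemma type_II_A: assumes "e \<in> E" shows "edge_type_II V \<tau> e \<longleftrightarrow> e \<in> A ` faces"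
proof
  assume II: "edge_type_II V \<tau> e"
  show "e \<in> A ` faces" using assms
  proof (cases rule: edge_cases)
    case (2 F)
    then have "edge_type_I V \<tau> e" using parts(3) by simp
    then show ?thesis using II type_II_iff[OF assms] by simp
  qed simp
next
  assume "e \<in> A ` faces"
  then show "edge_type_II V \<tau> e" using parts(2) by blast
qed

lemma Gamma_II_eq: "Gamma_II V E \<tau> = flow_digraph"
proof -
  have "{e \<in> E. edge_type_II V \<tau> e} = A ` faces" using type_II_A A_subset_E by blast
  moreover have "vertex_type_I V E \<tau> v \<longleftrightarrow> (\<forall>e\<in>A ` faces. v \<notin> e)" for v
    unfolding vertex_type_I_def using type_II_iff type_II_A A_subset_E by blast
  then have "{v \<in> V. \<not> vertex_type_I V E \<tau> v} = V2" unfolding V2_def by auto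
  moreover have "(\<lambda>e. fst (edge_direction V \<tau> e)) = src" "(\<lambda>e. snd (edge_direction V \<tau> e)) = tgt"
    by (auto simp: src_def tgt_def)
  ultimately show ?thesis unfolding Gamma_II_def flow_digraph_def by simp
qed

section \<open>Homogeneity and the apex\<close>

lemma homogeneous_if_apex_inner:
  assumes inner: "\<forall>F\<in>faces. apex F \<notin> V2" and Z: "Z \<in> zigzags M V E"
  shows "homogeneous V \<tau> Z"
proof -
  interpret D: disk_flow M V E A B C apex src tgt by unfold_locales (use inner in blast)
  obtain c where c: "c \<in> corners" "Z = zigzag_of c" using Z unfolding zigzags_eq by blast
  obtain p where p: "p \<in> D.starts" "zigzag_of c = zigzag_of p \<or> zigzag_of c = rev ` zigzag_of p"
    using D.corner_zigzag[OF c(1)] .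
  have pc: "p \<in> corners" using p(1) D.starts_corners by blast
  have n: "3 dvd period p" "1 < period p" by (rule D.period_starts[OF p(1)], rule period_gt_1[OF pc])
  have II: "edge_type_II V \<tau> (walk p i) \<longleftrightarrow> 3 dvd i" "edge_type_I V \<tau> (walk p i) \<longleftrightarrow> \<not> 3 dvd i" for i
    using D.walk_type[OF p(1)] type_II_A[OF walk_edge[OF pc]] type_II_iff[OF walk_edge[OF pc]] by auto
  from p(2) show ?thesis
  proof
    assume "zigzag_of c = zigzag_of p"
    then have "reading p \<in> Z" using c(2) reading_in_zigzag by simp
    then show ?thesis unfolding homogeneous_def
      by (rule bexI[rotated]) (use n II in \<open>simp add: reading_def\<close>)
  next
    assume "zigzag_of c = rev ` zigzag_of p"
    \<comment> \<open>The reading shifted by one ends with the initial edge of type II, so its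
      reverse begins with that edge, as the pattern requires.\<close>
    moreover have "reading (T p) \<in> zigzag_of p" using reading_in_zigzag zigzag_of_T[OF pc] by metis
    ultimately have "rev (reading (T p)) \<in> Z" using c(2) by blast
    moreover have len: "length (rev (reading (T p))) = period p" by (simp add: reading_def period_T[OF pc])
    moreover have "rev (reading (T p)) ! i = walk p (period p - i)" if "i < period p" for i
      using that walk_shift[of p "period p - Suc i" 1]
      by (simp add: reading_def rev_nth period_T[OF pc] Suc_diff_Suc)
    moreover have "3 dvd period p - i \<longleftrightarrow> 3 dvd i" if "i < period p" for i
      using n(1) that by presburger
    ultimately show ?thesis unfolding homogeneous_def
      by (intro bexI[of _ "rev (reading (T p))"]) (use n II in simp_all)
  qed
qed

text \<open>A change of apex puts edges of type II two places apart. As homogeneity only provides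
  some reading with the pattern, the indices have to be transferred from that reading back to this
  place.\<close>

lemma apex_inner_if_homogeneous:
  assumes hom: "\<forall>Z\<in>zigzags M V E. homogeneous V \<tau> Z" and F: "F \<in> faces"
  shows "apex F \<notin> V2"
proof (rule apex_inner_if_constant[OF _ F])
  fix F assume F: "F \<in> faces"
  show "apex (next_face F) = apex F"
  proof (rule ccontr)
    assume ne: "apex (next_face F) \<noteq> apex F"
    define p where "p = (A F, C F)"
    have p: "p \<in> corners" unfolding p_def by (rule flow_corners(1)[OF F])
    have "T p = (C F, A (next_face F))" unfolding p_def by (rule T_eq[OF zigzag_step_A_C_A[OF F ne]])
    then have w: "walk p 0 = A F" "walk p 2 = A (next_face F)"
      using funpow_T_walk[OF p, of 1] by (simp_all add: p_def walk_def numeral_2_eq_2)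
    have "zigzag_of p \<in> zigzags M V E" using p zigzags_eq by blast
    then have "homogeneous V \<tau> (zigzag_of p)" using hom by blast
    then obtain r where r: "r \<in> zigzag_of p" "3 dvd length r"
      "\<And>i. i < length r \<Longrightarrow> if 3 dvd i then edge_type_II V \<tau> (r ! i) else edge_type_I V \<tau> (r ! i)"
      unfolding homogeneous_def by blast
    obtain k where k: "r = reading ((T ^^ k) p)" using r(1) unfolding zigzag_of_def by blast
    define q where "q = (T ^^ k) p"
    have q: "q \<in> corners" unfolding q_def by (rule funpow_T[OF p])
    have len: "length r = period q" by (simp add: k q_def reading_def)
    have nth: "r ! i = walk q i" if "i < period q" for i using that by (simp add: k q_def reading_def)
    \<comment> \<open>Divisibility of the period by 3 extends the pattern of one reading to all
      indices.\<close>
    have pattern: "edge_type_II V \<tau> (walk q i) \<longleftrightarrow> 3 dvd i" for i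
    proof -
      define j where "j = i mod period q"
      have j: "j < period q" unfolding j_def using period(1)[OF q] by simp
      have "(T ^^ i) q = (T ^^ j) q" unfolding j_def using funpow_mod_eq[OF period(2)[OF q]] by metis
      then have wj: "walk q i = r ! j" using nth[OF j] by (simp add: walk_def)
      have "if 3 dvd j then edge_type_II V \<tau> (walk q i) else edge_type_I V \<tau> (walk q i)"
        unfolding wj using r(3) j len by simp
      then have "edge_type_II V \<tau> (walk q i) \<longleftrightarrow> 3 dvd j"
        using type_II_iff[OF walk_edge[OF q]] by (auto split: if_splits)
      also have "3 dvd j \<longleftrightarrow> 3 dvd i" unfolding j_def using r(2) len by (simp add: dvd_mod_iff)
      finally show ?thesis .
    qed
    \<comment> \<open>A forward shift that undoes the \<open>k\<close> steps from \<open>p\<close>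
      to \<open>q\<close>: together they make \<open>k\<close> full periods.\<close>
    define s where "s = k * period p - k"
    have ks: "s + k = k * period p" unfolding s_def using period(1)[OF p] by (cases "period p") auto
    have shifted: "walk q (s + i) = walk p i" for i
    proof -
      have "walk q (s + i) = walk p (i + k * period p)"
        unfolding q_def walk_shift[symmetric] using ks by (simp add: ac_simps)
      also have "(T ^^ (k * period p)) p = p"
        using funpow_mod_eq[OF period(2)[OF p], of "k * period p"] by simp
      then have "walk p (i + k * period p) = walk p i" by (simp add: walk_shift)
      finally show ?thesis .
    qed
    have "edge_type_II V \<tau> (walk p 0)" "edge_type_II V \<tau> (walk p 2)"
      unfolding w by (rule parts(2)[OF F], rule parts(2)[OF next_face(1)[OF F]])
    then have "3 dvd s + 0" "3 dvd s + 2" using pattern shifted by metis+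
    then show False by presburger
  qed
qed

end

theorem theorem1:
  fixes M V :: "'a::t2_space set"
    and E :: "'a set set"
    and \<tau> :: "'a set list set set"
    and G :: "('a, 'a set) pre_digraph"
  assumes "closed_surface M"
    and "surface_triangulation M V E"
    and "z_orientation M V E \<tau>"
    and "\<forall>F\<in>graph_faces M V E. face_type_I V E \<tau> F"
    and "G = Gamma_II V E \<tau>"
  shows "((\<forall>Z\<in>zigzags M V E. homogeneous V \<tau> Z) \<longleftrightarrow>
          closed_two_cell_embedding M (verts G) (arcs G) \<and> digraph G \<and> eulerian G \<and>
          (\<forall>F\<in>graph_faces M (verts G) (arcs G). directed_cycle_boundary G F))
       \<and> (closed_two_cell_embedding M (verts G) (arcs G) \<and> digraph G \<and> eulerian G \<and>
          (\<forall>F\<in>graph_faces M (verts G) (arcs G). directed_cycle_boundary G F)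
          \<longleftrightarrow>
          (\<forall>C\<in>components (M - (verts G \<union> \<Union>(arcs G))). C homeomorphic ball (0::complex) 1))"
proof -
  interpret z_flow M V E \<tau> by unfold_locales (use assms in auto)
  have G: "G = flow_digraph" "verts G = V2" "arcs G = A ` faces"
    unfolding assms(5) Gamma_II_eq by (simp_all add: flow_digraph_def)
  have comps: "graph_faces M (verts G) (arcs G) = components (M - (verts G \<union> \<Union>(arcs G)))"
    by (rule graph_faces_def)
  let ?one = "\<forall>Z\<in>zigzags M V E. homogeneous V \<tau> Z"
  let ?two = "closed_two_cell_embedding M (verts G) (arcs G) \<and> digraph G \<and> eulerian G \<and>
    (\<forall>F\<in>graph_faces M (verts G) (arcs G). directed_cycle_boundary G F)"
  let ?three = "\<forall>C\<in>components (M - (verts G \<union> \<Union>(arcs G))). C homeomorphic ball (0::complex) 1"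
  \<comment> \<open>The pivot of the equivalence: condition (1) is compared with it directly, while
    it implies (2), which contains (3), which implies it again.\<close>
  let ?inner = "\<forall>F\<in>faces. apex F \<notin> V2"
  have "?one \<longleftrightarrow> ?inner"
    using homogeneous_if_apex_inner apex_inner_if_homogeneous by blast
  moreover have "?two" if inner: ?inner
  proof -
    interpret D: disk_flow M V E A B C apex src tgt by unfold_locales (use inner in blast)
    have "directed_cycle_boundary G F" if "F \<in> graph_faces M (verts G) (arcs G)" for F
    proof -
      have "F \<in> components (M - skeleton)" using that comps unfolding G(2,3) by simp
      then show ?thesis unfolding G(1) using D.component_region by blast
    qed
    moreover have "digraph G" "eulerian G"
      unfolding G(1) by (rule flow_digraph, rule D.eulerian_flow_digraph)
    ultimately show ?thesis using D.closed_two_cell G(2,3) by simp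
  qed
  moreover have "?three" if ?two
    using that unfolding closed_two_cell_embedding_def two_cell_embedding_def comps by blast
  moreover have "?inner" if ?three
    using apex_inner_if_disks that unfolding G(2,3) by blast
  ultimately show ?thesis by blast
qed

end
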